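(* Let $m>1$, $T>0$, and let $\Omega=(X_L,X_R)\subset\mathbb{R}$ be a bounded interval. Assume that the initial function $f_0$ is positive and bounded on $\overline\Omega$, i.e. there are constants $b_f,B_f$ with $0<b_f\le f_0(X)\le B_f$. Let $x_e=x_e(X,t)$ be the exact solution, with enough regularity, on $\overline\Omega\times[0,T]$ of the trajectory problem $$\frac{f_0(X)}{m\big(\frac{f_0(X)}{\partial_X x}\big)^{m-1}}\,\partial_t x=-\partial_X\Big(\frac{f_0(X)}{\partial_X x}\Big),\quad X\in\Omega,\ t>0,\qquad x|_{\partial\Omega}=X|_{\partial\Omega},\qquad x(X,0)=X .$$ For $N,M\in\mathbb{N}^+$ put $\tau=T/N$, $h=|\Omega|/M$, $t_n=n\tau$, $X_i=X_L+ih$, and let $x_h^n=(x_{h_0}^n,\dots,x_{h_M}^n)\in\mathcal{Q}$, $n=0,\dots,N$, be the numerical solution: $x_{h_i}^0=X_i$ and, for $n=0,\dots,N-1$, $x_h^{n+1}\in\mathcal{Q}$ satisfies $$\frac{f_0(X_i)}{m\big(\frac{f_0(X)}{\widetilde D_h x_h^n}\big)_i^{m-1}}\cdot\frac{x_{h_i}^{n+1}-x_{h_i}^n}{\tau}=-d_h\Big(\frac{f_0(X)}{D_h x_h^{n+1}}\Big)_i,\quad 1\le i\le M-1,\qquad x_{h_0}^{n+1}=X_0,\ x_{h_M}^{n+1}=X_M .$$ Set $x_{e_i}^n=x_e(X_i,t_n)$, with $x_e^n\in\mathcal{Q}$, and define the error $e_i^n=x_{e_i}^n-x_{h_i}^n$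 for $0\le i\le M$, $0\le n\le N$. Then there is a positive constant $C$, independent of $h$, $\tau$ and $n$, such that for all $n=0,\dots,N$: (1) $e^n=(e_0^n,\dots,e_M^n)$ satisfies $\|e^n\|_2\le C(\tau+h^2)$; (2) $\widetilde D_h e^n=(\widetilde D_h e_0^n,\dots,\widetilde D_h e_M^n)$ satisfies $\|\widetilde D_h e^n\|_2\le C(\tau+h^2)$. Moreover, the error between the numerical density $f_h^n$ and the exact density $f_e^n$ (the solution of the porous medium problem) satisfies $$\|f_h^n-f_e^n\|_2\le C(\tau+h^2),\qquad n=0,\dots,N .$$
   Context: Grid: $X_r=X_L+rh$ for integer and half-integer $r$ (so $X_0=X_L$, $X_M=X_R$). $\mathcal{E}_M$ is the space of real functions on $\{X_i: i=0,\dots,M\}$, written $l_i=l(X_i)$, and $\mathcal{C}_M$ is the space of real functions on $\{X_{i-1/2}: i=1,\dots,M\}$, written $\phi_{i-1/2}=\phi(X_{i-1/2})$. Difference operators: $D_h:\mathcal{E}_M\to\mathcal{C}_M$, $(D_h l)_{i-1/2}=(l_i-l_{i-1})/h$, $1\le i\le M$; $(d_h\phi)_i=(\phi_{i+1/2}-\phi_{i-1/2})/h$ for $\phi\in\mathcal{C}_M$, $1\le i\le M-1$; $\widetilde D_h:\mathcal{E}_M\to\mathcal{E}_M$, $(\widetilde D_h l)_i=(l_{i+1}-l_{i-1})/(2h)$ for $1\le i\le M-1$, $(\widetilde D_h l)_0=(4l_1-l_2-3l_0)/(2h)$, $(\widetilde D_h l)_M=(l_{M-2}-4l_{M-1}+3l_M)/(2h)$.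 Products and quotients of grid functions are pointwise; in $f_0(X)/D_h x_h^{n+1}$, $f_0$ is evaluated at the half-integer points $X_{i-1/2}$, and in $f_0(X)/\widetilde D_h x_h^n$ at the points $X_i$. Admissible set: $\mathcal{Q}=\{l\in\mathcal{E}_M : l_{i-1}<l_i,\ 1\le i\le M;\ l_0=X_0,\ l_M=X_M\}$. Norm on $\mathcal{E}_M$: $\langle l,g\rangle=h\big(\tfrac12 l_0g_0+\sum_{i=1}^{M-1}l_ig_i+\tfrac12 l_Mg_M\big)$ and $\|l\|_2^2=\langle l,l\rangle$. The porous medium problem is: $\partial_t f+\partial_x(f\mathbf{v})=0$ and $f\mathbf{v}=-\partial_x(f^m)$ for $x\in\Omega$, $t>0$; $f(x,0)=f_0(x)$ on $\Omega$; $\partial_x f=0$ on $\partial\Omega$, $t>0$. In Lagrangian coordinates its solution is $f(x_e(X,t),t)=f_0(X)/\partial_X x_e(X,t)$, where $\partial_X x_e>0$. The grid densities are $f_{e,i}^n=f_0(X_i)/\partial_X x_e(X_i,t_n)$ (the exact density along trajectories) and $f_{h,i}^n=f_0(X_i)/(\widetilde D_h x_h^n)_i$, $0\le i\le M$. "With enough regularity" means that $x_e$ has as many continuous derivatives on $\overline\Omega\times[0,T]$ as needed (the paper does not specify the number). The constant $C$ may depend on the problem data and on the exact solution ($m$, $\Omega$, $T$, $f_0$, $x_e$).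
   Formalization: The density estimate is stated only for h ≤ h0, with h0 > 0 depending on the problem data: on coarse grids the end-point value of D̃_h x_h can vanish, so the bound fails for all N, M. Estimate (2) and the density estimate need M ≥ 2, since D̃_h is undefined for M = 1. *)

theory Defs
  imports "HOL-Analysis.Analysis"
begin

text \<open>
  A function in \<open>\<E>\<^sub>M\<close> is a sequence \<open>nat \<Rightarrow> real\<close> of which only the values at
  \<open>0..M\<close> matter.  A function in \<open>\<C>\<^sub>M\<close> is a sequence of which only the values at
  \<open>1..M\<close> matter; index \<open>i\<close> stands for the half-integer point with index \<open>i - 1/2\<close>.
\<close>

definition grid_pt :: "real \<Rightarrow> real \<Rightarrow> real \<Rightarrow> real" where
  "grid_pt XL h r = XL + r * h"

definition D_h :: "real \<Rightarrow> (nat \<Rightarrow> real) \<Rightarrow> nat \<Rightarrow> real" where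
  "D_h h l i = (l i - l (i - 1)) / h"

definition d_h :: "real \<Rightarrow> (nat \<Rightarrow> real) \<Rightarrow> nat \<Rightarrow> real" where
  "d_h h \<phi> i = (\<phi> (i + 1) - \<phi> i) / h"

text \<open>The two boundary formulas need three grid points, i.e. \<open>M \<ge> 2\<close>.\<close>

definition Dt_h :: "real \<Rightarrow> nat \<Rightarrow> (nat \<Rightarrow> real) \<Rightarrow> nat \<Rightarrow> real" where
  "Dt_h h M l i =
     (if i = 0 then (4 * l 1 - l 2 - 3 * l 0) / (2 * h)
      else if i = M then (l (M - 2) - 4 * l (M - 1) + 3 * l M) / (2 * h)
      else (l (i + 1) - l (i - 1)) / (2 * h))"

definition admissible :: "real \<Rightarrow> real \<Rightarrow> nat \<Rightarrow> (nat \<Rightarrow> real) set" where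
  "admissible XL XR M =
     {l. (\<forall>i\<in>{1..M}. l (i - 1) < l i) \<and> l 0 = XL \<and> l M = XR}"

definition grid_inner :: "real \<Rightarrow> nat \<Rightarrow> (nat \<Rightarrow> real) \<Rightarrow> (nat \<Rightarrow> real) \<Rightarrow> real" where
  "grid_inner h M l g =
     h * (l 0 * g 0 / 2 + (\<Sum>i=1..M - 1. l i * g i) + l M * g M / 2)"

definition grid_norm :: "real \<Rightarrow> nat \<Rightarrow> (nat \<Rightarrow> real) \<Rightarrow> real" where
  "grid_norm h M l = sqrt (grid_inner h M l l)"

text \<open>
  Functions of \<open>(X, t)\<close> live on \<open>{XL..XR} \<times> {0..T}\<close>; partial derivatives are
  one-sided on its boundary.
\<close>

definition pd_X :: "real \<Rightarrow> real \<Rightarrow> (real \<Rightarrow> real \<Rightarrow> real) \<Rightarrow> real \<Rightarrow> real \<Rightarrow> real" where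
  "pd_X XL XR x X t = vector_derivative (\<lambda>Y. x Y t) (at X within {XL..XR})"

definition pd_t :: "real \<Rightarrow> (real \<Rightarrow> real \<Rightarrow> real) \<Rightarrow> real \<Rightarrow> real \<Rightarrow> real" where
  "pd_t T x X t = vector_derivative (\<lambda>s. x X s) (at t within {0..T})"

text \<open>
  \<open>C\<^sup>k\<close> regularity up to the boundary of the rectangle: \<open>G i j\<close> is the derivative
  of order \<open>i\<close> in \<open>X\<close> and \<open>j\<close> in \<open>t\<close>.
\<close>

definition Ck_rect :: "nat \<Rightarrow> real \<Rightarrow> real \<Rightarrow> real \<Rightarrow> (real \<Rightarrow> real \<Rightarrow> real) \<Rightarrow> bool" where
  "Ck_rect k XL XR T x \<longleftrightarrow>
     (\<exists>G :: nat \<Rightarrow> nat \<Rightarrow> real \<Rightarrow> real \<Rightarrow> real.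
        (\<forall>X\<in>{XL..XR}. \<forall>t\<in>{0..T}. G 0 0 X t = x X t) \<and>
        (\<forall>i j. i + j \<le> k \<longrightarrow>
           continuous_on ({XL..XR} \<times> {0..T}) (\<lambda>(X, t). G i j X t)) \<and>
        (\<forall>i j. i + j < k \<longrightarrow> (\<forall>X\<in>{XL..XR}. \<forall>t\<in>{0..T}.
           ((\<lambda>Y. G i j Y t) has_real_derivative G (Suc i) j X t) (at X within {XL..XR}) \<and>
           ((\<lambda>s. G i j X s) has_real_derivative G i (Suc j) X t) (at t within {0..T}))))"

definition trajectory_solution ::
  "real \<Rightarrow> real \<Rightarrow> real \<Rightarrow> real \<Rightarrow> (real \<Rightarrow> real) \<Rightarrow> (real \<Rightarrow> real \<Rightarrow> real) \<Rightarrow> bool" where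
  "trajectory_solution m T XL XR f0 x \<longleftrightarrow>
     (\<forall>X\<in>{XL..XR}. \<forall>t\<in>{0..T}. 0 < pd_X XL XR x X t) \<and>
     (\<forall>X\<in>{XL<..<XR}. \<forall>t\<in>{0<..T}.
        (\<lambda>Y. f0 Y / pd_X XL XR x Y t) differentiable at X \<and>
        f0 X / (m * (f0 X / pd_X XL XR x X t) powr (m - 1)) * pd_t T x X t
          = - deriv (\<lambda>Y. f0 Y / pd_X XL XR x Y t) X) \<and>
     (\<forall>t\<in>{0..T}. x XL t = XL \<and> x XR t = XR) \<and>
     (\<forall>X\<in>{XL..XR}. x X 0 = X)"

text \<open>\<open>xh n i\<close> is the numerical trajectory at time level \<open>n\<close> and grid index \<open>i\<close>.\<close>

definition numerical_solution ::
  "real \<Rightarrow> real \<Rightarrow> real \<Rightarrow> real \<Rightarrow> (real \<Rightarrow> real) \<Rightarrow> nat \<Rightarrow> nat \<Rightarrow> (nat \<Rightarrow> nat \<Rightarrow> real) \<Rightarrow> bool" where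
  "numerical_solution m T XL XR f0 N M xh \<longleftrightarrow>
     (let \<tau> = T / real N; h = (XR - XL) / real M; P = grid_pt XL h in
       (\<forall>i\<le>M. xh 0 i = P (real i)) \<and>
       (\<forall>n\<le>N. xh n \<in> admissible XL XR M) \<and>
       (\<forall>n<N. \<forall>i\<in>{1..M - 1}.
          f0 (P (real i)) / (m * (f0 (P (real i)) / Dt_h h M (xh n) i) powr (m - 1))
            * ((xh (Suc n) i - xh n i) / \<tau>)
          = - d_h h (\<lambda>j. f0 (P (real j - 1 / 2)) / D_h h (xh (Suc n)) j) i))"

definition exact_density ::
  "real \<Rightarrow> real \<Rightarrow> (real \<Rightarrow> real) \<Rightarrow> (real \<Rightarrow> real \<Rightarrow> real) \<Rightarrow> real \<Rightarrow> real \<Rightarrow> nat \<Rightarrow> real" where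
  "exact_density XL XR f0 xe h t i =
     f0 (grid_pt XL h (real i)) / pd_X XL XR xe (grid_pt XL h (real i)) t"

definition numerical_density ::
  "real \<Rightarrow> (real \<Rightarrow> real) \<Rightarrow> real \<Rightarrow> nat \<Rightarrow> (nat \<Rightarrow> real) \<Rightarrow> nat \<Rightarrow> real" where
  "numerical_density XL f0 h M l i = f0 (grid_pt XL h (real i)) / Dt_h h M l i"

end

theory Submission
  imports Defs
begin

text \<open>
  Write \<open>p = D_h x_h\<close> and \<open>q = D_h x_e\<close> for the slopes of the numerical and the exact trajectory on the
  cells of the grid, \<open>r = p - q\<close>, and \<open>\<phi> = f\<^sub>0 / p\<close> for the numerical density.  The proof compares the two
  trajectories in an energy that only sees the slopes; it puts no relation between \<open>\<tau>\<close> and \<open>h\<close>.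

  \<^bold>\<open>Bounds.\<close>  The density \<open>\<phi>\<close> obeys a maximum principle (\<open>discrete_max_principle\<close>): in the cell where
  the new density is largest, the scheme moves neither end point inwards, so the cell has not shrunk and
  its density has not grown.  As \<open>p = 1\<close> initially, \<open>\<phi>\<close> stays between \<open>b\<^sub>f\<close> and \<open>B\<^sub>f\<close> for ever, which
  bounds the slopes \<open>p\<close> from both sides (\<open>numerical_bounds\<close>).  All nonlinearities are then evaluated in a fixed
  compact subset of the positive reals.

  \<^bold>\<open>Stability.\<close>  The scheme is implicit in the gradient flow of \<open>- \<Sum> h f\<^sub>0 ln p\<close>, with a friction
  coefficient taken at the old time level.  Its natural error functional is the relative energy
  \<open>H = \<Sum> h f\<^sub>0 \<psi>(p / q)\<close> with \<open>\<psi>(s) = s - 1 - ln s\<close>, which is comparable to \<open>\<Sum> h r\<^sup>2\<close>.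
  Convexity of \<open>\<psi>\<close> bounds the growth of \<open>H\<close> in one step by the difference of the two fluxes tested with
  the increment of the error \<open>e\<close>, up to \<open>O(\<tau>)\<close> times quadratic terms.  After summation by parts the
  error equation produces the dissipation \<open>- a |\<delta>e|\<^sup>2\<close> of the time difference quotient \<open>\<delta>e\<close>, and this
  absorbs both the truncation error and the error of the friction coefficient
  (\<open>relative_energy_step\<close>).  Testing with the increment of \<open>e\<close>, and not with \<open>e\<close>, is what makes this
  work: the numerical friction coefficient is never differenced in time, and no bound on time
  differences of \<open>x_h\<close> is known in advance.  Gronwall's inequality gives \<open>H = O((\<tau> + h\<^sup>2)\<^sup>2)\<close>
  (\<open>cell_error_bound\<close>); the estimates of \<open>e\<close> and of its differences are consequences.

  \<^bold>\<open>Consistency.\<close>  The initial density is only assumed to lie between two positive constants, but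
  the equation makes it smooth inside the interval: the exact density \<open>u = f\<^sub>0 / \<partial>\<^sub>X x_e\<close> solves \<open>u' = - u\<^bsup>2 - m\<^esup> \<partial>\<^sub>X x_e \<partial>\<^sub>t x_e / m\<close> at every positive time, an
  ordinary differential equation in \<open>X\<close> with smooth coefficients.  So \<open>u\<close> has three bounded derivatives
  inside the interval, and \<open>d_h (f\<^sub>0 / D_h x_e)\<close> is a second order approximation of \<open>u'\<close>
  (\<open>spatial_consistency\<close>, \<open>truncation_error\<close>).

  \<^bold>\<open>Density.\<close>  The numerical density divides by \<open>Dt_h x_h\<close>, which at the end points is the extrapolation
  \<open>(3 p\<^sub>1 - p\<^sub>2) / 2\<close> and is not controlled by bounds on \<open>p\<close> alone.  On fine meshes it stays positive because
  \<open>|p\<^sub>2 - p\<^sub>1| = O(\<surd>h)\<close> (\<open>boundary_gradient\<close>): for \<open>\<tau> \<le> h\<close> this follows from the error estimate, and for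
  \<open>\<tau> > h\<close> from the scheme, as the node next to the fixed end point moves by \<open>O(h)\<close> only in a step of
  length \<open>\<tau>\<close>.
\<close>

section \<open>Difference quotients and discrete norms\<close>

lemma sum_by_parts_grid:
  fixes \<theta> z :: "nat \<Rightarrow> real"
  assumes "1 \<le> M"
  shows "(\<Sum>j=1..M. \<theta> j * (z j - z (j - 1)))
       = \<theta> M * z M - \<theta> 1 * z 0 - (\<Sum>i=1..M - 1. (\<theta> (i + 1) - \<theta> i) * z i)"
  using assms
proof (induction M rule: dec_induct)
  case base
  then show ?case by (simp add: algebra_simps)
next
  case (step M)
  then obtain K where K: "M = Suc K" by (cases M) auto
  show ?case using step.IH by (simp add: K algebra_simps)
qed

lemma sum_adjacent_le:
  fixes w :: "nat \<Rightarrow> real"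
  assumes "\<And>j. 0 \<le> w j"
  shows "(\<Sum>i=1..M - 1. w i + w (i + 1)) \<le> 2 * (\<Sum>j=1..M. w j)"
proof -
  have "(\<Sum>i=1..M - 1. w i) \<le> (\<Sum>j=1..M. w j)"
    by (rule sum_mono2) (use assms in auto)
  moreover have "(\<Sum>i=1..M - 1. w (i + 1)) = (\<Sum>j\<in>(\<lambda>i. i + 1) ` {1..M - 1}. w j)"
    using sum.reindex[of "\<lambda>i. i + 1" "{1..M - 1}" w] by simp
  moreover have "(\<Sum>j\<in>(\<lambda>i. i + 1) ` {1..M - 1}. w j) \<le> (\<Sum>j=1..M. w j)"
    by (rule sum_mono2) (use assms in auto)
  ultimately show ?thesis by (simp add: sum.distrib)
qed

lemma D_h_diff: "D_h h (\<lambda>i. l i - g i) j = D_h h l j - D_h h g j"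
  by (simp add: D_h_def diff_divide_distrib)

lemma Dt_h_diff: "Dt_h h M (\<lambda>i. l i - g i) i = Dt_h h M l i - Dt_h h M g i"
  by (simp add: Dt_h_def diff_divide_distrib add_divide_distrib right_diff_distrib)

lemma Dt_h_interior:
  assumes "0 < h" "i \<in> {1..M - 1}"
  shows "Dt_h h M l i = (D_h h l i + D_h h l (i + 1)) / 2"
  using assms by (auto simp: Dt_h_def D_h_def field_simps)

lemma Dt_h_interior_bounds:
  assumes "0 < h" "i \<in> {1..M - 1}"
    and "\<And>j. j \<in> {1..M} \<Longrightarrow> a \<le> D_h h l j \<and> D_h h l j \<le> b"
  shows "a \<le> Dt_h h M l i" "Dt_h h M l i \<le> b"
proof -
  have "i \<in> {1..M}" "i + 1 \<in> {1..M}" using assms(2) by auto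
  then show "a \<le> Dt_h h M l i" "Dt_h h M l i \<le> b"
    unfolding Dt_h_interior[OF assms(1,2)] using assms(3)[of i] assms(3)[of "i + 1"] by auto
qed

lemma Dt_h_left:
  assumes "0 < h"
  shows "Dt_h h M l 0 = (3 * D_h h l 1 - D_h h l 2) / 2"
  using assms by (auto simp: Dt_h_def D_h_def field_simps)

lemma Dt_h_right:
  assumes "0 < h" "2 \<le> M"
  shows "Dt_h h M l M = (3 * D_h h l M - D_h h l (M - 1)) / 2"
  using assms by (auto simp: Dt_h_def D_h_def field_simps diff_diff_eq numeral_2_eq_2)

lemma grid_norm_le:
  assumes "0 \<le> B" "grid_inner h M l l \<le> B\<^sup>2"
  shows "grid_norm h M l \<le> B"
  unfolding grid_norm_def using assms by (metis real_le_lsqrt)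

lemma grid_norm_le_of_inner:
  assumes "0 \<le> c" "c \<le> C" "0 \<le> \<epsilon>" "grid_inner h M l l \<le> c * \<epsilon>\<^sup>2"
  shows "grid_norm h M l \<le> (1 + C) * \<epsilon>"
proof (rule grid_norm_le)
  have "c \<le> 1 + 2 * C + C * C" using assms(1,2) zero_le_square[of C] by linarith
  then have "c \<le> (1 + C)\<^sup>2" by (simp add: power2_eq_square algebra_simps)
  then have "c * \<epsilon>\<^sup>2 \<le> (1 + C)\<^sup>2 * \<epsilon>\<^sup>2" by (intro mult_right_mono) auto
  then show "grid_inner h M l l \<le> ((1 + C) * \<epsilon>)\<^sup>2"
    using assms(4) by (simp add: power_mult_distrib)
qed (use assms in auto)

lemma grid_inner_mono:
  assumes "0 < h" "\<And>i. i \<le> M \<Longrightarrow> (l i)\<^sup>2 \<le> B * (g i)\<^sup>2 + A" "0 \<le> A" "1 \<le> M"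
  shows "grid_inner h M l l \<le> B * grid_inner h M g g + h * real M * A"
proof -
  have s: "(\<Sum>i=1..M - 1. l i * l i) \<le> (\<Sum>i=1..M - 1. B * (g i * g i) + A)"
    by (rule sum_mono) (use assms in \<open>auto simp: power2_eq_square\<close>)
  also have "\<dots> = B * (\<Sum>i=1..M - 1. g i * g i) + real (M - 1) * A"
    by (simp add: sum.distrib sum_distrib_left)
  finally have s: "(\<Sum>i=1..M - 1. l i * l i) \<le> B * (\<Sum>i=1..M - 1. g i * g i) + (real M - 1) * A"
    using assms by (simp add: of_nat_diff)
  have "l 0 * l 0 \<le> B * (g 0 * g 0) + A" "l M * l M \<le> B * (g M * g M) + A"
    using assms(2)[of 0] assms(2)[of M] by (auto simp: power2_eq_square)
  then have "l 0 * l 0 / 2 + (\<Sum>i=1..M - 1. l i * l i) + l M * l M / 2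
      \<le> B * (g 0 * g 0 / 2 + (\<Sum>i=1..M - 1. g i * g i) + g M * g M / 2) + real M * A"
    using s by (simp add: algebra_simps)
  then have "h * (l 0 * l 0 / 2 + (\<Sum>i=1..M - 1. l i * l i) + l M * l M / 2)
      \<le> h * (B * (g 0 * g 0 / 2 + (\<Sum>i=1..M - 1. g i * g i) + g M * g M / 2) + real M * A)"
    using assms(1) by (intro mult_left_mono) auto
  then show ?thesis
    unfolding grid_inner_def by (simp only: distrib_left mult.left_commute mult.assoc)
qed

text \<open>
  A discrete Poincare inequality: since \<open>l 0 = 0\<close>, the value \<open>l i\<close> is the sum of the increments
  \<open>h * D_h h l j\<close> with \<open>j \<le> i\<close>, and the Cauchy-Schwarz inequality bounds it by the sum of their squares.
\<close>

lemma grid_inner_le_of_D_h: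
  assumes h: "0 < h" and M: "1 \<le> M" and l0: "l 0 = 0"
  shows "grid_inner h M l l \<le> (h * real M)\<^sup>2 * (h * (\<Sum>j=1..M. (D_h h l j)\<^sup>2))"
proof -
  let ?R = "h * (\<Sum>j=1..M. (D_h h l j)\<^sup>2)"
  have pt: "(l i)\<^sup>2 \<le> (h * real M) * ?R" if "i \<le> M" for i
  proof -
    have "l i = (\<Sum>j=1..i. h * D_h h l j)"
      using h l0 by (induction i) (auto simp: D_h_def)
    then have "\<bar>l i\<bar> \<le> (\<Sum>j=1..i. h * \<bar>D_h h l j\<bar>)"
      using sum_abs[of "\<lambda>j. h * D_h h l j" "{1..i}"] h by (simp add: abs_mult)
    also have "\<dots> \<le> (\<Sum>j=1..M. h * \<bar>D_h h l j\<bar>)"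
      by (rule sum_mono2) (use h that in auto)
    finally have a: "\<bar>l i\<bar> \<le> h * (\<Sum>j=1..M. \<bar>D_h h l j\<bar>)" by (simp add: sum_distrib_left)
    have "(\<Sum>j=1..M. \<bar>D_h h l j\<bar>)\<^sup>2 \<le> real M * (\<Sum>j=1..M. (D_h h l j)\<^sup>2)"
      using Cauchy_Schwarz_ineq_sum[of "\<lambda>j. \<bar>D_h h l j\<bar>" "\<lambda>j. 1" "{1..M}"] by (simp add: mult.commute)
    then have "(h * (\<Sum>j=1..M. \<bar>D_h h l j\<bar>))\<^sup>2 \<le> h\<^sup>2 * (real M * (\<Sum>j=1..M. (D_h h l j)\<^sup>2))"
      using h by (simp add: power_mult_distrib)
    moreover have "(l i)\<^sup>2 \<le> (h * (\<Sum>j=1..M. \<bar>D_h h l j\<bar>))\<^sup>2"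
      using power_mono[OF a abs_ge_zero, of 2] by simp
    ultimately show ?thesis by (simp add: power2_eq_square algebra_simps)
  qed
  have "0 \<le> (h * real M) * ?R" using h by (simp add: sum_nonneg)
  with pt have "grid_inner h M l l \<le> 0 * grid_inner h M l l + h * real M * ((h * real M) * ?R)"
    by (intro grid_inner_mono) (use h M in auto)
  then show ?thesis by (simp add: power2_eq_square algebra_simps)
qed

lemma Dt_h_interior_sq:
  assumes "0 < h" "i \<in> {1..M - 1}"
  shows "(Dt_h h M l i)\<^sup>2 \<le> ((D_h h l i)\<^sup>2 + (D_h h l (i + 1))\<^sup>2) / 2"
  using zero_le_power2[of "D_h h l i - D_h h l (i + 1)"]
  unfolding Dt_h_interior[OF assms] by (simp add: power2_eq_square field_simps)

lemma one_sided_sq: "((3 * x - y) / 2)\<^sup>2 \<le> 5 * (x\<^sup>2 + y\<^sup>2)" for x y :: real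
proof -
  have "0 \<le> (3 * y + x)\<^sup>2 + 10 * x\<^sup>2 + 10 * y\<^sup>2" by simp
  then show ?thesis by (simp add: power2_eq_square field_simps)
qed

text \<open>
  In the interior \<open>Dt_h\<close> averages the two adjacent cell slopes, which contributes the factor \<open>1\<close>; each end
  point extrapolates from two cells and contributes \<open>5 / 2\<close>, its weight in the inner product being one half.
\<close>

lemma grid_inner_Dt_h_le:
  assumes h: "0 < h" and M: "2 \<le> M"
  shows "grid_inner h M (Dt_h h M l) (Dt_h h M l) \<le> 6 * (h * (\<Sum>j=1..M. (D_h h l j)\<^sup>2))"
proof -
  let ?S = "\<Sum>j=1..M. (D_h h l j)\<^sup>2"
  let ?s = "\<lambda>j. (D_h h l j)\<^sup>2"
  have pair: "?s i + ?s j \<le> ?S" if "i \<noteq> j" "i \<in> {1..M}" "j \<in> {1..M}" for i j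
  proof -
    have "(\<Sum>k\<in>{i,j}. ?s k) \<le> ?S" by (rule sum_mono2) (use that in auto)
    then show ?thesis using that by simp
  qed
  have "(Dt_h h M l 0)\<^sup>2 \<le> 5 * (?s 1 + ?s 2)"
    unfolding Dt_h_left[OF h] by (rule one_sided_sq)
  also have "\<dots> \<le> 5 * ?S"
    by (intro mult_left_mono pair) (use M in auto)
  finally have L: "(Dt_h h M l 0)\<^sup>2 \<le> 5 * ?S" .
  have "(Dt_h h M l M)\<^sup>2 \<le> 5 * (?s M + ?s (M - 1))"
    unfolding Dt_h_right[OF h M] by (rule one_sided_sq)
  also have "\<dots> \<le> 5 * ?S"
    by (intro mult_left_mono pair) (use M in auto)
  finally have Rr: "(Dt_h h M l M)\<^sup>2 \<le> 5 * ?S" .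
  have "(\<Sum>i=1..M - 1. (Dt_h h M l i)\<^sup>2) \<le> (\<Sum>i=1..M - 1. (?s i + ?s (i + 1)) / 2)"
    by (rule sum_mono) (rule Dt_h_interior_sq[OF h])
  also have "\<dots> = (\<Sum>i=1..M - 1. ?s i + ?s (i + 1)) / 2" by (simp add: sum_divide_distrib)
  also have "\<dots> \<le> ?S" using sum_adjacent_le[of ?s M] by simp
  finally have "(\<Sum>i=1..M - 1. (Dt_h h M l i)\<^sup>2) \<le> ?S" .
  then have "(Dt_h h M l 0)\<^sup>2 / 2 + (\<Sum>i=1..M - 1. (Dt_h h M l i)\<^sup>2) + (Dt_h h M l M)\<^sup>2 / 2 \<le> 6 * ?S"
    using L Rr by linarith
  then have "h * ((Dt_h h M l 0)\<^sup>2 / 2 + (\<Sum>i=1..M - 1. (Dt_h h M l i)\<^sup>2) + (Dt_h h M l M)\<^sup>2 / 2) \<le> h * (6 * ?S)"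
    using h by (intro mult_left_mono) auto
  then show ?thesis by (simp add: grid_inner_def power2_eq_square)
qed

section \<open>Discrete maximum principle\<close>

text \<open>
  Here \<open>x'\<close> arises from \<open>x\<close> by an implicit step with time step and friction collected in \<open>c\<close>.  Let \<open>k\<close> be the
  cell with the largest new density.  Its density is at least that of its neighbours, so the scheme does
  not move the right end point to the left nor the left end point to the right; an end point on the boundary
  is fixed.  The cell has not shrunk, hence its new density is at most the old one.  Only signs enter,
  so this holds for every \<open>c \<ge> 0\<close>, whatever the step sizes.  The lower bound is symmetric.
\<close>

lemma discrete_max_principle:
  fixes F x x' c :: "nat \<Rightarrow> real"
  assumes h: "0 < h" and F: "\<And>j. j \<in> {1..M} \<Longrightarrow> 0 < F j"
    and p: "\<And>j. j \<in> {1..M} \<Longrightarrow> 0 < D_h h x j"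
    and p': "\<And>j. j \<in> {1..M} \<Longrightarrow> 0 < D_h h x' j"
    and c: "\<And>i. i \<in> {1..M - 1} \<Longrightarrow> 0 \<le> c i"
    and bc: "x' 0 = x 0" "x' M = x M"
    and eq: "\<And>i. i \<in> {1..M - 1} \<Longrightarrow> x' i - x i = - c i * (F (i + 1) / D_h h x' (i + 1) - F i / D_h h x' i)"
  shows "(\<forall>j\<in>{1..M}. F j / D_h h x j \<le> B) \<longrightarrow> (\<forall>j\<in>{1..M}. F j / D_h h x' j \<le> B)"
    and "(\<forall>j\<in>{1..M}. b \<le> F j / D_h h x j) \<longrightarrow> (\<forall>j\<in>{1..M}. b \<le> F j / D_h h x' j)"
proof -
  let ?\<phi> = "\<lambda>j. F j / D_h h x' j"
  show "(\<forall>j\<in>{1..M}. F j / D_h h x j \<le> B) \<longrightarrow> (\<forall>j\<in>{1..M}. ?\<phi> j \<le> B)"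
  proof (cases "M = 0")
    case False
    then obtain k where k: "k \<in> {1..M}" and e: "Max (?\<phi> ` {1..M}) = ?\<phi> k"
      using obtains_MAX[of "{1..M}" ?\<phi>] by auto
    have mx: "?\<phi> j \<le> ?\<phi> k" if "j \<in> {1..M}" for j
      unfolding e[symmetric] using that by (intro Max_ge) auto
    have up: "x k \<le> x' k"
    proof (cases "k = M")
      case False
      then have "?\<phi> (k + 1) \<le> ?\<phi> k" "k \<in> {1..M - 1}" using k mx[of "k + 1"] by auto
      then show ?thesis using eq[of k] c[of k] mult_nonneg_nonneg[of "c k" "?\<phi> k - ?\<phi> (k + 1)"]
        by (simp add: algebra_simps)
    qed (use bc in auto)
    have dn: "x' (k - 1) \<le> x (k - 1)"
    proof (cases "k = 1")
      case False
      then have k1: "k - 1 \<in> {1..M}" "k - 1 \<in> {1..M - 1}" "k - 1 + 1 = k"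
        using k by auto
      have "?\<phi> (k - 1) \<le> ?\<phi> k" by (rule mx[OF k1(1)])
      then show ?thesis using k1 eq[of "k - 1"] c[of "k - 1"] mult_nonneg_nonneg[of "c (k - 1)" "?\<phi> k - ?\<phi> (k - 1)"]
        by (simp add: algebra_simps)
    qed (use bc in auto)
    have "D_h h x k \<le> D_h h x' k"
      unfolding D_h_def using up dn h by (intro divide_right_mono) auto
    then have "?\<phi> k \<le> F k / D_h h x k"
      using p[OF k] F[OF k] by (intro divide_left_mono) auto
    then show ?thesis using mx k by (meson order_trans)
  qed auto
  show "(\<forall>j\<in>{1..M}. b \<le> F j / D_h h x j) \<longrightarrow> (\<forall>j\<in>{1..M}. b \<le> ?\<phi> j)"
  proof (cases "M = 0")
    case False
    then obtain k where k: "k \<in> {1..M}" and e: "Min (?\<phi> ` {1..M}) = ?\<phi> k"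
      using obtains_MIN[of "{1..M}" ?\<phi>] by auto
    have mx: "?\<phi> k \<le> ?\<phi> j" if "j \<in> {1..M}" for j
      unfolding e[symmetric] using that by (intro Min_le) auto
    have up: "x' k \<le> x k"
    proof (cases "k = M")
      case False
      then have "?\<phi> k \<le> ?\<phi> (k + 1)" "k \<in> {1..M - 1}" using k mx[of "k + 1"] by auto
      then show ?thesis using eq[of k] c[of k] mult_nonneg_nonneg[of "c k" "?\<phi> (k + 1) - ?\<phi> k"]
        by (simp add: algebra_simps)
    qed (use bc in auto)
    have dn: "x (k - 1) \<le> x' (k - 1)"
    proof (cases "k = 1")
      case False
      then have k1: "k - 1 \<in> {1..M}" "k - 1 \<in> {1..M - 1}" "k - 1 + 1 = k"
        using k by auto
      have "?\<phi> k \<le> ?\<phi> (k - 1)" by (rule mx[OF k1(1)])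
      then show ?thesis using k1 eq[of "k - 1"] c[of "k - 1"] mult_nonneg_nonneg[of "c (k - 1)" "?\<phi> (k - 1) - ?\<phi> k"]
        by (simp add: algebra_simps)
    qed (use bc in auto)
    have "D_h h x' k \<le> D_h h x k"
      unfolding D_h_def using up dn h by (intro divide_right_mono) auto
    then have "F k / D_h h x k \<le> ?\<phi> k"
      using p'[OF k] p[OF k] F[OF k] by (intro divide_left_mono) auto
    then show ?thesis using mx k by (meson order_trans)
  qed auto
qed

section \<open>Relative energy\<close>

text \<open>
  The Bregman distance \<open>F p - F q - F' q * (p - q)\<close> of the convex function \<open>F = - ln\<close> depends on \<open>s = p / q\<close>
  only, and equals this function of \<open>s\<close>.
\<close>

definition rel_entropy :: "real \<Rightarrow> real" where
  "rel_entropy s = s - 1 - ln s"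

text \<open>
  With \<open>w = \<surd>(p / q)\<close>, the elementary bound \<open>ln w \<le> w - 1\<close> gives \<open>(w - 1)\<^sup>2 \<le> rel_entropy (w\<^sup>2)\<close>, and
  \<open>w - 1 = (w\<^sup>2 - 1) / (w + 1)\<close>.
\<close>

lemma rel_entropy_lower:
  assumes "0 < p" "0 < q"
  shows "(p - q)\<^sup>2 / (2 * q * (p + q)) \<le> rel_entropy (p / q)"
proof -
  define w where "w = sqrt (p / q)"
  have w: "0 < w" "w\<^sup>2 = p / q" using assms by (auto simp: w_def)
  have p: "p = q * w\<^sup>2" using w assms by simp
  have "ln (p / q) = 2 * ln w" using w(2) w(1) by (metis ln_realpow of_nat_numeral)
  also have "\<dots> \<le> 2 * (w - 1)" using w ln_le_minus_one[of w] by simp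
  finally have "(w - 1)\<^sup>2 \<le> rel_entropy (p / q)"
    unfolding rel_entropy_def w(2)[symmetric] by (simp add: power2_eq_square algebra_simps)
  moreover have "(p - q)\<^sup>2 / (2 * q * (p + q)) \<le> (w - 1)\<^sup>2"
  proof -
    have "(p - q)\<^sup>2 = q\<^sup>2 * ((w - 1)\<^sup>2 * (w + 1)\<^sup>2)"
      unfolding p by (simp add: power2_eq_square algebra_simps)
    moreover have "(w + 1)\<^sup>2 \<le> 2 * (w\<^sup>2 + 1)"
      using zero_le_power2[of "w - 1"] by (simp add: power2_eq_square algebra_simps)
    ultimately have "(p - q)\<^sup>2 \<le> q\<^sup>2 * ((w - 1)\<^sup>2 * (2 * (w\<^sup>2 + 1)))"
      by (simp add: mult_left_mono)
    also have "\<dots> = (w - 1)\<^sup>2 * (2 * q * (p + q))"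
      unfolding p by (simp add: power2_eq_square algebra_simps)
    finally show ?thesis using assms by (simp add: pos_divide_le_eq)
  qed
  ultimately show ?thesis by linarith
qed

text \<open>
  Convexity: \<open>\<psi>(s') - \<psi>(s) \<le> \<psi>'(s') * (s' - s)\<close> with \<open>\<psi>'(s') = 1 - 1 / s'\<close>.  The first term on the right
  pairs the difference of the fluxes with the increment of the error, as the implicit scheme does.  The
  second one comes from the motion of the exact slope \<open>q\<close>; it is quadratic in the error and, when
  \<open>q' - q = O(\<tau>)\<close>, small enough for Gronwall's inequality.
\<close>

lemma rel_entropy_step:
  assumes "0 < p" "0 < q" "0 < p'" "0 < q'"
  shows "rel_entropy (p' / q') - rel_entropy (p / q)
    \<le> (1 / q' - 1 / p') * ((p' - q') - (p - q)) + (p' - q') * (p - q) * (q - q') / (q * p' * q')"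
proof -
  define s where "s = p / q"
  define s' where "s' = p' / q'"
  have s: "0 < s" "0 < s'" using assms by (auto simp: s_def s'_def)
  have "ln s - ln s' \<le> s / s' - 1"
    using ln_le_minus_one[of "s / s'"] s by (simp add: ln_div)
  then have "rel_entropy s' - rel_entropy s \<le> (s' - s) + (s / s' - 1)"
    by (simp add: rel_entropy_def)
  also have "\<dots> = (1 / q' - 1 / p') * ((p' - q') - (p - q)) + (p' - q') * (p - q) * (q - q') / (q * p' * q')"
    using assms by (simp add: s_def s'_def field_simps)
  finally show ?thesis by (simp add: s_def s'_def)
qed

lemma mult_sub_square_le:
  fixes a g z :: real
  assumes "0 < a" "\<bar>y\<bar> \<le> g"
  shows "y * z - a * z\<^sup>2 \<le> g\<^sup>2 / (4 * a)"
proof -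
  have "0 \<le> (y - 2 * a * z)\<^sup>2" by simp
  then have "4 * a * (y * z - a * z\<^sup>2) \<le> y\<^sup>2" by (simp add: power2_eq_square algebra_simps)
  also have "\<dots> \<le> g\<^sup>2" using assms by (simp add: abs_le_square_iff[symmetric])
  finally show ?thesis using assms by (simp add: pos_le_divide_eq mult.commute)
qed

text \<open>
  The stability estimate, for arbitrary node positions.  Besides the scheme (\<open>eqh\<close>) and its perturbation
  by a defect of size \<open>g\<close> (\<open>eqe\<close>) it uses that the friction coefficients \<open>ae\<close> and \<open>ah\<close> differ by at
  most a multiple of the slope error.  Summation by parts, with errors that vanish at the end points, turns the
  flux term of \<open>rel_entropy_step\<close> into \<open>\<Sum> h * (y * z - ah * z\<^sup>2)\<close>, where \<open>z\<close> is the time difference quotient of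
  the error and \<open>y\<close> collects the defect and the friction error; maximising over \<open>z\<close> leaves
  \<open>y\<^sup>2 / (4 * a0)\<close>.
\<close>

lemma relative_energy_step:
  fixes xh xh' xe xe' F ah ae :: "nat \<Rightarrow> real" and h :: real
  defines "p \<equiv> \<lambda>x. D_h h x"
  assumes h: "0 < h" and tau: "0 < \<tau>" and M: "1 \<le> M" and lo: "0 < lo"
    and plo: "\<And>x j. x \<in> {xh, xh', xe, xe'} \<Longrightarrow> j \<in> {1..M} \<Longrightarrow> lo \<le> p x j"
    and F: "\<And>j. j \<in> {1..M} \<Longrightarrow> 0 < F j \<and> F j \<le> Bf"
    and q: "\<And>j. j \<in> {1..M} \<Longrightarrow> \<bar>p xe' j - p xe j\<bar> \<le> K * \<tau>"
    and bc: "\<And>x. x \<in> {xh, xh', xe, xe'} \<Longrightarrow> x 0 = XL \<and> x M = XR"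
    and eqh: "\<And>i. i \<in> {1..M - 1} \<Longrightarrow>
        ah i * ((xh' i - xh i) / \<tau>) = - d_h h (\<lambda>j. F j / D_h h xh' j) i"
    and eqe: "\<And>i. i \<in> {1..M - 1} \<Longrightarrow>
        \<bar>ae i * ((xe' i - xe i) / \<tau>) + d_h h (\<lambda>j. F j / D_h h xe' j) i\<bar> \<le> g"
    and a0: "0 < a0" "\<And>i. i \<in> {1..M - 1} \<Longrightarrow> a0 \<le> ah i"
    and La: "0 \<le> La" "\<And>i. i \<in> {1..M - 1} \<Longrightarrow> \<bar>ae i - ah i\<bar> \<le> La * \<bar>Dt_h h M xe i - Dt_h h M xh i\<bar>"
    and V: "\<And>i. i \<in> {1..M - 1} \<Longrightarrow> \<bar>(xe' i - xe i) / \<tau>\<bar> \<le> V"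
  shows "h * (\<Sum>j=1..M. F j * rel_entropy (p xh' j / p xe' j)) - h * (\<Sum>j=1..M. F j * rel_entropy (p xh j / p xe j))
    \<le> \<tau> * ((Bf * K / lo ^ 3 + (La * V)\<^sup>2 / a0)
          * (h * (\<Sum>j=1..M. (p xh j - p xe j)\<^sup>2) + h * (\<Sum>j=1..M. (p xh' j - p xe' j)\<^sup>2))
        + h * real M * g\<^sup>2 / (2 * a0))"
proof -
  define r where "r = (\<lambda>j. p xh j - p xe j)"
  define r' where "r' = (\<lambda>j. p xh' j - p xe' j)"
  define E where "E = (\<lambda>i. (xe' i - xh' i) - (xe i - xh i))"
  \<comment> \<open>The difference of the exact and the numerical density, which drives the error.\<close>
  define \<theta> where "\<theta> = (\<lambda>j. F j / p xe' j - F j / p xh' j)"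
  define R where "R = h * (\<Sum>j=1..M. (r j)\<^sup>2)"
  define R' where "R' = h * (\<Sum>j=1..M. (r' j)\<^sup>2)"
  have R0: "0 \<le> R" "0 \<le> R'" using h by (auto simp: R_def R'_def intro!: mult_nonneg_nonneg sum_nonneg)
  have pos: "0 < p x j" if "x \<in> {xh, xh', xe, xe'}" "j \<in> {1..M}" for x j
    using plo[OF that] lo by linarith
  have K: "0 \<le> K" using q[of 1] M tau
    by (smt (verit) abs_ge_zero atLeastAtMost_iff mult_neg_pos order_refl)
  have Bf: "0 < Bf" using F[of 1] M by force
  have cell: "F j * rel_entropy (p xh' j / p xe' j) - F j * rel_entropy (p xh j / p xe j)
      \<le> \<theta> j * (r' j - r j) + \<tau> * (Bf * K / lo ^ 3 / 2) * ((r j)\<^sup>2 + (r' j)\<^sup>2)" if j: "j \<in> {1..M}" for j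
  proof -
    note ps = pos[of xh j] pos[of xh' j] pos[of xe j] pos[of xe' j]
    have "F j * rel_entropy (p xh' j / p xe' j) - F j * rel_entropy (p xh j / p xe j)
       \<le> F j * ((1 / p xe' j - 1 / p xh' j) * (r' j - r j)
           + r' j * r j * (p xe j - p xe' j) / (p xe j * p xh' j * p xe' j))"
      using rel_entropy_step[of "p xh j" "p xe j" "p xh' j" "p xe' j"] ps j F[OF j]
      by (simp add: r_def r'_def mult_left_mono flip: right_diff_distrib)
    also have "\<dots> = \<theta> j * (r' j - r j) + F j * (r' j * r j * (p xe j - p xe' j) / (p xe j * p xh' j * p xe' j))"
      by (simp add: \<theta>_def algebra_simps)
    also have "F j * (r' j * r j * (p xe j - p xe' j) / (p xe j * p xh' j * p xe' j))
        \<le> Bf * (((r j)\<^sup>2 + (r' j)\<^sup>2) / 2 * (K * \<tau>) / lo ^ 3)"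
    proof -
      have "r' j * r j * (p xe j - p xe' j) / (p xe j * p xh' j * p xe' j)
         \<le> \<bar>r' j * r j * (p xe j - p xe' j)\<bar> / (p xe j * p xh' j * p xe' j)"
        using ps j by (intro divide_right_mono) auto
      also have "\<dots> \<le> ((r j)\<^sup>2 + (r' j)\<^sup>2) / 2 * (K * \<tau>) / lo ^ 3"
      proof (rule frac_le)
        show "lo ^ 3 \<le> p xe j * p xh' j * p xe' j"
          unfolding power3_eq_cube using plo j lo ps
          by (intro mult_mono) (auto intro!: mult_nonneg_nonneg)
        have "\<bar>r' j * r j\<bar> \<le> ((r j)\<^sup>2 + (r' j)\<^sup>2) / 2"
          using sum_squares_bound[of "\<bar>r' j\<bar>" "\<bar>r j\<bar>"] by (simp add: abs_mult)
        then show "\<bar>r' j * r j * (p xe j - p xe' j)\<bar> \<le> ((r j)\<^sup>2 + (r' j)\<^sup>2) / 2 * (K * \<tau>)"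
          unfolding abs_mult[of "_ * _"] using q[OF j]
          by (intro mult_mono) (auto simp: abs_minus_commute)
      qed (use lo K tau in auto)
      finally have "r' j * r j * (p xe j - p xe' j) / (p xe j * p xh' j * p xe' j)
         \<le> ((r j)\<^sup>2 + (r' j)\<^sup>2) / 2 * (K * \<tau>) / lo ^ 3" .
      moreover have "0 \<le> ((r j)\<^sup>2 + (r' j)\<^sup>2) / 2 * (K * \<tau>) / lo ^ 3"
        using K tau lo by auto
      ultimately show ?thesis using F[OF j]
        by (intro order_trans[OF mult_left_mono mult_right_mono]) auto
    qed
    also have "Bf * (((r j)\<^sup>2 + (r' j)\<^sup>2) / 2 * (K * \<tau>) / lo ^ 3) = \<tau> * (Bf * K / lo ^ 3 / 2) * ((r j)\<^sup>2 + (r' j)\<^sup>2)"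
      by (simp add: mult_ac)
    finally show ?thesis by simp
  qed
  have node: "h * (d_h h \<theta> i * E i) \<le> \<tau> * (h * g\<^sup>2 / (2 * a0) + (La * V)\<^sup>2 / a0 / 4 * (h * ((r i)\<^sup>2 + (r (i + 1))\<^sup>2)))"
    if i: "i \<in> {1..M - 1}" for i
  proof -
    define z where "z = E i / \<tau>"
    \<comment> \<open>The error equation at node \<open>i\<close> reads \<open>d_h h \<theta> i = y - ah i * z\<close>.\<close>
    define y where "y = (ae i * ((xe' i - xe i) / \<tau>) + d_h h (\<lambda>j. F j / D_h h xe' j) i) - (ae i - ah i) * ((xe' i - xe i) / \<tau>)"
    define w where "w = \<bar>Dt_h h M xe i - Dt_h h M xh i\<bar>"
    have dt: "d_h h \<theta> i = d_h h (\<lambda>j. F j / D_h h xe' j) i - d_h h (\<lambda>j. F j / D_h h xh' j) i"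
      by (simp add: d_h_def \<theta>_def p_def diff_divide_distrib)
    have z: "z = (xe' i - xe i) / \<tau> - (xh' i - xh i) / \<tau>"
      by (simp add: z_def E_def diff_divide_distrib)
    have "d_h h \<theta> i = y - ah i * z"
      unfolding dt y_def z using eqh[OF i] by (simp only: left_diff_distrib right_diff_distrib)
    moreover have "E i = \<tau> * z" using tau by (simp add: z_def)
    ultimately have "d_h h \<theta> i * E i = (y - ah i * z) * (\<tau> * z)" by simp
    also have "\<dots> = \<tau> * (y * z - ah i * z\<^sup>2)"
      by (simp add: power2_eq_square algebra_simps)
    also have "\<dots> \<le> \<tau> * (y * z - a0 * z\<^sup>2)"
      using a0(2)[OF i] tau by (intro mult_left_mono) (auto intro: mult_right_mono)
    also have "\<dots> \<le> \<tau> * ((g + La * w * V)\<^sup>2 / (4 * a0))"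
    proof (intro mult_left_mono mult_sub_square_le)
      have "\<bar>(ae i - ah i) * ((xe' i - xe i) / \<tau>)\<bar> \<le> (La * w) * V"
        unfolding abs_mult w_def using La V i by (intro mult_mono) auto
      then show "\<bar>y\<bar> \<le> g + La * w * V" unfolding y_def using eqe[OF i] by linarith
    qed (use a0 tau in auto)
    also have "\<dots> \<le> \<tau> * ((2 * g\<^sup>2 + 2 * (La * V)\<^sup>2 * w\<^sup>2) / (4 * a0))"
    proof (intro mult_left_mono divide_right_mono)
      show "(g + La * w * V)\<^sup>2 \<le> 2 * g\<^sup>2 + 2 * (La * V)\<^sup>2 * w\<^sup>2"
        using zero_le_power2[of "g - La * w * V"] by (simp add: power2_eq_square algebra_simps)
    qed (use a0 tau in auto)
    also have "\<dots> \<le> \<tau> * ((2 * g\<^sup>2 + 2 * (La * V)\<^sup>2 * (((r i)\<^sup>2 + (r (i + 1))\<^sup>2) / 2)) / (4 * a0))"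
    proof (intro mult_left_mono divide_right_mono add_left_mono)
      have "w\<^sup>2 = (Dt_h h M (\<lambda>i. xe i - xh i) i)\<^sup>2" by (simp add: w_def Dt_h_diff)
      also have "\<dots> \<le> ((D_h h (\<lambda>i. xe i - xh i) i)\<^sup>2 + (D_h h (\<lambda>i. xe i - xh i) (i + 1))\<^sup>2) / 2"
        by (rule Dt_h_interior_sq[OF h i])
      also have "\<dots> = ((r i)\<^sup>2 + (r (i + 1))\<^sup>2) / 2"
        by (simp add: D_h_diff r_def p_def power2_commute)
      finally show "w\<^sup>2 \<le> ((r i)\<^sup>2 + (r (i + 1))\<^sup>2) / 2" .
    qed (use a0 tau in auto)
    finally have "d_h h \<theta> i * E i \<le> \<tau> * ((2 * g\<^sup>2 + 2 * (La * V)\<^sup>2 * (((r i)\<^sup>2 + (r (i + 1))\<^sup>2) / 2)) / (4 * a0))" .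
    then have "h * (d_h h \<theta> i * E i) \<le> h * (\<tau> * ((2 * g\<^sup>2 + 2 * (La * V)\<^sup>2 * (((r i)\<^sup>2 + (r (i + 1))\<^sup>2) / 2)) / (4 * a0)))"
      using h by (intro mult_left_mono) auto
    also have "\<dots> = \<tau> * (h * g\<^sup>2 / (2 * a0) + (La * V)\<^sup>2 / a0 / 4 * (h * ((r i)\<^sup>2 + (r (i + 1))\<^sup>2)))"
      using a0 by (simp add: field_simps)
    finally show ?thesis .
  qed
  have E0: "E 0 = 0" "E M = 0" using bc[of xh] bc[of xh'] bc[of xe] bc[of xe'] by (auto simp: E_def)
  have rE: "h * (r' j - r j) = - (E j - E (j - 1))" for j
    using h by (simp add: r_def r'_def p_def D_h_def E_def field_simps)
  have "h * (\<Sum>j=1..M. \<theta> j * (r' j - r j)) = (\<Sum>j=1..M. \<theta> j * (h * (r' j - r j)))"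
    by (simp add: sum_distrib_left mult.left_commute)
  also have "\<dots> = - (\<Sum>j=1..M. \<theta> j * (E j - E (j - 1)))"
    unfolding rE mult_minus_right sum_negf ..
  also have "\<dots> = (\<Sum>i=1..M - 1. (\<theta> (i + 1) - \<theta> i) * E i)"
    unfolding sum_by_parts_grid[OF M] by (simp add: E0)
  also have "\<dots> = (\<Sum>i=1..M - 1. h * (d_h h \<theta> i * E i))"
    using h by (simp add: d_h_def)
  also have "\<dots> \<le> (\<Sum>i=1..M - 1. \<tau> * (h * g\<^sup>2 / (2 * a0) + (La * V)\<^sup>2 / a0 / 4 * (h * ((r i)\<^sup>2 + (r (i + 1))\<^sup>2))))"
    by (rule sum_mono) (rule node)
  also have "\<dots> = \<tau> * (real (M - 1) * (h * g\<^sup>2 / (2 * a0)) + (La * V)\<^sup>2 / a0 / 4 * (h * (\<Sum>i=1..M - 1. (r i)\<^sup>2 + (r (i + 1))\<^sup>2)))"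
    unfolding sum_distrib_left[symmetric] sum.distrib by simp
  also have "\<dots> \<le> \<tau> * (real M * (h * g\<^sup>2 / (2 * a0)) + (La * V)\<^sup>2 / a0 / 4 * (h * (2 * (\<Sum>j=1..M. (r j)\<^sup>2))))"
    using tau h a0 sum_adjacent_le[of "\<lambda>j. (r j)\<^sup>2" M]
    by (intro mult_left_mono add_mono mult_right_mono) auto
  also have "\<dots> = \<tau> * (h * real M * g\<^sup>2 / (2 * a0) + (La * V)\<^sup>2 / a0 / 2 * R)"
    by (simp add: R_def mult_ac)
  finally have nodes: "h * (\<Sum>j=1..M. \<theta> j * (r' j - r j)) \<le> \<tau> * (h * real M * g\<^sup>2 / (2 * a0) + (La * V)\<^sup>2 / a0 / 2 * R)" .
  have "h * (\<Sum>j=1..M. F j * rel_entropy (p xh' j / p xe' j)) - h * (\<Sum>j=1..M. F j * rel_entropy (p xh j / p xe j))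
     = h * (\<Sum>j=1..M. F j * rel_entropy (p xh' j / p xe' j) - F j * rel_entropy (p xh j / p xe j))"
    by (simp add: sum_subtractf right_diff_distrib)
  also have "\<dots> \<le> h * (\<Sum>j=1..M. \<theta> j * (r' j - r j) + \<tau> * (Bf * K / lo ^ 3 / 2) * ((r j)\<^sup>2 + (r' j)\<^sup>2))"
    using h by (intro mult_left_mono sum_mono cell) auto
  also have "\<dots> = h * (\<Sum>j=1..M. \<theta> j * (r' j - r j)) + \<tau> * (Bf * K / lo ^ 3 / 2) * (R + R')"
    unfolding sum.distrib sum_distrib_left[symmetric] R_def R'_def by (simp add: algebra_simps)
  also have "\<dots> \<le> \<tau> * (h * real M * g\<^sup>2 / (2 * a0) + (La * V)\<^sup>2 / a0 / 2 * R) + \<tau> * (Bf * K / lo ^ 3 / 2) * (R + R')"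
    using nodes by simp
  also have "\<dots> = \<tau> * (h * real M * g\<^sup>2 / (2 * a0) + ((La * V)\<^sup>2 / a0 / 2 * R + Bf * K / lo ^ 3 / 2 * (R + R')))"
    by (simp add: algebra_simps)
  also have "\<dots> \<le> \<tau> * ((Bf * K / lo ^ 3 + (La * V)\<^sup>2 / a0) * (R + R') + h * real M * g\<^sup>2 / (2 * a0))"
  proof (intro mult_left_mono)
    have half: "x / 2 * R \<le> x * (R + R')" if "0 \<le> x" for x
      using R0 that by (intro mult_mono) auto
    have half': "x / 2 * (R + R') \<le> x * (R + R')" if "0 \<le> x" for x
      using R0 that by (intro mult_mono) auto
    have "(La * V)\<^sup>2 / a0 / 2 * R \<le> (La * V)\<^sup>2 / a0 * (R + R')"
      by (rule half) (use a0 in auto)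
    moreover have "Bf * K / lo ^ 3 / 2 * (R + R') \<le> Bf * K / lo ^ 3 * (R + R')"
      by (rule half') (use Bf K lo in auto)
    ultimately show "h * real M * g\<^sup>2 / (2 * a0) + ((La * V)\<^sup>2 / a0 / 2 * R + Bf * K / lo ^ 3 / 2 * (R + R'))
      \<le> (Bf * K / lo ^ 3 + (La * V)\<^sup>2 / a0) * (R + R') + h * real M * g\<^sup>2 / (2 * a0)"
      unfolding distrib_right[of "Bf * K / lo ^ 3"] by linarith
  qed (use tau in auto)
  finally show ?thesis by (simp add: R_def R'_def r_def r'_def)
qed

text \<open>
  The inequality is implicit in \<open>H (Suc n)\<close>; for \<open>k = c * \<tau> \<le> 1 / 2\<close> the growth factor is
  \<open>(1 + k) / (1 - k) \<le> 1 + 4 * k\<close>.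
\<close>

lemma discrete_Gronwall:
  fixes H :: "nat \<Rightarrow> real"
  assumes H0: "H 0 = 0" and Hn: "\<And>n. n \<le> N \<Longrightarrow> 0 \<le> H n" and c: "0 < c" "0 < \<tau>" "c * \<tau> \<le> 1 / 2" and b: "0 \<le> b"
    and step: "\<And>n. n < N \<Longrightarrow> H (Suc n) - H n \<le> \<tau> * c * (H n + H (Suc n) + b)"
    and n: "n \<le> N"
  shows "H n \<le> exp (4 * c * (real n * \<tau>)) * b"
proof -
  have "H n + b / 2 \<le> (1 + 4 * c * \<tau>) ^ n * (b / 2)"
    using n
  proof (induction n)
    case 0
    then show ?case by (simp add: H0)
  next
    case (Suc n)
    define k where "k = c * \<tau>"
    have k: "0 < k" "k \<le> 1 / 2" using c by (auto simp: k_def)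
    have "H (Suc n) * (1 - k) \<le> (1 + k) * H n + k * b"
      using step[of n] Suc.prems by (simp add: k_def algebra_simps)
    also have "\<dots> \<le> (1 - k) * ((1 + 4 * k) * H n + 2 * k * b)"
    proof -
      have "1 + k \<le> (1 - k) * (1 + 4 * k)" "k \<le> (1 - k) * (2 * k)"
        using k mult_mono[of k "1/2" k k] by (auto simp: algebra_simps)
      then have "(1 + k) * H n \<le> (1 - k) * (1 + 4 * k) * H n" "k * b \<le> (1 - k) * (2 * k) * b"
        using Hn[of n] Suc.prems b by (auto intro: mult_right_mono)
      then show ?thesis by (simp add: algebra_simps)
    qed
    finally have "H (Suc n) \<le> (1 + 4 * k) * H n + 2 * k * b"
      using k by (simp add: mult.commute)
    then have "H (Suc n) + b / 2 \<le> (1 + 4 * k) * (H n + b / 2)" by (simp add: algebra_simps)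
    also have "\<dots> \<le> (1 + 4 * k) * ((1 + 4 * c * \<tau>) ^ n * (b / 2))"
      using Suc k by (intro mult_left_mono) auto
    finally show ?case by (simp add: k_def mult.assoc)
  qed
  also have "\<dots> \<le> exp (4 * c * (real n * \<tau>)) * (b / 2)"
  proof (intro mult_right_mono)
    have "(1 + 4 * c * \<tau>) ^ n \<le> exp (4 * c * \<tau>) ^ n"
      using c by (intro power_mono) auto
    also have "\<dots> = exp (4 * c * (real n * \<tau>))"
      by (simp add: exp_of_nat_mult[symmetric] mult.left_commute mult.commute)
    finally show "(1 + 4 * c * \<tau>) ^ n \<le> exp (4 * c * (real n * \<tau>))" .
  qed (use b in auto)
  also have "\<dots> \<le> exp (4 * c * (real n * \<tau>)) * b" using b by simp
  finally show ?thesis using b by linarith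
qed

section \<open>Finite differences of smooth functions\<close>

lemma Taylor_quadratic:
  fixes f :: "nat \<Rightarrow> real \<Rightarrow> real"
  assumes der: "\<And>i x. x \<in> {a..b} \<Longrightarrow> i \<le> 2 \<Longrightarrow> (f i has_real_derivative f (Suc i) x) (at x within {a..b})"
    and K: "\<And>x. x \<in> {a..b} \<Longrightarrow> \<bar>f 3 x\<bar> \<le> K"
    and "w \<in> {a..b}" "z \<in> {a..b}"
  shows "\<bar>f 0 z - f 0 w - f 1 w * (z - w) - f 2 w * (z - w)\<^sup>2 / 2\<bar> \<le> K * \<bar>z - w\<bar> ^ 3 / 2"
proof -
  have "norm (f 0 z - (\<Sum>i\<le>2. f i w * (z - w) ^ i / fact i)) \<le> K * norm (z - w) ^ Suc 2 / fact 2"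
    by (rule field_Taylor[where S = "{a..b}"]) (use assms in \<open>auto simp: numeral_3_eq_3 numeral_2_eq_2\<close>)
  moreover have "(\<Sum>i\<le>2. f i w * (z - w) ^ i / fact i) = f 0 w + f 1 w * (z - w) + f 2 w * (z - w)\<^sup>2 / 2"
    by (simp add: numeral_2_eq_2 fact_2)
  ultimately show ?thesis by (simp add: fact_2 numeral_3_eq_3 algebra_simps)
qed

lemma central_difference:
  fixes f :: "nat \<Rightarrow> real \<Rightarrow> real"
  assumes der: "\<And>i x. x \<in> {a..b} \<Longrightarrow> i \<le> 2 \<Longrightarrow> (f i has_real_derivative f (Suc i) x) (at x within {a..b})"
    and K: "\<And>x. x \<in> {a..b} \<Longrightarrow> \<bar>f 3 x\<bar> \<le> K"
    and d: "0 < d" "a \<le> y - d" "y + d \<le> b"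
  shows "\<bar>(f 0 (y + d) - f 0 (y - d)) / (2 * d) - f 1 y\<bar> \<le> K * d\<^sup>2"
proof -
  have mem: "y \<in> {a..b}" "y + d \<in> {a..b}" "y - d \<in> {a..b}" using d by auto
  note T = Taylor_quadratic[where f = f, OF der K]
  have "\<bar>f 0 (y + d) - f 0 y - f 1 y * d - f 2 y * d\<^sup>2 / 2\<bar> \<le> K * d ^ 3 / 2"
    using T[of y "y + d"] mem d by simp
  moreover have "\<bar>f 0 (y - d) - f 0 y + f 1 y * d - f 2 y * d\<^sup>2 / 2\<bar> \<le> K * d ^ 3 / 2"
    using T[of y "y - d"] mem d by simp
  ultimately have "\<bar>f 0 (y + d) - f 0 (y - d) - f 1 y * (2 * d)\<bar> \<le> K * d ^ 3"
    by linarith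
  moreover have "(f 0 (y + d) - f 0 (y - d)) / (2 * d) - f 1 y = (f 0 (y + d) - f 0 (y - d) - f 1 y * (2 * d)) / (2 * d)"
    using d by (simp add: field_simps)
  ultimately have "\<bar>(f 0 (y + d) - f 0 (y - d)) / (2 * d) - f 1 y\<bar> \<le> K * d ^ 3 / (2 * d)"
    using d by (simp add: divide_right_mono)
  also have "\<dots> = K * d\<^sup>2 / 2" using d by (simp add: power2_eq_square power3_eq_cube)
  also have "\<dots> \<le> K * d\<^sup>2" using K[OF mem(1)] by simp
  finally show ?thesis .
qed

lemma one_sided_difference:
  fixes f :: "nat \<Rightarrow> real \<Rightarrow> real"
  assumes der: "\<And>i x. x \<in> {a..b} \<Longrightarrow> i \<le> 2 \<Longrightarrow> (f i has_real_derivative f (Suc i) x) (at x within {a..b})"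
    and K: "\<And>x. x \<in> {a..b} \<Longrightarrow> \<bar>f 3 x\<bar> \<le> K"
    and d: "d \<noteq> 0" and mem: "y \<in> {a..b}" "y + d \<in> {a..b}" "y + 2 * d \<in> {a..b}"
  shows "\<bar>(4 * f 0 (y + d) - f 0 (y + 2 * d) - 3 * f 0 y) / (2 * d) - f 1 y\<bar> \<le> 3 * K * d\<^sup>2"
proof -
  note T = Taylor_quadratic[where f = f, OF der K]
  have "\<bar>f 0 (y + d) - f 0 y - f 1 y * d - f 2 y * d\<^sup>2 / 2\<bar> \<le> K * \<bar>d\<bar> ^ 3 / 2"
    using T[of y "y + d"] mem by simp
  moreover have "\<bar>f 0 (y + 2 * d) - f 0 y - f 1 y * (2 * d) - f 2 y * d\<^sup>2 * 2\<bar> \<le> K * \<bar>d\<bar> ^ 3 * 4"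
    using T[of y "y + 2 * d"] mem by (simp add: power_mult_distrib abs_mult mult.commute mult.left_commute)
  ultimately have "\<bar>4 * f 0 (y + d) - f 0 (y + 2 * d) - 3 * f 0 y - f 1 y * (2 * d)\<bar> \<le> 6 * K * \<bar>d\<bar> ^ 3"
    by linarith
  moreover have "(4 * f 0 (y + d) - f 0 (y + 2 * d) - 3 * f 0 y) / (2 * d) - f 1 y
      = (4 * f 0 (y + d) - f 0 (y + 2 * d) - 3 * f 0 y - f 1 y * (2 * d)) / (2 * d)"
    using d by (simp add: diff_divide_distrib)
  ultimately have "\<bar>(4 * f 0 (y + d) - f 0 (y + 2 * d) - 3 * f 0 y) / (2 * d) - f 1 y\<bar> \<le> 6 * K * \<bar>d\<bar> ^ 3 / \<bar>2 * d\<bar>"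
    by (simp only: abs_divide) (rule divide_right_mono, auto)
  also have "\<dots> = 3 * K * d\<^sup>2"
    using d by (simp add: power3_eq_cube power2_eq_square abs_mult)
  finally show ?thesis .
qed

section \<open>The friction coefficient\<close>

text \<open>
  The factor in front of the velocity, both in the trajectory equation (\<open>p = \<partial>\<^sub>X x\<close>) and in the scheme
  (\<open>p = Dt_h x\<close>), with \<open>f\<close> the value of the initial density.
\<close>

definition friction :: "real \<Rightarrow> real \<Rightarrow> real \<Rightarrow> real" where
  "friction m f p = f / (m * (f / p) powr (m - 1))"

lemma powr_le_endpoints:
  fixes a b z \<gamma> :: real
  assumes "0 < a" "a \<le> z" "z \<le> b"
  shows "z powr \<gamma> \<le> a powr \<gamma> + b powr \<gamma>"
proof (cases "0 \<le> \<gamma>")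
  case True
  then have "z powr \<gamma> \<le> b powr \<gamma>" using assms by (intro powr_mono2) auto
  then show ?thesis by (simp add: add_increasing)
next
  case False
  then have "z powr \<gamma> \<le> a powr \<gamma>" using assms by (intro powr_mono2') auto
  then show ?thesis by (simp add: add_increasing2)
qed

text \<open>
  On the relevant range, \<open>friction m f p = f / m * (p / f) powr (m - 1)\<close> with \<open>p / f\<close> in a compact interval
  of positive numbers, where powers are bounded and Lipschitz continuous.
\<close>

lemma friction_bounds:
  fixes m bf Bf lo K :: real
  assumes m: "1 < m" and b: "0 < bf" "0 < lo"
  obtains a0 a1 La where "0 < a0" "0 < a1" "0 \<le> La"
    "\<And>f p. bf \<le> f \<Longrightarrow> f \<le> Bf \<Longrightarrow> lo \<le> p \<Longrightarrow> p \<le> K \<Longrightarrow> a0 \<le> friction m f p \<and> friction m f p \<le> a1"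
    "\<And>f p q. bf \<le> f \<Longrightarrow> f \<le> Bf \<Longrightarrow> lo \<le> p \<Longrightarrow> p \<le> K \<Longrightarrow> lo \<le> q \<Longrightarrow> q \<le> K \<Longrightarrow>
       \<bar>friction m f p - friction m f q\<bar> \<le> La * \<bar>p - q\<bar>"
proof -
  define za where "za = lo / max bf Bf"
  define zb where "zb = max lo K / bf"
  define L where "L = (m - 1) * (za powr (m - 2) + zb powr (m - 2))"
  have za: "0 < za" using b by (simp add: za_def less_max_iff_disj)
  have zab: "za \<le> zb" unfolding za_def zb_def using b by (intro frac_le) auto
  have L0: "0 \<le> L" using m by (simp add: L_def)
  have mob: "friction m f p = f / m * (p / f) powr (m - 1)" if "bf \<le> f" "lo \<le> p" for f p
    using that b by (simp add: friction_def powr_divide)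
  have z: "za \<le> p / f \<and> p / f \<le> zb" if "bf \<le> f" "f \<le> Bf" "lo \<le> p" "p \<le> K" for f p
    unfolding za_def zb_def using that b by (auto intro!: frac_le)
  have Lip: "\<bar>x powr (m - 1) - y powr (m - 1)\<bar> \<le> L * \<bar>x - y\<bar>"
    if "za \<le> x" "x \<le> zb" "za \<le> y" "y \<le> zb" for x y
  proof -
    have "norm (x powr (m - 1) - y powr (m - 1)) \<le> L * norm (x - y)"
    proof (rule field_differentiable_bound[where S = "{za..zb}" and f' = "\<lambda>z. (m - 1) * z powr (m - 2)"])
      fix z assume z: "z \<in> {za..zb}"
      then have "0 < z" using za by auto
      have e: "m - 1 - 1 = m - 2" by simp
      show "((\<lambda>z. z powr (m - 1)) has_real_derivative (m - 1) * z powr (m - 2)) (at z within {za..zb})"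
        using has_real_derivative_powr[OF \<open>0 < z\<close>, of "m - 1", unfolded e]
        by (rule has_field_derivative_at_within)
      show "norm ((m - 1) * z powr (m - 2)) \<le> L"
        using z za m by (auto simp: L_def abs_mult intro!: mult_left_mono powr_le_endpoints)
    qed (use that in auto)
    then show ?thesis by simp
  qed
  show thesis
  proof
    show "0 < bf / m * za powr (m - 1)" "0 < max bf Bf / m * zb powr (m - 1)" "0 \<le> max bf Bf / m * (L / bf)"
      using b m za zab L0 by (auto simp: less_max_iff_disj)
  next
    fix f p assume fp: "bf \<le> f" "f \<le> Bf" "lo \<le> p" "p \<le> K"
    have "bf / m * za powr (m - 1) \<le> f / m * (p / f) powr (m - 1)"
      using fp z[OF fp] b m za by (intro mult_mono divide_right_mono powr_mono2) auto
    moreover have "f / m * (p / f) powr (m - 1) \<le> max bf Bf / m * zb powr (m - 1)"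
      using fp z[OF fp] b m za by (intro mult_mono divide_right_mono powr_mono2) auto
    ultimately show "bf / m * za powr (m - 1) \<le> friction m f p \<and> friction m f p \<le> max bf Bf / m * zb powr (m - 1)"
      unfolding mob[OF fp(1,3)] by simp
  next
    fix f p q assume fp: "bf \<le> f" "f \<le> Bf" "lo \<le> p" "p \<le> K" "lo \<le> q" "q \<le> K"
    have "\<bar>friction m f p - friction m f q\<bar> = f / m * \<bar>(p / f) powr (m - 1) - (q / f) powr (m - 1)\<bar>"
      unfolding mob[OF fp(1,3)] mob[OF fp(1,5)] right_diff_distrib[symmetric] abs_mult using fp b m by simp
    also have "\<dots> \<le> f / m * (L * \<bar>p / f - q / f\<bar>)"
      using fp z[of f p] z[of f q] b m by (intro mult_left_mono Lip) auto
    also have "\<dots> = 1 / m * (L * \<bar>p - q\<bar>)"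
      using fp b by (simp flip: diff_divide_distrib)
    also have "\<dots> \<le> max bf Bf / bf / m * (L * \<bar>p - q\<bar>)"
      using b m L0 by (intro mult_right_mono divide_right_mono) auto
    finally show "\<bar>friction m f p - friction m f q\<bar> \<le> max bf Bf / m * (L / bf) * \<bar>p - q\<bar>"
      by (simp add: mult_ac)
  qed
qed

section \<open>Regularity of the exact density\<close>

lemma DERIV_within_interior:
  fixes f :: "real \<Rightarrow> real"
  assumes "(f has_real_derivative D) (at x within {a..b})" "a < x" "x < b"
  shows "(f has_real_derivative D) (at x)"
  using assms at_within_interior[of x "{a..b}"] by (simp add: interior_atLeastAtMost_real)

lemma pd_X_eqI:
  assumes "XL < XR" "X \<in> {XL..XR}"
    and "((\<lambda>Y. x Y t) has_real_derivative D) (at X within {XL..XR})"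
  shows "pd_X XL XR x X t = D"
  unfolding pd_X_def using assms
  by (intro vector_derivative_within_closed_interval)
     (auto simp: has_real_derivative_iff_has_vector_derivative)

text \<open>
  The exact solution with its derivatives: \<open>G i j\<close> is \<open>\<partial>\<^sub>X\<^sup>i \<partial>\<^sub>t\<^sup>j x_e\<close>.  Order four comes from the consistency
  analysis, where the derivative of the defect \<open>D_h x_e - \<partial>\<^sub>X x_e\<close> has to be \<open>O(h\<^sup>2)\<close>.  The constants \<open>lo\<close> and
  \<open>K\<close> are shared: the interval from \<open>lo\<close> to \<open>K\<close> contains \<open>\<partial>\<^sub>X x_e\<close> and also \<open>b\<^sub>f / B\<^sub>f\<close> and \<open>B\<^sub>f / b\<^sub>f\<close>,
  the bounds that the maximum principle gives for the slopes of the numerical trajectory.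
\<close>

locale regular_trajectory =
  fixes m T XL XR bf Bf K lo :: real
    and f0 :: "real \<Rightarrow> real"
    and xe :: "real \<Rightarrow> real \<Rightarrow> real"
    and G :: "nat \<Rightarrow> nat \<Rightarrow> real \<Rightarrow> real \<Rightarrow> real"
  assumes m: "1 < m" and T: "0 < T" and XLR: "XL < XR" and bf: "0 < bf"
    and f0: "\<And>X. X \<in> {XL..XR} \<Longrightarrow> bf \<le> f0 X \<and> f0 X \<le> Bf"
    and G0: "\<And>X t. X \<in> {XL..XR} \<Longrightarrow> t \<in> {0..T} \<Longrightarrow> G 0 0 X t = xe X t"
    and G_X: "\<And>i j X t. i + j < 4 \<Longrightarrow> X \<in> {XL..XR} \<Longrightarrow> t \<in> {0..T} \<Longrightarrow>
        ((\<lambda>Y. G i j Y t) has_real_derivative G (Suc i) j X t) (at X within {XL..XR})"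
    and G_t: "\<And>i j X t. i + j < 4 \<Longrightarrow> X \<in> {XL..XR} \<Longrightarrow> t \<in> {0..T} \<Longrightarrow>
        ((\<lambda>s. G i j X s) has_real_derivative G i (Suc j) X t) (at t within {0..T})"
    and G_le: "\<And>i j X t. i + j \<le> 4 \<Longrightarrow> X \<in> {XL..XR} \<Longrightarrow> t \<in> {0..T} \<Longrightarrow> \<bar>G i j X t\<bar> \<le> K"
    and lo: "0 < lo" "lo \<le> bf / Bf" and K_ge: "Bf / bf \<le> K"
    and lo_le: "\<And>X t. X \<in> {XL..XR} \<Longrightarrow> t \<in> {0..T} \<Longrightarrow> lo \<le> G 1 0 X t"
    and sol: "trajectory_solution m T XL XR f0 xe"
begin

lemma Bf_pos: "0 < Bf" and bf_le_Bf: "bf \<le> Bf"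
  using f0[of XL] XLR bf by auto

lemma K_ge_1: "1 \<le> K"
  using K_ge bf_le_Bf bf by (smt (verit) le_divide_eq_1_pos)

lemma pd_X_eq:
  assumes "X \<in> {XL..XR}" "t \<in> {0..T}"
  shows "pd_X XL XR xe X t = G 1 0 X t"
proof -
  have "((\<lambda>Y. xe Y t) has_real_derivative G 1 0 X t) (at X within {XL..XR})"
    using G_X[of 0 0 X t] assms G0
    by (auto intro: has_field_derivative_transform_within[where d = 1])
  then show ?thesis by (rule pd_X_eqI[OF XLR assms(1)])
qed

lemma pd_t_eq:
  assumes "X \<in> {XL..XR}" "t \<in> {0..T}"
  shows "pd_t T xe X t = G 0 1 X t"
proof -
  have "((\<lambda>s. xe X s) has_real_derivative G 0 1 X t) (at t within {0..T})"
    using G_t[of 0 0 X t] assms G0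
    by (auto intro: has_field_derivative_transform_within[where d = 1])
  then show ?thesis
    unfolding pd_t_def using assms T
    by (intro vector_derivative_within_closed_interval)
       (auto simp: has_real_derivative_iff_has_vector_derivative)
qed

text \<open>
  The exact density along trajectories.
\<close>

definition u :: "real \<Rightarrow> real \<Rightarrow> real" where
  "u t X = f0 X / G 1 0 X t"

text \<open>
  The derivative of order \<open>k \<le> 2\<close> in \<open>X\<close> of \<open>\<partial>\<^sub>X x_e * \<partial>\<^sub>t x_e\<close>.
\<close>

definition vel :: "nat \<Rightarrow> real \<Rightarrow> real \<Rightarrow> real" where
  "vel k t X =
     (if k = 0 then G 1 0 X t * G 0 1 X t
      else if k = 1 then G 2 0 X t * G 0 1 X t + G 1 0 X t * G 1 1 X t
      else G 3 0 X t * G 0 1 X t + 2 * G 2 0 X t * G 1 1 X t + G 1 0 X t * G 2 1 X t)"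

lemma u_bounds:
  assumes "X \<in> {XL..XR}" "t \<in> {0..T}"
  shows "bf / K \<le> u t X" "u t X \<le> Bf / lo" "0 < u t X"
proof -
  have "G 1 0 X t \<le> K" "lo \<le> G 1 0 X t" using G_le[of 1 0 X t] lo_le[of X t] assms by auto
  then show "bf / K \<le> u t X" "u t X \<le> Bf / lo"
    unfolding u_def using f0[of X] assms bf lo by (auto intro!: frac_le)
  then show "0 < u t X" using bf K_ge_1 by (smt (verit) divide_pos_pos)
qed

lemma PDE:
  assumes X: "X \<in> {XL<..<XR}" and t: "t \<in> {0<..T}"
  shows "(u t has_real_derivative - (friction m (f0 X) (G 1 0 X t) * G 0 1 X t)) (at X)"
proof -
  have mem: "X \<in> {XL..XR}" "t \<in> {0..T}" using assms by auto
  let ?w = "\<lambda>Y. f0 Y / pd_X XL XR xe Y t"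
  have "?w differentiable at X"
    and eq: "f0 X / (m * (f0 X / pd_X XL XR xe X t) powr (m - 1)) * pd_t T xe X t = - deriv ?w X"
    using sol X t unfolding trajectory_solution_def by blast+
  then have "(?w has_real_derivative deriv ?w X) (at X)"
    by (metis DERIV_imp_deriv real_differentiableE)
  then have "(u t has_real_derivative deriv ?w X) (at X)"
    by (rule has_field_derivative_transform_within_open[where S = "{XL<..<XR}"])
       (use X t in \<open>auto simp: u_def pd_X_eq\<close>)
  moreover have "deriv ?w X = - (friction m (f0 X) (G 1 0 X t) * G 0 1 X t)"
    using eq unfolding pd_X_eq[OF mem] pd_t_eq[OF mem] by (simp add: friction_def)
  ultimately show ?thesis by simp
qed

text \<open>
  Substituting \<open>f\<^sub>0 = u * \<partial>\<^sub>X x_e\<close> removes \<open>f\<^sub>0\<close> from the trajectory equation and leaves an ordinary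
  differential equation for \<open>u\<close> whose coefficient \<open>vel 0\<close> is as smooth as the trajectory.
\<close>

lemma friction_u:
  assumes "X \<in> {XL..XR}" "t \<in> {0..T}"
  shows "friction m (f0 X) (G 1 0 X t) * G 0 1 X t = u t X powr (2 - m) * vel 0 t X / m"
proof -
  note u = u_bounds(3)[OF assms]
  have G1: "0 < G 1 0 X t" using lo_le[OF assms] lo by linarith
  have "u t X powr (2 - m) * u t X powr (m - 1) = u t X"
    using u by (simp flip: powr_add)
  then have "u t X / u t X powr (m - 1) = u t X powr (2 - m)"
    using u by (simp add: field_simps)
  moreover have "f0 X = u t X * G 1 0 X t" using G1 by (simp add: u_def)
  then have "friction m (f0 X) (G 1 0 X t) = (u t X / u t X powr (m - 1)) * G 1 0 X t / m"
    unfolding friction_def u_def[symmetric] by (simp add: mult.commute)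
  ultimately show ?thesis by (simp add: vel_def)
qed

text \<open>
  Products of powers of \<open>u\<close> and smooth functions are closed under differentiation; this is all that the higher
  derivatives of \<open>u\<close> need.
\<close>

lemma u_powr_deriv:
  assumes X: "X \<in> {XL<..<XR}" and t: "t \<in> {0<..T}"
  shows "((\<lambda>Y. u t Y powr \<gamma>) has_real_derivative - (\<gamma> / m) * (u t X powr (\<gamma> + 1 - m) * vel 0 t X)) (at X)"
proof -
  have mem: "X \<in> {XL..XR}" "t \<in> {0..T}" using assms by auto
  have D: "((\<lambda>Y. u t Y powr \<gamma>) has_real_derivative (\<gamma> * u t X powr (\<gamma> - 1)) * - (u t X powr (2 - m) * vel 0 t X / m)) (at X)"
    using DERIV_chain2[OF has_real_derivative_powr[OF u_bounds(3)[OF mem]] PDE[OF assms, unfolded friction_u[OF mem]]] .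
  have U: "u t X powr (\<gamma> - 1) * u t X powr (2 - m) = u t X powr (\<gamma> + 1 - m)"
    by (simp flip: powr_add add: algebra_simps)
  have "(\<gamma> * u t X powr (\<gamma> - 1)) * - (u t X powr (2 - m) * vel 0 t X / m)
     = - (\<gamma> / m) * ((u t X powr (\<gamma> - 1) * u t X powr (2 - m)) * vel 0 t X)"
    by simp
  with D show ?thesis unfolding U by (simp only:)
qed

lemma vel_deriv:
  assumes X: "X \<in> {XL<..<XR}" and t: "t \<in> {0<..T}" and "k < 2"
  shows "(vel k t has_real_derivative vel (Suc k) t X) (at X)"
proof -
  have D: "((\<lambda>Y. G i j Y t) has_real_derivative G (Suc i) j X t) (at X)" if "i + j < 4" for i j
    using DERIV_within_interior[OF G_X[OF that, of X t]] X t by simp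
  have "k = 0 \<or> k = 1" using \<open>k < 2\<close> by auto
  then show ?thesis
    unfolding vel_def
    by (auto intro!: derivative_eq_intros D[THEN DERIV_cong] simp: numeral_2_eq_2 numeral_3_eq_3 algebra_simps)
qed

text \<open>
  The derivatives of \<open>u t\<close> up to order three, computed by differentiating \<open>u' = - u powr (2 - m) * vel 0 / m\<close>.
  Although \<open>f\<^sub>0\<close> carries no smoothness assumption, these expressions involve only powers of \<open>u\<close> and derivatives
  of the trajectory, so they are bounded uniformly in time.
\<close>

definition u_deriv :: "real \<Rightarrow> nat \<Rightarrow> real \<Rightarrow> real" where
  "u_deriv t k X =
    (let U = (\<lambda>\<gamma>. u t X powr \<gamma>); g = vel 0 t X; g1 = vel 1 t X; g2 = vel 2 t X in
     if k = 0 then u t X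
     else if k = 1 then - (1 / m) * (U (2 - m) * g)
     else if k = 2 then - (1 / m) * (- ((2 - m) / m) * (U (3 - 2 * m) * g) * g + U (2 - m) * g1)
     else - (1 / m) * (- ((2 - m) / m) * (- ((3 - 2 * m) / m) * (U (4 - 3 * m) * g) * g\<^sup>2 + U (3 - 2 * m) * (2 * g * g1))
           + (- ((2 - m) / m) * (U (3 - 2 * m) * g) * g1 + U (2 - m) * g2)))"

lemma u_deriv_0: "u_deriv t 0 = u t"
  by (simp add: u_deriv_def Let_def fun_eq_iff)

lemma u_deriv_1:
  assumes "X \<in> {XL..XR}" "t \<in> {0..T}"
  shows "u_deriv t 1 X = - (friction m (f0 X) (G 1 0 X t) * G 0 1 X t)"
  unfolding friction_u[OF assms] by (simp add: u_deriv_def)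

lemma u_deriv_deriv:
  assumes X: "X \<in> {XL<..<XR}" and t: "t \<in> {0<..T}" and "k \<le> 2"
  shows "(u_deriv t k has_real_derivative u_deriv t (Suc k) X) (at X)"
proof -
  have e: "\<And>\<gamma>. 2 - m + 1 - m = 3 - 2 * m" "3 - 2 * m + 1 - m = 4 - 3 * m" by auto
  note U = u_powr_deriv[OF X t, of "2 - m", unfolded e] u_powr_deriv[OF X t, of "3 - 2 * m", unfolded e]
  note V = vel_deriv[OF X t, of 0, simplified] vel_deriv[OF X t, of 1, simplified]
  consider "k = 0" | "k = 1" | "k = 2" using \<open>k \<le> 2\<close> by linarith
  then show ?thesis
  proof cases
    case 1
    have "X \<in> {XL..XR}" "t \<in> {0..T}" using X t by auto
    then show ?thesis using PDE[OF X t] u_deriv_1[of X t] by (simp add: 1 u_deriv_0)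
  next
    case 2
    have "u_deriv t 1 = (\<lambda>Y. - (1 / m) * (u t Y powr (2 - m) * vel 0 t Y))"
      by (simp add: u_deriv_def fun_eq_iff)
    moreover have "u_deriv t 2 X = - (1 / m) * (- ((2 - m) / m) * (u t X powr (3 - 2 * m) * vel 0 t X) * vel 0 t X
        + vel 1 t X * u t X powr (2 - m))"
      by (simp add: u_deriv_def Let_def mult.commute)
    ultimately show ?thesis
      using DERIV_cmult[OF DERIV_mult[OF U(1) V(1)], of "- (1 / m)"] 2 by (simp add: numeral_2_eq_2)
  next
    case 3
    have "u_deriv t 2 = (\<lambda>Y. - (1 / m) * (- ((2 - m) / m) * (u t Y powr (3 - 2 * m) * (vel 0 t Y * vel 0 t Y))
         + u t Y powr (2 - m) * vel 1 t Y))"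
      by (simp add: u_deriv_def Let_def fun_eq_iff)
    moreover have "u_deriv t 3 X = - (1 / m) * (- ((2 - m) / m) *
        (- ((3 - 2 * m) / m) * (u t X powr (4 - 3 * m) * vel 0 t X) * (vel 0 t X * vel 0 t X)
           + (vel 1 t X * vel 0 t X + vel 1 t X * vel 0 t X) * u t X powr (3 - 2 * m))
        + (- ((2 - m) / m) * (u t X powr (3 - 2 * m) * vel 0 t X) * vel 1 t X + vel 2 t X * u t X powr (2 - m)))"
      by (simp add: u_deriv_def Let_def power2_eq_square algebra_simps)
    ultimately show ?thesis
      using DERIV_cmult[OF DERIV_add[OF DERIV_cmult[OF DERIV_mult[OF U(2) DERIV_mult[OF V(1) V(1)]]] DERIV_mult[OF U(1) V(2)]],
          of "- (1 / m)" "- ((2 - m) / m)"] 3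
      by (simp add: numeral_2_eq_2 numeral_3_eq_3)
  qed
qed

definition unif_bdd :: "(real \<Rightarrow> real \<Rightarrow> real) \<Rightarrow> bool" where
  "unif_bdd f \<longleftrightarrow> (\<exists>B. \<forall>t\<in>{0..T}. \<forall>X\<in>{XL..XR}. \<bar>f t X\<bar> \<le> B)"

lemma unif_bdd_const: "unif_bdd (\<lambda>t X. c)"
  unfolding unif_bdd_def by auto

lemma unif_bdd_add:
  assumes "unif_bdd f" "unif_bdd g" shows "unif_bdd (\<lambda>t X. f t X + g t X)"
proof -
  obtain A B where "\<forall>t\<in>{0..T}. \<forall>X\<in>{XL..XR}. \<bar>f t X\<bar> \<le> A" "\<forall>t\<in>{0..T}. \<forall>X\<in>{XL..XR}. \<bar>g t X\<bar> \<le> B"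
    using assms unfolding unif_bdd_def by blast
  then show ?thesis unfolding unif_bdd_def
    by (intro exI[of _ "A + B"]) (meson abs_triangle_ineq add_mono order_trans)
qed

lemma unif_bdd_mult:
  assumes "unif_bdd f" "unif_bdd g" shows "unif_bdd (\<lambda>t X. f t X * g t X)"
proof -
  obtain A B where "\<forall>t\<in>{0..T}. \<forall>X\<in>{XL..XR}. \<bar>f t X\<bar> \<le> A" "\<forall>t\<in>{0..T}. \<forall>X\<in>{XL..XR}. \<bar>g t X\<bar> \<le> B"
    using assms unfolding unif_bdd_def by blast
  then show ?thesis unfolding unif_bdd_def
    by (intro exI[of _ "A * B"]) (auto simp: abs_mult intro!: mult_mono order_trans[OF abs_ge_zero])
qed

lemma unif_bdd_if:
  "unif_bdd f \<Longrightarrow> unif_bdd g \<Longrightarrow> unif_bdd (\<lambda>t X. if c then f t X else g t X)"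
  by (cases c) auto

lemma unif_bdd_G: "i + j \<le> 4 \<Longrightarrow> unif_bdd (\<lambda>t X. G i j X t)"
  unfolding unif_bdd_def using G_le by blast

lemma unif_bdd_u_powr: "unif_bdd (\<lambda>t X. u t X powr \<gamma>)"
  unfolding unif_bdd_def
proof (intro exI ballI)
  fix t X assume "t \<in> {0..T}" "X \<in> {XL..XR}"
  then show "\<bar>u t X powr \<gamma>\<bar> \<le> (bf / K) powr \<gamma> + (Bf / lo) powr \<gamma>"
    using u_bounds[of X t] bf K_ge_1 powr_le_endpoints[of "bf / K" "u t X" "Bf / lo" \<gamma>] by simp
qed

lemma unif_bdd_u: "unif_bdd u"
  unfolding unif_bdd_def
  using u_bounds by (intro exI[of _ "Bf / lo"]) (auto simp: abs_if intro: less_imp_le dest: less_asym)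

lemma unif_bdd_vel: "unif_bdd (vel k)"
proof -
  have "unif_bdd (\<lambda>t X. vel k t X)"
    unfolding vel_def
    by (intro unif_bdd_if unif_bdd_add unif_bdd_mult unif_bdd_const unif_bdd_G) auto
  then show ?thesis by simp
qed

lemma u_deriv_bounded:
  obtains B where "0 < B" "\<And>k t X. k \<le> 3 \<Longrightarrow> t \<in> {0..T} \<Longrightarrow> X \<in> {XL..XR} \<Longrightarrow> \<bar>u_deriv t k X\<bar> \<le> B"
proof -
  have "unif_bdd (\<lambda>t X. u_deriv t k X)" for k
    unfolding u_deriv_def Let_def power2_eq_square
    by (intro unif_bdd_if unif_bdd_add unif_bdd_mult unif_bdd_const unif_bdd_u_powr unif_bdd_vel unif_bdd_u)
  then obtain b where b: "\<And>k t X. t \<in> {0..T} \<Longrightarrow> X \<in> {XL..XR} \<Longrightarrow> \<bar>u_deriv t k X\<bar> \<le> b k"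
    unfolding unif_bdd_def by metis
  show thesis
  proof
    show "0 < 1 + (\<Sum>k\<le>3::nat. \<bar>b k\<bar>)" by (simp add: add_pos_nonneg sum_nonneg)
    fix k :: nat and t X assume *: "k \<le> 3" "t \<in> {0..T}" "X \<in> {XL..XR}"
    have "\<bar>b k\<bar> \<le> (\<Sum>k\<le>3::nat. \<bar>b k\<bar>)" by (rule member_le_sum) (use * in auto)
    then show "\<bar>u_deriv t k X\<bar> \<le> 1 + (\<Sum>k\<le>3::nat. \<bar>b k\<bar>)"
      using b[OF *(2,3), of k] by linarith
  qed
qed

text \<open>
  At a fixed positive time \<open>f\<^sub>0\<close> is the product of \<open>u\<close> and \<open>\<partial>\<^sub>X x_e\<close>.  The end points are excluded, since the
  equation holds in the open interval and \<open>f\<^sub>0\<close> may jump there.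
\<close>

lemma f0_Lipschitz:
  obtains L where "0 < L" "\<And>x y. x \<in> {XL<..<XR} \<Longrightarrow> y \<in> {XL<..<XR} \<Longrightarrow> \<bar>f0 x - f0 y\<bar> \<le> L * \<bar>x - y\<bar>"
proof -
  obtain B where B: "0 < B" "\<And>k t X. k \<le> 3 \<Longrightarrow> t \<in> {0..T} \<Longrightarrow> X \<in> {XL..XR} \<Longrightarrow> \<bar>u_deriv t k X\<bar> \<le> B"
    using u_deriv_bounded by blast
  have tT: "T \<in> {0<..T}" "T \<in> {0..T}" using T by auto
  show thesis
  proof
    show "0 < B * K + K * B" using B K_ge_1 by (auto intro!: add_pos_pos mult_pos_pos)
    fix x y assume xy: "x \<in> {XL<..<XR}" "y \<in> {XL<..<XR}"
    have "norm (u T x * G 1 0 x T - u T y * G 1 0 y T) \<le> (B * K + K * B) * norm (x - y)"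
    proof (rule field_differentiable_bound[where S = "{XL<..<XR}" and f' = "\<lambda>z. u_deriv T 1 z * G 1 0 z T + G 2 0 z T * u T z"])
      fix z assume z: "z \<in> {XL<..<XR}"
      have "(u T has_real_derivative u_deriv T 1 z) (at z)"
        using u_deriv_deriv[OF z tT(1), of 0] by (simp add: u_deriv_0)
      moreover have "((\<lambda>Y. G 1 0 Y T) has_real_derivative G 2 0 z T) (at z)"
        using DERIV_within_interior[OF G_X[of 1 0 z T]] z tT by (simp add: numeral_2_eq_2)
      ultimately show "((\<lambda>z. u T z * G 1 0 z T) has_real_derivative u_deriv T 1 z * G 1 0 z T + G 2 0 z T * u T z) (at z within {XL<..<XR})"
        by (rule has_field_derivative_at_within[OF DERIV_mult])
      have z': "z \<in> {XL..XR}" using z by auto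
      have "\<bar>u_deriv T 1 z * G 1 0 z T\<bar> \<le> B * K" "\<bar>G 2 0 z T * u T z\<bar> \<le> K * B"
        unfolding abs_mult using B(2)[of 1 T z] B(2)[of 0 T z] G_le[of 1 0 z T] G_le[of 2 0 z T] z' tT B(1) K_ge_1
        by (intro mult_mono; simp add: u_deriv_0)+
      then show "norm (u_deriv T 1 z * G 1 0 z T + G 2 0 z T * u T z) \<le> B * K + K * B"
        unfolding real_norm_def by linarith
    qed (use xy in auto)
    moreover have "u T z * G 1 0 z T = f0 z" if "z \<in> {XL<..<XR}" for z
      using lo_le[of z T] that tT lo by (auto simp: u_def)
    ultimately show "\<bar>f0 x - f0 y\<bar> \<le> (B * K + K * B) * \<bar>x - y\<bar>" using xy by simp
  qed
qed

end

section \<open>Consistency of the scheme\<close>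

lemma MVT_within:
  fixes f f' :: "real \<Rightarrow> real"
  assumes "a < b" "\<And>x. x \<in> {a..b} \<Longrightarrow> (f has_real_derivative f' x) (at x within {a..b})"
  obtains x where "x \<in> {a<..<b}" "f b - f a = f' x * (b - a)"
  using mvt_simple[of a b f "\<lambda>x. (*) (f' x)"] assms by (force simp: has_field_derivative_def)

lemma DERIV_shift_within:
  fixes f f' :: "real \<Rightarrow> real"
  assumes "\<And>x. x \<in> {A..B} \<Longrightarrow> (f has_real_derivative f' x) (at x within {A..B})"
    and "A \<le> a + c" "b + c \<le> B" "y \<in> {a..b}"
  shows "((\<lambda>y. f (y + c)) has_real_derivative f' (y + c)) (at y within {a..b})"
proof -
  have "(\<lambda>y. y + c) ` {a..b} \<subseteq> {A..B}" using assms by auto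
  then have "(f has_real_derivative f' (y + c)) (at (y + c) within (\<lambda>y. y + c) ` {a..b})"
    using assms by (intro has_field_derivative_subset[OF assms(1)]) auto
  moreover have "((\<lambda>y. y + c) has_real_derivative 1) (at y within {a..b})"
    by (auto intro!: derivative_eq_intros)
  ultimately show ?thesis
    using DERIV_image_chain[of f _ "\<lambda>y. y + c" y "{a..b}" 1] by (simp add: o_def)
qed

context regular_trajectory
begin

lemma G_X_within:
  assumes "i + j < 4" "t \<in> {0..T}" "XL \<le> a" "b \<le> XR" "Y \<in> {a..b}"
  shows "((\<lambda>Y. G i j Y t) has_real_derivative G (Suc i) j Y t) (at Y within {a..b})"
  using assms by (intro has_field_derivative_subset[OF G_X]) auto

lemma G_time_Lipschitz:
  assumes "i + j < 4" "X \<in> {XL..XR}" "s \<in> {0..T}" "t \<in> {0..T}"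
  shows "\<bar>G i j X t - G i j X s\<bar> \<le> K * \<bar>t - s\<bar>"
proof -
  have "norm (G i j X t - G i j X s) \<le> K * norm (t - s)"
    by (rule field_differentiable_bound[where S = "{0..T}" and f' = "G i (Suc j) X"])
       (use assms G_t G_le[of i "Suc j" X] in auto)
  then show ?thesis by simp
qed

lemma xe_increment:
  assumes "XL \<le> a" "a < b" "b \<le> XR" "t \<in> {0..T}"
  shows "lo \<le> (xe b t - xe a t) / (b - a)" "(xe b t - xe a t) / (b - a) \<le> K"
proof -
  obtain x where x: "x \<in> {a<..<b}" "G 0 0 b t - G 0 0 a t = G 1 0 x t * (b - a)"
    using MVT_within[of a b "\<lambda>Y. G 0 0 Y t" "\<lambda>Y. G 1 0 Y t"] G_X_within[of 0 0 t a b] assms by auto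
  have "(xe b t - xe a t) / (b - a) = G 1 0 x t"
    using x assms by (simp add: G0 field_simps)
  moreover have "lo \<le> G 1 0 x t" "\<bar>G 1 0 x t\<bar> \<le> K" using lo_le[of x t] G_le[of 1 0 x t] x assms by auto
  ultimately show "lo \<le> (xe b t - xe a t) / (b - a)" "(xe b t - xe a t) / (b - a) \<le> K" by auto
qed

lemma xe_increment_time:
  assumes "XL \<le> a" "a < b" "b \<le> XR" "s \<in> {0..T}" "t \<in> {0..T}"
  shows "\<bar>(xe b t - xe a t) / (b - a) - (xe b s - xe a s) / (b - a)\<bar> \<le> K * \<bar>t - s\<bar>"
proof -
  obtain x where x: "x \<in> {a<..<b}"
    "(G 0 0 b t - G 0 0 b s) - (G 0 0 a t - G 0 0 a s) = (G 1 0 x t - G 1 0 x s) * (b - a)"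
    using MVT_within[of a b "\<lambda>Y. G 0 0 Y t - G 0 0 Y s" "\<lambda>Y. G 1 0 Y t - G 1 0 Y s"]
      DERIV_diff[OF G_X_within[of 0 0 t a b] G_X_within[of 0 0 s a b]] assms by auto
  have "(xe b t - xe a t) / (b - a) - (xe b s - xe a s) / (b - a) = ((xe b t - xe b s) - (xe a t - xe a s)) / (b - a)"
    by (simp add: diff_divide_distrib)
  also have "\<dots> = G 1 0 x t - G 1 0 x s"
    using x assms by (simp add: G0)
  finally have "(xe b t - xe a t) / (b - a) - (xe b s - xe a s) / (b - a) = G 1 0 x t - G 1 0 x s" .
  then show ?thesis using G_time_Lipschitz[of 1 0 x s t] x assms by auto
qed

lemma G_central_difference:
  assumes "i \<le> 1" "t \<in> {0..T}" "0 < d" "XL \<le> y - d" "y + d \<le> XR"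
  shows "\<bar>(G i 0 (y + d) t - G i 0 (y - d) t) / (2 * d) - G (Suc i) 0 y t\<bar> \<le> K * d\<^sup>2"
  using central_difference[of XL XR "\<lambda>k Y. G (k + i) 0 Y t" K d y] assms G_X G_le by auto

text \<open>
  The discrete exact density \<open>f\<^sub>0 / Gh\<close>, with \<open>Gh Y\<close> the difference quotient of \<open>x_e\<close> over the cell centred
  at \<open>Y\<close>, is \<open>u * (\<partial>\<^sub>X x_e / Gh)\<close>.  Its deviation from \<open>u\<close> is differentiated once more by the scheme, so
  smallness \<open>O(h\<^sup>2)\<close> of the deviation does not suffice: the same is needed for its derivative.
\<close>

lemma density_ratio_derivative:
  assumes t: "t \<in> {0<..T}" and h: "0 < h" "XL \<le> y - h" "y + h \<le> XR"
    and B: "0 < B" "\<And>k t X. k \<le> 3 \<Longrightarrow> t \<in> {0..T} \<Longrightarrow> X \<in> {XL..XR} \<Longrightarrow> \<bar>u_deriv t k X\<bar> \<le> B"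
    and Y: "Y \<in> {y - h / 2..y + h / 2}"
  defines "Gh \<equiv> \<lambda>Y. (G 0 0 (Y + h / 2) t - G 0 0 (Y - h / 2) t) / h"
  obtains D where
    "((\<lambda>Y. u t Y * (G 1 0 Y t / Gh Y - 1)) has_real_derivative D) (at Y within {y - h / 2..y + h / 2})"
    "\<bar>D\<bar> \<le> (B * K / lo + B * (2 * K\<^sup>2) / lo\<^sup>2) * h\<^sup>2"
proof -
  have tT: "t \<in> {0..T}" using t by auto
  have mem: "Y \<in> {XL<..<XR}" "Y \<in> {XL..XR}" using Y h by auto
  define G1h where "G1h = (G 1 0 (Y + h / 2) t - G 1 0 (Y - h / 2) t) / h"
  let ?S = "{y - h / 2..y + h / 2}"
  have Gh_lo: "lo \<le> Gh Y"
    using xe_increment(1)[of "Y - h / 2" "Y + h / 2" t] Y h tT by (auto simp: Gh_def G0)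
  have Gh0: "0 < Gh Y" using Gh_lo lo by linarith
  have sh: "((\<lambda>Y. G 0 0 (Y + c) t) has_real_derivative G 1 0 (Y + c) t) (at Y within ?S)"
    if "XL \<le> y - h / 2 + c" "y + h / 2 + c \<le> XR" for c
    using DERIV_shift_within[of XL XR "\<lambda>Y. G 0 0 Y t" "\<lambda>Y. G 1 0 Y t" "y - h / 2" c "y + h / 2" Y]
      G_X[of 0 0 _ t] tT that Y by auto
  have dG: "(Gh has_real_derivative G1h) (at Y within ?S)"
    unfolding Gh_def G1h_def
    using DERIV_cdivide[OF DERIV_diff[OF sh[of "h / 2"] sh[of "- (h / 2)"]], of h] h by simp
  have du: "(u t has_real_derivative u_deriv t 1 Y) (at Y within ?S)"
    using has_field_derivative_at_within[OF u_deriv_deriv[OF mem(1) t, of 0]] by (simp add: u_deriv_0)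
  have d1: "((\<lambda>Y. G 1 0 Y t) has_real_derivative G 2 0 Y t) (at Y within ?S)"
    using G_X_within[of 1 0 t "y - h / 2" "y + h / 2" Y] tT h Y by (simp add: numeral_2_eq_2)
  define \<rho>' where "\<rho>' = (G 2 0 Y t * Gh Y - G 1 0 Y t * G1h) / (Gh Y * Gh Y)"
  have d\<rho>: "((\<lambda>Y. G 1 0 Y t / Gh Y - 1) has_real_derivative \<rho>') (at Y within ?S)"
    using DERIV_diff[OF DERIV_divide[OF d1 dG] DERIV_const[of 1]] Gh0 by (simp add: \<rho>'_def)
  have c0: "\<bar>Gh Y - G 1 0 Y t\<bar> \<le> K * h\<^sup>2"
  proof -
    have "\<bar>Gh Y - G 1 0 Y t\<bar> \<le> K * (h / 2)\<^sup>2"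
      using G_central_difference[of 0 t "h / 2" Y] h tT Y by (simp add: Gh_def)
    also have "\<dots> \<le> K * h\<^sup>2" using K_ge_1 by (simp add: power_divide)
    finally show ?thesis .
  qed
  have c1: "\<bar>G1h - G 2 0 Y t\<bar> \<le> K * h\<^sup>2"
  proof -
    have "\<bar>G1h - G 2 0 Y t\<bar> \<le> K * (h / 2)\<^sup>2"
      using G_central_difference[of 1 t "h / 2" Y] h tT Y by (simp add: G1h_def numeral_2_eq_2)
    also have "\<dots> \<le> K * h\<^sup>2" using K_ge_1 by (simp add: power_divide)
    finally show ?thesis .
  qed
  have b0: "\<bar>G 1 0 Y t / Gh Y - 1\<bar> \<le> K * h\<^sup>2 / lo"
  proof -
    have "\<bar>G 1 0 Y t / Gh Y - 1\<bar> = \<bar>Gh Y - G 1 0 Y t\<bar> / Gh Y"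
      using Gh0 by (simp add: field_simps abs_minus_commute)
    also have "\<dots> \<le> K * h\<^sup>2 / lo" using c0 Gh_lo lo by (intro frac_le) auto
    finally show ?thesis .
  qed
  have b1: "\<bar>\<rho>'\<bar> \<le> 2 * K\<^sup>2 * h\<^sup>2 / lo\<^sup>2"
  proof -
    have "G 2 0 Y t * Gh Y - G 1 0 Y t * G1h = G 2 0 Y t * (Gh Y - G 1 0 Y t) - G 1 0 Y t * (G1h - G 2 0 Y t)"
      by (simp add: algebra_simps)
    moreover have "\<bar>G 2 0 Y t * (Gh Y - G 1 0 Y t)\<bar> \<le> K * (K * h\<^sup>2)"
      unfolding abs_mult by (intro mult_mono c0 G_le) (use mem tT K_ge_1 in auto)
    moreover have "\<bar>G 1 0 Y t * (G1h - G 2 0 Y t)\<bar> \<le> K * (K * h\<^sup>2)"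
      unfolding abs_mult by (intro mult_mono c1 G_le) (use mem tT K_ge_1 in auto)
    ultimately have "\<bar>G 2 0 Y t * Gh Y - G 1 0 Y t * G1h\<bar> \<le> 2 * (K * (K * h\<^sup>2))" by linarith
    then have "\<bar>\<rho>'\<bar> \<le> 2 * (K * (K * h\<^sup>2)) / (lo * lo)"
      unfolding \<rho>'_def abs_divide using Gh_lo lo K_ge_1
      by (intro frac_le) (auto simp: abs_mult intro!: mult_mono)
    then show ?thesis by (simp add: power2_eq_square mult_ac)
  qed
  show thesis
  proof
    show "((\<lambda>Y. u t Y * (G 1 0 Y t / Gh Y - 1)) has_real_derivative
        u_deriv t 1 Y * (G 1 0 Y t / Gh Y - 1) + \<rho>' * u t Y) (at Y within ?S)"
      by (rule DERIV_mult[OF du d\<rho>])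
    have "\<bar>u_deriv t 1 Y * (G 1 0 Y t / Gh Y - 1)\<bar> \<le> B * (K * h\<^sup>2 / lo)"
      unfolding abs_mult by (intro mult_mono b0 B(2)) (use mem tT B in auto)
    moreover have "\<bar>\<rho>' * u t Y\<bar> \<le> (2 * K\<^sup>2 * h\<^sup>2 / lo\<^sup>2) * B"
      unfolding abs_mult using B(2)[of 0 t Y] mem tT
      by (intro mult_mono b1) (use B in \<open>auto simp: u_deriv_0\<close>)
    ultimately have "\<bar>u_deriv t 1 Y * (G 1 0 Y t / Gh Y - 1) + \<rho>' * u t Y\<bar> \<le> B * (K * h\<^sup>2 / lo) + (2 * K\<^sup>2 * h\<^sup>2 / lo\<^sup>2) * B"
      by linarith
    also have "\<dots> = (B * K / lo + B * (2 * K\<^sup>2) / lo\<^sup>2) * h\<^sup>2" by (simp add: algebra_simps)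
    finally show "\<bar>u_deriv t 1 Y * (G 1 0 Y t / Gh Y - 1) + \<rho>' * u t Y\<bar> \<le> (B * K / lo + B * (2 * K\<^sup>2) / lo\<^sup>2) * h\<^sup>2" .
  qed
qed

text \<open>
  The discrete density splits as \<open>u + v\<close> with \<open>v = u * (\<partial>\<^sub>X x_e / Gh - 1)\<close>.  The central difference of \<open>u\<close>
  approximates \<open>u'\<close> to second order, and that of \<open>v\<close> is \<open>O(h\<^sup>2)\<close> by the mean value theorem.  The points
  \<open>y - h\<close> and \<open>y + h\<close> may lie on the boundary, but \<open>u\<close> and \<open>v\<close> are differentiated only up to half a cell away
  from \<open>y\<close>, inside the open interval.
\<close>

lemma spatial_consistency:
  obtains C where "0 < C"
    "\<And>t y h. t \<in> {0<..T} \<Longrightarrow> 0 < h \<Longrightarrow> XL \<le> y - h \<Longrightarrow> y + h \<le> XR \<Longrightarrow>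
      \<bar>(f0 (y + h / 2) / ((xe (y + h) t - xe y t) / h) - f0 (y - h / 2) / ((xe y t - xe (y - h) t) / h)) / h
        - u_deriv t 1 y\<bar> \<le> C * h\<^sup>2"
proof -
  obtain B where B: "0 < B" "\<And>k t X. k \<le> 3 \<Longrightarrow> t \<in> {0..T} \<Longrightarrow> X \<in> {XL..XR} \<Longrightarrow> \<bar>u_deriv t k X\<bar> \<le> B"
    using u_deriv_bounded by blast
  define C where "C = B * K / lo + B * (2 * K\<^sup>2) / lo\<^sup>2"
  have C0: "0 < C" unfolding C_def using B K_ge_1 lo by (intro add_pos_pos) auto
  show thesis
  proof
    show "0 < B + C" using B C0 by simp
    fix t y h :: real assume t: "t \<in> {0<..T}" and h: "0 < h" "XL \<le> y - h" "y + h \<le> XR"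
    define Gh where "Gh = (\<lambda>Y. (G 0 0 (Y + h / 2) t - G 0 0 (Y - h / 2) t) / h)"
    define v where "v = (\<lambda>Y. u t Y * (G 1 0 Y t / Gh Y - 1))"
    have tT: "t \<in> {0..T}" using t by auto
    have split: "f0 Y / Gh Y = u t Y + v Y" if "Y \<in> {XL..XR}" for Y
      using lo_le[OF that tT] lo by (simp add: v_def u_def right_diff_distrib)
    have G00: "Gh (y + h / 2) = (xe (y + h) t - xe y t) / h" "Gh (y - h / 2) = (xe y t - xe (y - h) t) / h"
      using h tT by (auto simp: Gh_def G0 add.commute)
    have "\<exists>D. (v has_real_derivative D) (at Y within {y - h / 2..y + h / 2}) \<and> \<bar>D\<bar> \<le> C * h\<^sup>2"
      if "Y \<in> {y - h / 2..y + h / 2}" for Y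
      by (rule density_ratio_derivative[OF t h B that]) (auto simp: C_def v_def Gh_def)
    then obtain D where D: "\<And>Y. Y \<in> {y - h / 2..y + h / 2} \<Longrightarrow> (v has_real_derivative D Y) (at Y within {y - h / 2..y + h / 2})"
      "\<And>Y. Y \<in> {y - h / 2..y + h / 2} \<Longrightarrow> \<bar>D Y\<bar> \<le> C * h\<^sup>2"
      by metis
    have "norm (v (y + h / 2) - v (y - h / 2)) \<le> C * h\<^sup>2 * norm ((y + h / 2) - (y - h / 2))"
      by (rule field_differentiable_bound[where S = "{y - h / 2..y + h / 2}" and f' = D]) (use D h in auto)
    then have v: "\<bar>(v (y + h / 2) - v (y - h / 2)) / h\<bar> \<le> C * h\<^sup>2"
      using h by (simp add: abs_divide divide_le_eq)
    have "\<bar>(u_deriv t 0 (y + h / 2) - u_deriv t 0 (y - h / 2)) / (2 * (h / 2)) - u_deriv t 1 y\<bar> \<le> B * (h / 2)\<^sup>2"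
    proof (rule central_difference[where a = "y - h / 2" and b = "y + h / 2"])
      fix k x assume x: "x \<in> {y - h / 2..y + h / 2}" and k: "k \<le> (2::nat)"
      have "x \<in> {XL<..<XR}" using x h by auto
      then show "(u_deriv t k has_real_derivative u_deriv t (Suc k) x) (at x within {y - h / 2..y + h / 2})"
        using has_field_derivative_at_within[OF u_deriv_deriv[OF _ t k]] by blast
    next
      fix x assume "x \<in> {y - h / 2..y + h / 2}"
      then show "\<bar>u_deriv t 3 x\<bar> \<le> B" using h tT by (intro B) auto
    qed (use h in auto)
    also have "\<dots> \<le> B * h\<^sup>2" using B by (simp add: power_divide)
    finally have u: "\<bar>(u t (y + h / 2) - u t (y - h / 2)) / h - u_deriv t 1 y\<bar> \<le> B * h\<^sup>2"
      by (simp add: u_deriv_0)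
    have "(f0 (y + h / 2) / Gh (y + h / 2) - f0 (y - h / 2) / Gh (y - h / 2)) / h - u_deriv t 1 y
       = ((u t (y + h / 2) - u t (y - h / 2)) / h - u_deriv t 1 y) + (v (y + h / 2) - v (y - h / 2)) / h"
      using h by (simp add: split diff_divide_distrib add_divide_distrib)
    then have "\<bar>(f0 (y + h / 2) / Gh (y + h / 2) - f0 (y - h / 2) / Gh (y - h / 2)) / h - u_deriv t 1 y\<bar> \<le> B * h\<^sup>2 + C * h\<^sup>2"
      using u v by linarith
    then show "\<bar>(f0 (y + h / 2) / ((xe (y + h) t - xe y t) / h) - f0 (y - h / 2) / ((xe y t - xe (y - h) t) / h)) / h
        - u_deriv t 1 y\<bar> \<le> (B + C) * h\<^sup>2"
      unfolding G00 by (simp add: distrib_right)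
  qed
qed


definition mesh :: "nat \<Rightarrow> real" where
  "mesh M = (XR - XL) / real M"

definition exact :: "real \<Rightarrow> real \<Rightarrow> nat \<Rightarrow> real" where
  "exact h t i = xe (grid_pt XL h (real i)) t"

definition f0_cell :: "real \<Rightarrow> nat \<Rightarrow> real" where
  "f0_cell h j = f0 (grid_pt XL h (real j - 1 / 2))"

lemma mesh_pos: "1 \<le> M \<Longrightarrow> 0 < mesh M" and mesh_mult: "1 \<le> M \<Longrightarrow> mesh M * real M = XR - XL"
  using XLR by (auto simp: mesh_def)

lemma grid_pt_mem:
  assumes "1 \<le> M" "0 \<le> r" "r \<le> real M"
  shows "grid_pt XL (mesh M) r \<in> {XL..XR}"
proof -
  have "r * mesh M \<le> mesh M * real M" "0 \<le> r * mesh M"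
    using assms mesh_pos[of M] by auto
  then show ?thesis using mesh_mult[OF assms(1)] by (simp add: grid_pt_def)
qed

lemma grid_pt_interior:
  assumes "1 \<le> M" "0 < r" "r < real M"
  shows "grid_pt XL (mesh M) r \<in> {XL<..<XR}"
proof -
  have "r * mesh M < mesh M * real M" "0 < r * mesh M"
    using assms mesh_pos[of M] by auto
  then show ?thesis using mesh_mult[OF assms(1)] by (simp add: grid_pt_def)
qed

lemma f0_cell_bounds:
  assumes "j \<in> {1..M}"
  shows "bf \<le> f0_cell (mesh M) j" "f0_cell (mesh M) j \<le> Bf" "0 < f0_cell (mesh M) j"
proof -
  have "grid_pt XL (mesh M) (real j - 1 / 2) \<in> {XL..XR}"
    using assms by (intro grid_pt_mem) auto
  then show "bf \<le> f0_cell (mesh M) j" "f0_cell (mesh M) j \<le> Bf" "0 < f0_cell (mesh M) j"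
    using f0 bf unfolding f0_cell_def by force+
qed

lemma exact_boundary:
  assumes "1 \<le> M" "t \<in> {0..T}"
  shows "exact (mesh M) t 0 = XL" "exact (mesh M) t M = XR"
proof -
  have "grid_pt XL (mesh M) 0 = XL" "grid_pt XL (mesh M) (real M) = XR"
    using mesh_mult[OF assms(1)] by (auto simp: grid_pt_def mult.commute)
  then show "exact (mesh M) t 0 = XL" "exact (mesh M) t M = XR"
    using sol assms unfolding exact_def trajectory_solution_def by auto
qed

lemma D_h_exact:
  assumes "j \<in> {1..M}"
  shows "D_h (mesh M) (exact (mesh M) t) j =
    (xe (grid_pt XL (mesh M) (real j)) t - xe (grid_pt XL (mesh M) (real j - 1)) t)
      / (grid_pt XL (mesh M) (real j) - grid_pt XL (mesh M) (real j - 1))"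
    and "grid_pt XL (mesh M) (real j - 1) < grid_pt XL (mesh M) (real j)"
    and "XL \<le> grid_pt XL (mesh M) (real j - 1)" "grid_pt XL (mesh M) (real j) \<le> XR"
  using assms mesh_pos[of M] grid_pt_mem[of M "real j"] grid_pt_mem[of M "real j - 1"]
  by (auto simp: D_h_def exact_def of_nat_diff) (auto simp: grid_pt_def algebra_simps)

lemma D_h_exact_bounds:
  assumes j: "j \<in> {1..M}" and t: "t \<in> {0..T}"
  shows "lo \<le> D_h (mesh M) (exact (mesh M) t) j" "D_h (mesh M) (exact (mesh M) t) j \<le> K"
  unfolding D_h_exact(1)[OF j] using xe_increment[OF _ _ _ t] D_h_exact(2-4)[OF j] by auto

lemma D_h_exact_time:
  assumes j: "j \<in> {1..M}" and "s \<in> {0..T}" "t \<in> {0..T}"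
  shows "\<bar>D_h (mesh M) (exact (mesh M) t) j - D_h (mesh M) (exact (mesh M) s) j\<bar> \<le> K * \<bar>t - s\<bar>"
  unfolding D_h_exact(1)[OF j] using xe_increment_time[of _ _ s t] D_h_exact(2-4)[OF j] assms by auto

lemma Dt_h_exact:
  assumes M: "2 \<le> M" and i: "i \<le> M" and t: "t \<in> {0..T}"
  shows "\<bar>Dt_h (mesh M) M (exact (mesh M) t) i - G 1 0 (grid_pt XL (mesh M) (real i)) t\<bar> \<le> 3 * K * (mesh M)\<^sup>2"
proof -
  define h where "h = mesh M"
  have h: "0 < h" "h * real M = XR - XL" using mesh_pos[of M] mesh_mult[of M] M by (auto simp: h_def)
  let ?P = "\<lambda>i. grid_pt XL h (real i)"
  have E: "exact h t k = G 0 0 (?P k) t" if "k \<le> M" for k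
    using G0[OF grid_pt_mem[of M "real k"] t] M that by (auto simp: exact_def h_def)
  note cd = central_difference[of XL XR "\<lambda>k Y. G k 0 Y t" K] one_sided_difference[of XL XR "\<lambda>k Y. G k 0 Y t" K]
  have der: "((\<lambda>Y. G k 0 Y t) has_real_derivative G (Suc k) 0 x t) (at x within {XL..XR})"
    if "x \<in> {XL..XR}" "k \<le> 2" for k x using G_X[of k 0 x t] that t by auto
  have bd: "\<bar>G 3 0 x t\<bar> \<le> K" if "x \<in> {XL..XR}" for x using G_le[of 3 0 x t] that t by auto
  have mem: "?P k \<in> {XL..XR}" if "k \<le> M" for k
    using grid_pt_mem[of M "real k"] M that by (auto simp: h_def)
  consider "i = 0" | "i = M" "i \<noteq> 0" | "i \<noteq> 0" "i \<noteq> M" by blast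
  then have "\<bar>Dt_h h M (exact h t) i - G 1 0 (?P i) t\<bar> \<le> 3 * K * h\<^sup>2"
  proof cases
    case 1
    have "?P 1 = ?P 0 + h" "?P 2 = ?P 0 + 2 * h" by (auto simp: grid_pt_def)
    then show ?thesis
      using cd(2)[OF der bd, of h "?P 0"] mem[of 0] mem[of 1] mem[of 2] h M E[of 0] E[of 1] E[of 2]
      by (simp add: 1 Dt_h_def)
  next
    case 2
    have P: "?P (M - 1) = ?P M + - h" "?P (M - 2) = ?P M + 2 * (- h)"
      using M by (auto simp: grid_pt_def of_nat_diff algebra_simps)
    have "Dt_h h M (exact h t) M = (4 * G 0 0 (?P M + - h) t - G 0 0 (?P M + 2 * (- h)) t - 3 * G 0 0 (?P M) t) / (2 * (- h))"
      using M h unfolding P[symmetric] by (simp add: Dt_h_def E field_simps)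
    then show ?thesis
      using cd(2)[OF der bd, of "- h" "?P M"] mem[of M] mem[of "M - 1"] mem[of "M - 2"] h M
      unfolding P 2 by simp
  next
    case 3
    then have i: "i \<in> {1..M - 1}" using i by auto
    have P: "?P (i + 1) = ?P i + h" "?P (i - 1) = ?P i - h"
      using i by (auto simp: grid_pt_def of_nat_diff algebra_simps)
    have "\<bar>Dt_h h M (exact h t) i - G 1 0 (?P i) t\<bar> \<le> K * h\<^sup>2"
      using cd(1)[OF der bd, of h "?P i"] mem[of "i + 1"] mem[of "i - 1"] h 3 i E[of "i + 1"] E[of "i - 1"]
      unfolding P by (simp add: Dt_h_def)
    also have "\<dots> \<le> 3 * K * h\<^sup>2" using K_ge_1 by simp
    finally show ?thesis .
  qed
  then show ?thesis by (simp add: h_def)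
qed

text \<open>
  The equation is used at the new time \<open>t + \<tau>\<close>, which is positive, whereas it is not available at time
  \<open>0\<close>.  Evaluating the friction coefficient at the old time then costs \<open>O(\<tau>)\<close>.
\<close>

lemma truncation_error:
  obtains C where "0 < C"
    "\<And>M i t \<tau>. i \<in> {1..M - 1} \<Longrightarrow> 0 < \<tau> \<Longrightarrow> 0 \<le> t \<Longrightarrow> t + \<tau> \<le> T \<Longrightarrow>
      \<bar>friction m (f0 (grid_pt XL (mesh M) (real i))) (Dt_h (mesh M) M (exact (mesh M) t) i)
          * ((exact (mesh M) (t + \<tau>) i - exact (mesh M) t i) / \<tau>)
        + d_h (mesh M) (\<lambda>j. f0_cell (mesh M) j / D_h (mesh M) (exact (mesh M) (t + \<tau>)) j) i\<bar>
      \<le> C * (\<tau> + (mesh M)\<^sup>2)"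
proof -
  obtain Cs where Cs: "0 < Cs"
    "\<And>t y h. t \<in> {0<..T} \<Longrightarrow> 0 < h \<Longrightarrow> XL \<le> y - h \<Longrightarrow> y + h \<le> XR \<Longrightarrow>
      \<bar>(f0 (y + h / 2) / ((xe (y + h) t - xe y t) / h) - f0 (y - h / 2) / ((xe y t - xe (y - h) t) / h)) / h
        - u_deriv t 1 y\<bar> \<le> Cs * h\<^sup>2"
    using spatial_consistency by blast
  obtain a0 a1 La where A: "0 < a0" "0 < a1" "0 \<le> La"
    "\<And>f p. bf \<le> f \<Longrightarrow> f \<le> Bf \<Longrightarrow> lo \<le> p \<Longrightarrow> p \<le> K \<Longrightarrow> a0 \<le> friction m f p \<and> friction m f p \<le> a1"
    "\<And>f p q. bf \<le> f \<Longrightarrow> f \<le> Bf \<Longrightarrow> lo \<le> p \<Longrightarrow> p \<le> K \<Longrightarrow> lo \<le> q \<Longrightarrow> q \<le> K \<Longrightarrow>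
       \<bar>friction m f p - friction m f q\<bar> \<le> La * \<bar>p - q\<bar>"
    using friction_bounds[OF m bf lo(1), of Bf K] by blast
  show thesis
  proof
    show "0 < 3 * La * K\<^sup>2 + a1 * K + Cs" using A Cs K_ge_1 by (intro add_nonneg_pos add_nonneg_nonneg) auto
    fix M i :: nat and t \<tau> :: real
    assume i: "i \<in> {1..M - 1}" and tau: "0 < \<tau>" "0 \<le> t" "t + \<tau> \<le> T"
    define h where "h = mesh M"
    define y where "y = grid_pt XL h (real i)"
    define t' where "t' = t + \<tau>"
    have M: "2 \<le> M" and iM: "i \<le> M" using i by auto
    have h: "0 < h" using mesh_pos[of M] M by (simp add: h_def)
    have tT: "t \<in> {0..T}" "t' \<in> {0..T}" "t' \<in> {0<..T}" using tau by (auto simp: t'_def)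
    have P: "grid_pt XL h (real (i + 1)) = y + h" "grid_pt XL h (real (i - 1)) = y - h"
      "grid_pt XL h (real (i + 1) - 1 / 2) = y + h / 2" "grid_pt XL h (real i - 1 / 2) = y - h / 2"
      using i by (auto simp: grid_pt_def y_def of_nat_diff algebra_simps)
    have y: "XL \<le> y - h" "y + h \<le> XR" "y \<in> {XL..XR}"
      using grid_pt_mem[of M "real (i + 1)"] grid_pt_mem[of M "real (i - 1)"] grid_pt_mem[of M "real i"] i M
      unfolding h_def[symmetric] P y_def[symmetric] by auto
    define \<delta> where "\<delta> = (exact h t' i - exact h t i) / \<tau>"
    have space: "\<bar>d_h h (\<lambda>j. f0_cell h j / D_h h (exact h t') j) i - u_deriv t' 1 y\<bar> \<le> Cs * h\<^sup>2"
      using Cs(2)[OF tT(3) h y(1,2)]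
      by (simp add: d_h_def f0_cell_def D_h_def exact_def P[simplified] flip: y_def)
    obtain s where s: "s \<in> {t<..<t'}" "G 0 0 y t' - G 0 0 y t = G 0 1 y s * (t' - t)"
    proof (rule MVT_within[of t t' "G 0 0 y" "G 0 1 y"])
      show "(G 0 0 y has_real_derivative G 0 1 y x) (at x within {t..t'})" if "x \<in> {t..t'}" for x
        using has_field_derivative_subset[OF G_t[of 0 0 y x]] that y tT by auto
    qed (use tau in \<open>auto simp: t'_def\<close>)
    have \<delta>: "\<delta> = G 0 1 y s"
      using s tau y tT by (simp add: \<delta>_def exact_def y_def[symmetric] G0 t'_def)
    have sT: "s \<in> {0..T}" using s tT by auto
    have \<delta>1: "\<bar>\<delta>\<bar> \<le> K" unfolding \<delta> using G_le[of 0 1 y s] y sT by auto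
    have \<delta>2: "\<bar>\<delta> - G 0 1 y t'\<bar> \<le> K * \<tau>"
    proof -
      have "\<bar>\<delta> - G 0 1 y t'\<bar> \<le> K * \<bar>s - t'\<bar>"
        unfolding \<delta> using G_time_Lipschitz[of 0 1 y t' s] y sT tT by auto
      also have "\<dots> \<le> K * \<tau>" using s K_ge_1 by (intro mult_left_mono) (auto simp: t'_def)
      finally show ?thesis .
    qed
    define A where "A = friction m (f0 y) (Dt_h h M (exact h t) i)"
    define A' where "A' = friction m (f0 y) (G 1 0 y t')"
    have f: "bf \<le> f0 y" "f0 y \<le> Bf" using f0[OF y(3)] by auto
    have Dt: "lo \<le> Dt_h h M (exact h t) i" "Dt_h h M (exact h t) i \<le> K"
      using Dt_h_interior_bounds[OF h i, of lo "exact h t" K] D_h_exact_bounds[OF _ tT(1), of _ M] unfolding h_def by auto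
    have G1: "lo \<le> G 1 0 y t'" "G 1 0 y t' \<le> K" using lo_le[of y t'] G_le[of 1 0 y t'] y tT by auto
    have "\<bar>Dt_h h M (exact h t) i - G 1 0 y t'\<bar> \<le> 3 * K * h\<^sup>2 + K * \<tau>"
      using Dt_h_exact[OF M iM tT(1)] G_time_Lipschitz[of 1 0 y t t'] i y tT tau
      by (simp add: h_def[symmetric] y_def[symmetric] t'_def)
    also have "\<dots> \<le> 3 * K * (\<tau> + h\<^sup>2)" using K_ge_1 tau by (simp add: distrib_left)
    finally have "\<bar>A - A'\<bar> \<le> La * (3 * K * (\<tau> + h\<^sup>2))"
      unfolding A_def A'_def using A(5)[OF f Dt G1] A(3) by (meson mult_left_mono order_trans)
    then have 1: "\<bar>(A - A') * \<delta>\<bar> \<le> La * (3 * K * (\<tau> + h\<^sup>2)) * K"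
      unfolding abs_mult using \<delta>1 A(3) K_ge_1 tau by (intro mult_mono) auto
    have "\<bar>A'\<bar> \<le> a1" using A(4)[OF f G1] A(1) by (auto simp: A'_def)
    then have "\<bar>A' * (\<delta> - G 0 1 y t')\<bar> \<le> a1 * (K * \<tau>)"
      unfolding abs_mult using \<delta>2 A(2) by (intro mult_mono) auto
    also have "\<dots> \<le> a1 * (K * (\<tau> + h\<^sup>2))" using A(2) K_ge_1 by (intro mult_left_mono) auto
    finally have 2: "\<bar>A' * (\<delta> - G 0 1 y t')\<bar> \<le> a1 * (K * (\<tau> + h\<^sup>2))" .
    have 3: "\<bar>d_h h (\<lambda>j. f0_cell h j / D_h h (exact h t') j) i - u_deriv t' 1 y\<bar> \<le> Cs * (\<tau> + h\<^sup>2)"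
      using space Cs(1) tau by (smt (verit) mult_left_mono)
    have "u_deriv t' 1 y = - (A' * G 0 1 y t')"
      unfolding A'_def by (rule u_deriv_1[OF y(3) tT(2)])
    then have "A * \<delta> + d_h h (\<lambda>j. f0_cell h j / D_h h (exact h t') j) i
       = (A - A') * \<delta> + A' * (\<delta> - G 0 1 y t') + (d_h h (\<lambda>j. f0_cell h j / D_h h (exact h t') j) i - u_deriv t' 1 y)"
      by (simp add: left_diff_distrib right_diff_distrib)
    then have "\<bar>A * \<delta> + d_h h (\<lambda>j. f0_cell h j / D_h h (exact h t') j) i\<bar>
      \<le> La * (3 * K * (\<tau> + h\<^sup>2)) * K + a1 * (K * (\<tau> + h\<^sup>2)) + Cs * (\<tau> + h\<^sup>2)"
      using 1 2 3 by linarith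
    also have "\<dots> = (3 * La * K\<^sup>2 + a1 * K + Cs) * (\<tau> + h\<^sup>2)" by (simp add: power2_eq_square algebra_simps)
    finally show "\<bar>friction m (f0 (grid_pt XL (mesh M) (real i))) (Dt_h (mesh M) M (exact (mesh M) t) i)
          * ((exact (mesh M) (t + \<tau>) i - exact (mesh M) t i) / \<tau>)
        + d_h (mesh M) (\<lambda>j. f0_cell (mesh M) j / D_h (mesh M) (exact (mesh M) (t + \<tau>)) j) i\<bar>
      \<le> (3 * La * K\<^sup>2 + a1 * K + Cs) * (\<tau> + (mesh M)\<^sup>2)"
      unfolding A_def \<delta>_def h_def y_def t'_def .
  qed
qed


section \<open>A priori bounds for the numerical solution\<close>

definition numerical :: "nat \<Rightarrow> nat \<Rightarrow> (nat \<Rightarrow> nat \<Rightarrow> real) \<Rightarrow> bool" where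
  "numerical N M xh \<longleftrightarrow> 1 \<le> N \<and> 1 \<le> M \<and> numerical_solution m T XL XR f0 N M xh"

definition timestep :: "nat \<Rightarrow> real" where
  "timestep N = T / real N"

lemma timestep_pos: "1 \<le> N \<Longrightarrow> 0 < timestep N"
  using T by (simp add: timestep_def)

lemma time_mem:
  assumes "1 \<le> N" "n \<le> N"
  shows "real n * timestep N \<in> {0..T}"
proof -
  have "real n * timestep N \<le> real N * timestep N"
    using assms timestep_pos[of N] by (intro mult_right_mono) auto
  then show ?thesis using assms T by (simp add: timestep_def)
qed

lemma numericalD:
  assumes "numerical N M xh"
  shows "1 \<le> N" "1 \<le> M" "0 < timestep N" "0 < mesh M"
    and "\<And>i. i \<le> M \<Longrightarrow> xh 0 i = grid_pt XL (mesh M) (real i)"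
    and "\<And>n. n \<le> N \<Longrightarrow> xh n 0 = XL" "\<And>n. n \<le> N \<Longrightarrow> xh n M = XR"
    and "\<And>n j. n \<le> N \<Longrightarrow> j \<in> {1..M} \<Longrightarrow> 0 < D_h (mesh M) (xh n) j"
    and "\<And>n i. n < N \<Longrightarrow> i \<in> {1..M - 1} \<Longrightarrow>
      friction m (f0 (grid_pt XL (mesh M) (real i))) (Dt_h (mesh M) M (xh n) i) * ((xh (Suc n) i - xh n i) / timestep N)
      = - d_h (mesh M) (\<lambda>j. f0_cell (mesh M) j / D_h (mesh M) (xh (Suc n)) j) i"
proof -
  show NM: "1 \<le> N" "1 \<le> M" using assms by (auto simp: numerical_def)
  show "0 < timestep N" "0 < mesh M" using timestep_pos mesh_pos NM by auto
  have ns: "numerical_solution m T XL XR f0 N M xh" using assms by (simp add: numerical_def)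
  note ns = ns[unfolded numerical_solution_def Let_def, folded mesh_def timestep_def]
  show "\<And>i. i \<le> M \<Longrightarrow> xh 0 i = grid_pt XL (mesh M) (real i)" using ns by blast
  have adm: "\<And>n. n \<le> N \<Longrightarrow> xh n \<in> admissible XL XR M" using ns by blast
  then show "\<And>n. n \<le> N \<Longrightarrow> xh n 0 = XL" "\<And>n. n \<le> N \<Longrightarrow> xh n M = XR" by (auto simp: admissible_def)
  show "0 < D_h (mesh M) (xh n) j" if "n \<le> N" "j \<in> {1..M}" for n j
    using adm[OF that(1)] that(2) mesh_pos[OF NM(2)] by (auto simp: admissible_def D_h_def)
  show "friction m (f0 (grid_pt XL (mesh M) (real i))) (Dt_h (mesh M) M (xh n) i) * ((xh (Suc n) i - xh n i) / timestep N)
      = - d_h (mesh M) (\<lambda>j. f0_cell (mesh M) j / D_h (mesh M) (xh (Suc n)) j) i" if "n < N" "i \<in> {1..M - 1}" for n i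
    using ns that unfolding friction_def f0_cell_def by blast
qed

lemma cell_bounds_of_density_bounds:
  assumes "j \<in> {1..M}" "0 < p" "bf \<le> f0_cell (mesh M) j / p" "f0_cell (mesh M) j / p \<le> Bf"
  shows "lo \<le> p" "p \<le> K"
proof -
  note F = f0_cell_bounds[OF assms(1)]
  have "f0_cell (mesh M) j \<le> Bf * p" "bf * p \<le> f0_cell (mesh M) j"
    using assms(2-4) by (simp_all add: field_simps)
  then have "bf \<le> Bf * p" "bf * p \<le> Bf" using F by linarith+
  then have "bf / Bf \<le> p" "p \<le> Bf / bf" using bf Bf_pos by (simp_all add: field_simps)
  then show "lo \<le> p" "p \<le> K" using lo K_ge by auto
qed

text \<open>
  The initial slopes are \<open>1\<close>, so the initial densities are values of \<open>f\<^sub>0\<close>, and the maximum principle preserves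
  their bounds.  Its assumption that the friction coefficient is positive is part of the induction: that
  coefficient depends on the slopes at the old time level.
\<close>

lemma numerical_bounds:
  assumes num: "numerical N M xh" and n: "n \<le> N" and j: "j \<in> {1..M}"
  shows "bf \<le> f0_cell (mesh M) j / D_h (mesh M) (xh n) j" "f0_cell (mesh M) j / D_h (mesh M) (xh n) j \<le> Bf"
    and "lo \<le> D_h (mesh M) (xh n) j" "D_h (mesh M) (xh n) j \<le> K"
proof -
  let ?h = "mesh M" and ?\<tau> = "timestep N"
  let ?\<phi> = "\<lambda>n j. f0_cell ?h j / D_h ?h (xh n) j"
  note nd = numericalD[OF num]
  have "(\<forall>j\<in>{1..M}. ?\<phi> n j \<le> Bf) \<and> (\<forall>j\<in>{1..M}. bf \<le> ?\<phi> n j)"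
    using n
  proof (induction n)
    case 0
    have "D_h ?h (xh 0) j = 1" if "j \<in> {1..M}" for j
      using that nd(4) nd(5)[of j] nd(5)[of "j - 1"]
      by (auto simp: D_h_def grid_pt_def of_nat_diff field_simps)
    then show ?case using f0_cell_bounds by simp
  next
    case (Suc n)
    then have n: "n \<le> N" "n < N" and IH: "\<forall>j\<in>{1..M}. ?\<phi> n j \<le> Bf" "\<forall>j\<in>{1..M}. bf \<le> ?\<phi> n j" by auto
    define A where "A = (\<lambda>i. friction m (f0 (grid_pt XL ?h (real i))) (Dt_h ?h M (xh n) i))"
    have A: "0 < A i" if i: "i \<in> {1..M - 1}" for i
    proof -
      have "lo \<le> Dt_h ?h M (xh n) i"
        by (rule Dt_h_interior_bounds[OF nd(4) i, of lo _ K])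
           (use IH nd(8)[OF n(1)] cell_bounds_of_density_bounds in blast)
      then have D0: "0 < Dt_h ?h M (xh n) i" using lo by linarith
      have "grid_pt XL ?h (real i) \<in> {XL..XR}" using i nd(2) by (intro grid_pt_mem) auto
      then have "0 < f0 (grid_pt XL ?h (real i))" using f0 bf by force
      then show ?thesis using D0 m by (simp add: A_def friction_def)
    qed
    have eq: "xh (Suc n) i - xh n i = - (?\<tau> / (?h * A i)) * (?\<phi> (Suc n) (i + 1) - ?\<phi> (Suc n) i)"
      if i: "i \<in> {1..M - 1}" for i
    proof -
      have "A i * ((xh (Suc n) i - xh n i) / ?\<tau>) = - ((?\<phi> (Suc n) (i + 1) - ?\<phi> (Suc n) i) / ?h)"
        using nd(9)[OF n(2) i] by (simp add: A_def d_h_def)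
      moreover have "xh (Suc n) i - xh n i = ?\<tau> / A i * (A i * ((xh (Suc n) i - xh n i) / ?\<tau>))"
        using A[OF i] nd(3) by simp
      ultimately have "xh (Suc n) i - xh n i = ?\<tau> / A i * (- ((?\<phi> (Suc n) (i + 1) - ?\<phi> (Suc n) i) / ?h))"
        by (simp only:)
      then show ?thesis by simp
    qed
    have c: "0 \<le> ?\<tau> / (?h * A i)" if "i \<in> {1..M - 1}" for i
      using A[OF that] nd(3,4) by simp
    have bc: "xh (Suc n) 0 = xh n 0" "xh (Suc n) M = xh n M"
      using nd(6,7)[of n] nd(6,7)[of "Suc n"] Suc.prems by auto
    note mp = discrete_max_principle[OF nd(4) f0_cell_bounds(3) nd(8)[OF n(1)] nd(8)[OF Suc.prems] c bc eq]
    show ?case using mp(1)[of Bf] mp(2)[of bf] IH by blast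
  qed
  then show b: "bf \<le> ?\<phi> n j" "?\<phi> n j \<le> Bf" using j by blast+
  show "lo \<le> D_h ?h (xh n) j" "D_h ?h (xh n) j \<le> K"
    using cell_bounds_of_density_bounds[OF j nd(8)[OF n j] b] by auto
qed


section \<open>Convergence of the slopes\<close>

definition cell_error :: "nat \<Rightarrow> nat \<Rightarrow> (nat \<Rightarrow> nat \<Rightarrow> real) \<Rightarrow> nat \<Rightarrow> real" where
  "cell_error N M xh n = mesh M * (\<Sum>j=1..M. (D_h (mesh M) (xh n) j
     - D_h (mesh M) (exact (mesh M) (real n * timestep N)) j)\<^sup>2)"

definition rel_energy :: "nat \<Rightarrow> nat \<Rightarrow> (nat \<Rightarrow> nat \<Rightarrow> real) \<Rightarrow> nat \<Rightarrow> real" where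
  "rel_energy N M xh n = mesh M * (\<Sum>j=1..M. f0_cell (mesh M) j * rel_entropy (D_h (mesh M) (xh n) j
     / D_h (mesh M) (exact (mesh M) (real n * timestep N)) j))"

lemma cell_error_le_rel_energy:
  assumes num: "numerical N M xh" and n: "n \<le> N"
  shows "cell_error N M xh n \<le> 4 * K\<^sup>2 / bf * rel_energy N M xh n"
proof -
  note nd = numericalD[OF num]
  let ?p = "D_h (mesh M) (xh n)" and ?q = "D_h (mesh M) (exact (mesh M) (real n * timestep N))"
  have "(?p j - ?q j)\<^sup>2 \<le> 4 * K\<^sup>2 / bf * (f0_cell (mesh M) j * rel_entropy (?p j / ?q j))" if j: "j \<in> {1..M}" for j
  proof -
    note p = numerical_bounds(3,4)[OF num n j] and q = D_h_exact_bounds[OF j time_mem[OF nd(1) n]]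
    have pos: "0 < ?p j" "0 < ?q j" using p q lo by linarith+
    have "2 * ?q j * (?p j + ?q j) \<le> 2 * K * (K + K)" using p q pos by (intro mult_mono) auto
    then have "(?p j - ?q j)\<^sup>2 / (4 * K\<^sup>2) \<le> (?p j - ?q j)\<^sup>2 / (2 * ?q j * (?p j + ?q j))"
      using pos K_ge_1 by (intro divide_left_mono) (auto simp: power2_eq_square intro!: mult_pos_pos add_pos_pos)
    also have "\<dots> \<le> rel_entropy (?p j / ?q j)" by (rule rel_entropy_lower[OF pos])
    finally have e: "(?p j - ?q j)\<^sup>2 \<le> 4 * K\<^sup>2 * rel_entropy (?p j / ?q j)"
      using K_ge_1 by (simp add: divide_le_eq mult.commute)
    have "0 \<le> rel_entropy (?p j / ?q j)"
      using rel_entropy_lower[OF pos] pos by (smt (verit) divide_nonneg_pos mult_pos_pos zero_le_power2)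
    then have "1 * rel_entropy (?p j / ?q j) \<le> f0_cell (mesh M) j / bf * rel_entropy (?p j / ?q j)"
      using f0_cell_bounds[OF j] bf by (intro mult_right_mono) auto
    then have "4 * K\<^sup>2 * rel_entropy (?p j / ?q j) \<le> 4 * K\<^sup>2 * (f0_cell (mesh M) j / bf * rel_entropy (?p j / ?q j))"
      by (intro mult_left_mono) auto
    with e show ?thesis by simp
  qed
  then have "mesh M * (\<Sum>j=1..M. (?p j - ?q j)\<^sup>2)
      \<le> mesh M * (\<Sum>j=1..M. 4 * K\<^sup>2 / bf * (f0_cell (mesh M) j * rel_entropy (?p j / ?q j)))"
    using nd(4) by (intro mult_left_mono sum_mono) auto
  then show ?thesis unfolding cell_error_def rel_energy_def sum_distrib_left[symmetric] by (simp add: mult_ac)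
qed

lemma rel_energy_nonneg:
  assumes num: "numerical N M xh" and n: "n \<le> N"
  shows "0 \<le> rel_energy N M xh n"
proof -
  have "0 \<le> cell_error N M xh n"
    unfolding cell_error_def using numericalD(4)[OF num] by (intro mult_nonneg_nonneg sum_nonneg) auto
  then have "0 \<le> 4 * K\<^sup>2 / bf * rel_energy N M xh n" using cell_error_le_rel_energy[OF assms] by linarith
  then show ?thesis using bf K_ge_1 by (simp add: zero_le_mult_iff zero_le_divide_iff)
qed

lemma cell_error_le_const:
  assumes num: "numerical N M xh" and n: "n \<le> N"
  shows "cell_error N M xh n \<le> (XR - XL) * K\<^sup>2"
proof -
  note nd = numericalD[OF num]
  let ?p = "D_h (mesh M) (xh n)" and ?q = "D_h (mesh M) (exact (mesh M) (real n * timestep N))"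
  have "(\<Sum>j=1..M. (?p j - ?q j)\<^sup>2) \<le> (\<Sum>j=1..M. K\<^sup>2)"
  proof (rule sum_mono)
    fix j assume j: "j \<in> {1..M}"
    have "\<bar>?p j - ?q j\<bar> \<le> K"
      using numerical_bounds(3,4)[OF num n j] D_h_exact_bounds[OF j time_mem[OF nd(1) n]] lo by linarith
    then show "(?p j - ?q j)\<^sup>2 \<le> K\<^sup>2" using power_mono[of "\<bar>?p j - ?q j\<bar>" K 2] by simp
  qed
  then have "cell_error N M xh n \<le> mesh M * (\<Sum>j=1..M. K\<^sup>2)"
    unfolding cell_error_def using nd(4) by (intro mult_left_mono) auto
  also have "\<dots> = (mesh M * real M) * K\<^sup>2" by simp
  finally show ?thesis unfolding mesh_mult[OF nd(2)] .
qed

text \<open>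
  The stability estimate for the scheme: the defect is the truncation error, and the squared slope errors
  are controlled by the relative energy itself.
\<close>

lemma rel_energy_step:
  obtains c where "0 < c"
    "\<And>N M xh n. numerical N M xh \<Longrightarrow> n < N \<Longrightarrow>
      rel_energy N M xh (Suc n) - rel_energy N M xh n
      \<le> timestep N * c * (rel_energy N M xh n + rel_energy N M xh (Suc n) + (timestep N + (mesh M)\<^sup>2)\<^sup>2)"
proof -
  obtain a0 a1 La where A: "0 < a0" "0 < a1" "0 \<le> La"
    "\<And>f p. bf \<le> f \<Longrightarrow> f \<le> Bf \<Longrightarrow> lo \<le> p \<Longrightarrow> p \<le> K \<Longrightarrow> a0 \<le> friction m f p \<and> friction m f p \<le> a1"
    "\<And>f p q. bf \<le> f \<Longrightarrow> f \<le> Bf \<Longrightarrow> lo \<le> p \<Longrightarrow> p \<le> K \<Longrightarrow> lo \<le> q \<Longrightarrow> q \<le> K \<Longrightarrow>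
       \<bar>friction m f p - friction m f q\<bar> \<le> La * \<bar>p - q\<bar>"
    using friction_bounds[OF m bf lo(1), of Bf K] by blast
  obtain Cg where Cg: "0 < Cg"
    "\<And>M i t \<tau>. i \<in> {1..M - 1} \<Longrightarrow> 0 < \<tau> \<Longrightarrow> 0 \<le> t \<Longrightarrow> t + \<tau> \<le> T \<Longrightarrow>
      \<bar>friction m (f0 (grid_pt XL (mesh M) (real i))) (Dt_h (mesh M) M (exact (mesh M) t) i)
          * ((exact (mesh M) (t + \<tau>) i - exact (mesh M) t i) / \<tau>)
        + d_h (mesh M) (\<lambda>j. f0_cell (mesh M) j / D_h (mesh M) (exact (mesh M) (t + \<tau>)) j) i\<bar>
      \<le> Cg * (\<tau> + (mesh M)\<^sup>2)"
    using truncation_error by blast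
  define c1 where "c1 = Bf * K / lo ^ 3 + (La * K)\<^sup>2 / a0"
  define c2 where "c2 = (XR - XL) * Cg\<^sup>2 / (2 * a0)"
  define c where "c = c1 * (4 * K\<^sup>2 / bf) + c2"
  have c1: "0 \<le> c1" unfolding c1_def using Bf_pos K_ge_1 lo A by (intro add_nonneg_nonneg) auto
  have c2: "0 < c2" unfolding c2_def using XLR Cg A by auto
  have c13: "0 \<le> c1 * (4 * K\<^sup>2 / bf)" using c1 bf by simp
  show thesis
  proof
    show "0 < c" unfolding c_def using c2 c13 by linarith
    fix N M :: nat and xh n assume num: "numerical N M xh" and n: "n < N"
    note nd = numericalD[OF num]
    define h where "h = mesh M"
    define \<tau> where "\<tau> = timestep N"
    define t where "t = real n * \<tau>"
    define \<epsilon> where "\<epsilon> = \<tau> + h\<^sup>2"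
    have h: "0 < h" and tau: "0 < \<tau>" using nd by (auto simp: h_def \<tau>_def)
    have tT: "t \<in> {0..T}" "t + \<tau> \<in> {0..T}"
      using time_mem[of N n] time_mem[of N "Suc n"] n nd(1) by (auto simp: t_def \<tau>_def algebra_simps)
    have tS: "real (Suc n) * \<tau> = t + \<tau>" by (simp add: t_def algebra_simps)
    have mem: "grid_pt XL h (real i) \<in> {XL..XR}" if "i \<in> {1..M - 1}" for i
      using that nd(2) unfolding h_def by (intro grid_pt_mem) auto
    have f: "bf \<le> f0 (grid_pt XL h (real i))" "f0 (grid_pt XL h (real i)) \<le> Bf" if "i \<in> {1..M - 1}" for i
      using f0[OF mem[OF that]] by auto
    have Dth: "lo \<le> Dt_h h M (xh n) i" "Dt_h h M (xh n) i \<le> K" if "i \<in> {1..M - 1}" for i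
      using Dt_h_interior_bounds[OF h that, of lo "xh n" K] numerical_bounds(3,4)[OF num _, of n] n unfolding h_def by auto
    have Dte: "lo \<le> Dt_h h M (exact h t) i" "Dt_h h M (exact h t) i \<le> K" if "i \<in> {1..M - 1}" for i
      using Dt_h_interior_bounds[OF h that, of lo "exact h t" K] D_h_exact_bounds[OF _ tT(1), of _ M] unfolding h_def by auto
    define ah where "ah = (\<lambda>i. friction m (f0 (grid_pt XL h (real i))) (Dt_h h M (xh n) i))"
    define ae where "ae = (\<lambda>i. friction m (f0 (grid_pt XL h (real i))) (Dt_h h M (exact h t) i))"
    have lo4: "lo \<le> D_h h x j" if "x \<in> {xh n, xh (Suc n), exact h t, exact h (t + \<tau>)}" "j \<in> {1..M}" for x j
      using that numerical_bounds(3)[OF num, of n j] numerical_bounds(3)[OF num, of "Suc n" j] n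
        D_h_exact_bounds(1)[OF that(2) tT(1)] D_h_exact_bounds(1)[OF that(2) tT(2)]
      unfolding h_def by auto
    have bc4: "x 0 = XL \<and> x M = XR" if "x \<in> {xh n, xh (Suc n), exact h t, exact h (t + \<tau>)}" for x
      using that nd(6,7)[of n] nd(6,7)[of "Suc n"] n exact_boundary[OF nd(2) tT(1)] exact_boundary[OF nd(2) tT(2)]
      unfolding h_def by auto
    have F: "0 < f0_cell h j \<and> f0_cell h j \<le> Bf" if "j \<in> {1..M}" for j
      using f0_cell_bounds[OF that] by (simp add: h_def)
    have q: "\<bar>D_h h (exact h (t + \<tau>)) j - D_h h (exact h t) j\<bar> \<le> K * \<tau>" if "j \<in> {1..M}" for j
      using D_h_exact_time[OF that tT] tau by (simp add: h_def)
    have eqh: "ah i * ((xh (Suc n) i - xh n i) / \<tau>) = - d_h h (\<lambda>j. f0_cell h j / D_h h (xh (Suc n)) j) i"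
      if "i \<in> {1..M - 1}" for i
      using nd(9)[OF n that] by (simp add: ah_def h_def \<tau>_def)
    have eqe: "\<bar>ae i * ((exact h (t + \<tau>) i - exact h t i) / \<tau>)
        + d_h h (\<lambda>j. f0_cell h j / D_h h (exact h (t + \<tau>)) j) i\<bar> \<le> Cg * \<epsilon>" if "i \<in> {1..M - 1}" for i
      using Cg(2)[OF that tau, of t] tT by (simp add: ae_def h_def \<epsilon>_def)
    have a0: "a0 \<le> ah i" if "i \<in> {1..M - 1}" for i
      using A(4)[OF f[OF that] Dth[OF that]] by (simp add: ah_def)
    have La: "\<bar>ae i - ah i\<bar> \<le> La * \<bar>Dt_h h M (exact h t) i - Dt_h h M (xh n) i\<bar>" if "i \<in> {1..M - 1}" for i
      using A(5)[OF f[OF that] Dte[OF that] Dth[OF that]] by (simp add: ah_def ae_def)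
    have V: "\<bar>(exact h (t + \<tau>) i - exact h t i) / \<tau>\<bar> \<le> K" if "i \<in> {1..M - 1}" for i
      using G_time_Lipschitz[of 0 0 "grid_pt XL h (real i)" t "t + \<tau>"] mem[OF that] tT tau
      by (simp add: exact_def G0 abs_divide divide_le_eq mult.commute)
    have "rel_energy N M xh (Suc n) - rel_energy N M xh n
      \<le> \<tau> * (c1 * (cell_error N M xh n + cell_error N M xh (Suc n)) + h * real M * (Cg * \<epsilon>)\<^sup>2 / (2 * a0))"
      using relative_energy_step[OF h tau nd(2) lo(1) lo4 F q bc4 eqh eqe A(1) a0 A(3) La V]
      unfolding rel_energy_def cell_error_def c1_def h_def[symmetric] \<tau>_def[symmetric] tS t_def[symmetric] .
    also have "h * real M * (Cg * \<epsilon>)\<^sup>2 / (2 * a0) = c2 * \<epsilon>\<^sup>2"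
      unfolding h_def mesh_mult[OF nd(2)] c2_def by (simp add: power_mult_distrib)
    also have "\<tau> * (c1 * (cell_error N M xh n + cell_error N M xh (Suc n)) + c2 * \<epsilon>\<^sup>2)
      \<le> \<tau> * (c1 * (4 * K\<^sup>2 / bf * rel_energy N M xh n + 4 * K\<^sup>2 / bf * rel_energy N M xh (Suc n)) + c2 * \<epsilon>\<^sup>2)"
      using tau c1 c2 n by (intro mult_left_mono add_mono order_refl cell_error_le_rel_energy[OF num]) auto
    also have "\<dots> = \<tau> * (c1 * (4 * K\<^sup>2 / bf) * (rel_energy N M xh n + rel_energy N M xh (Suc n)) + c2 * \<epsilon>\<^sup>2)"
      by (simp add: algebra_simps)
    also have "\<dots> \<le> \<tau> * (c * (rel_energy N M xh n + rel_energy N M xh (Suc n)) + c * \<epsilon>\<^sup>2)"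
    proof -
      have "c1 * (4 * K\<^sup>2 / bf) \<le> c" "c2 \<le> c" unfolding c_def using c2 c13 by auto
      then show ?thesis using rel_energy_nonneg[OF num, of n] rel_energy_nonneg[OF num, of "Suc n"] n tau by (intro mult_left_mono add_mono mult_right_mono) auto
    qed
    also have "\<dots> = \<tau> * c * (rel_energy N M xh n + rel_energy N M xh (Suc n) + \<epsilon>\<^sup>2)"
      by (simp add: algebra_simps)
    finally show "rel_energy N M xh (Suc n) - rel_energy N M xh n
      \<le> timestep N * c * (rel_energy N M xh n + rel_energy N M xh (Suc n) + (timestep N + (mesh M)\<^sup>2)\<^sup>2)"
      unfolding \<epsilon>_def \<tau>_def h_def .
  qed
qed

lemma rel_energy_0:
  assumes num: "numerical N M xh"
  shows "rel_energy N M xh 0 = 0"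
proof -
  note nd = numericalD[OF num]
  have "xh 0 i = exact (mesh M) (real 0 * timestep N) i" if "i \<le> M" for i
    using nd(5)[OF that] sol grid_pt_mem[of M "real i"] that nd(2)
    unfolding exact_def trajectory_solution_def by auto
  then have "D_h (mesh M) (xh 0) j = D_h (mesh M) (exact (mesh M) (real 0 * timestep N)) j" if "j \<in> {1..M}" for j
    using that by (auto simp: D_h_def)
  moreover have "0 < D_h (mesh M) (xh 0) j" if "j \<in> {1..M}" for j using nd(8)[of 0 j] that by simp
  ultimately have "f0_cell (mesh M) j * rel_entropy (D_h (mesh M) (xh 0) j
     / D_h (mesh M) (exact (mesh M) (real 0 * timestep N)) j) = 0" if "j \<in> {1..M}" for j
    using that by (force simp: rel_entropy_def)
  then have "(\<Sum>j=1..M. f0_cell (mesh M) j * rel_entropy (D_h (mesh M) (xh 0) j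
     / D_h (mesh M) (exact (mesh M) (real 0 * timestep N)) j)) = 0"
    by (intro sum.neutral) blast
  then show ?thesis unfolding rel_energy_def by (simp only: mult_zero_right)
qed

text \<open>
  Gronwall's inequality applies to small time steps.  A large time step is bounded below by a constant,
  and then the trivial bound on the slopes is already a multiple of \<open>\<tau>\<^sup>2\<close>.
\<close>

lemma cell_error_bound:
  obtains C where "0 < C"
    "\<And>N M xh n. numerical N M xh \<Longrightarrow> n \<le> N \<Longrightarrow> cell_error N M xh n \<le> C * (timestep N + (mesh M)\<^sup>2)\<^sup>2"
proof -
  obtain c where c: "0 < c"
    "\<And>N M xh n. numerical N M xh \<Longrightarrow> n < N \<Longrightarrow>
      rel_energy N M xh (Suc n) - rel_energy N M xh n
      \<le> timestep N * c * (rel_energy N M xh n + rel_energy N M xh (Suc n) + (timestep N + (mesh M)\<^sup>2)\<^sup>2)"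
    using rel_energy_step by blast
  define C1 where "C1 = 4 * K\<^sup>2 / bf * exp (4 * c * T)"
  define C2 where "C2 = (XR - XL) * K\<^sup>2 * (2 * c)\<^sup>2"
  have C: "0 < C1" "0 < C2" using bf K_ge_1 XLR c by (auto simp: C1_def C2_def)
  show thesis
  proof
    show "0 < C1 + C2" using C by simp
    fix N M :: nat and xh n assume num: "numerical N M xh" and n: "n \<le> N"
    define \<tau> where "\<tau> = timestep N"
    define \<epsilon> where "\<epsilon> = \<tau> + (mesh M)\<^sup>2"
    note nd = numericalD[OF num]
    have tau: "0 < \<tau>" "\<tau> \<le> \<epsilon>" using nd by (auto simp: \<tau>_def \<epsilon>_def)
    have "cell_error N M xh n \<le> (C1 + C2) * \<epsilon>\<^sup>2"
    proof (cases "c * \<tau> \<le> 1 / 2")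
      case True
      have "rel_energy N M xh n \<le> exp (4 * c * (real n * \<tau>)) * \<epsilon>\<^sup>2"
        by (rule discrete_Gronwall[of _ N])
           (use rel_energy_0[OF num] rel_energy_nonneg[OF num] c(1) c(2)[OF num] tau True n in \<open>auto simp: \<epsilon>_def \<tau>_def\<close>)
      also have "\<dots> \<le> exp (4 * c * T) * \<epsilon>\<^sup>2"
        using time_mem[OF nd(1) n] c(1) by (intro mult_right_mono) (auto simp: \<tau>_def)
      finally have "4 * K\<^sup>2 / bf * rel_energy N M xh n \<le> 4 * K\<^sup>2 / bf * (exp (4 * c * T) * \<epsilon>\<^sup>2)"
        using bf by (intro mult_left_mono) auto
      then have "cell_error N M xh n \<le> C1 * \<epsilon>\<^sup>2"
        using cell_error_le_rel_energy[OF num n] by (simp add: C1_def mult_ac)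
      moreover have "C1 * \<epsilon>\<^sup>2 \<le> (C1 + C2) * \<epsilon>\<^sup>2" using C by (intro mult_right_mono) auto
      ultimately show ?thesis by linarith
    next
      case False
      then have "1 \<le> 2 * c * \<tau>" by simp
      also have "\<dots> \<le> 2 * c * \<epsilon>" using tau c(1) by simp
      finally have "1 \<le> (2 * c * \<epsilon>)\<^sup>2" by simp
      then have "(XR - XL) * K\<^sup>2 * 1 \<le> (XR - XL) * K\<^sup>2 * (2 * c * \<epsilon>)\<^sup>2"
        using XLR by (intro mult_left_mono) auto
      also have "\<dots> = C2 * \<epsilon>\<^sup>2" by (simp add: C2_def power_mult_distrib)
      also have "\<dots> \<le> (C1 + C2) * \<epsilon>\<^sup>2" using C by (intro mult_right_mono) auto
      finally show ?thesis using cell_error_le_const[OF num n] by linarith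
    qed
    then show "cell_error N M xh n \<le> (C1 + C2) * (timestep N + (mesh M)\<^sup>2)\<^sup>2"
      by (simp add: \<epsilon>_def \<tau>_def)
  qed
qed


section \<open>Slopes at the end points\<close>

lemma D_h_exact_adjacent:
  assumes i: "i \<in> {1..M - 1}" and t: "t \<in> {0..T}"
  shows "\<bar>D_h (mesh M) (exact (mesh M) t) (i + 1) - D_h (mesh M) (exact (mesh M) t) i\<bar> \<le> 2 * K * mesh M"
proof -
  have M: "1 \<le> M" and i1: "i \<in> {1..M}" "i + 1 \<in> {1..M}" using i by auto
  have cell: "\<exists>x \<in> {grid_pt XL (mesh M) (real j - 1)..grid_pt XL (mesh M) (real j)}.
      D_h (mesh M) (exact (mesh M) t) j = G 1 0 x t" if j: "j \<in> {1..M}" for j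
  proof -
    let ?a = "grid_pt XL (mesh M) (real j - 1)" and ?b = "grid_pt XL (mesh M) (real j)"
    note ab = D_h_exact(2-4)[OF j]
    obtain x where x: "x \<in> {?a<..<?b}" "G 0 0 ?b t - G 0 0 ?a t = G 1 0 x t * (?b - ?a)"
      using MVT_within[of ?a ?b "\<lambda>Y. G 0 0 Y t" "\<lambda>Y. G 1 0 Y t"] G_X_within[of 0 0 t ?a ?b] ab t by auto
    have "D_h (mesh M) (exact (mesh M) t) j = G 1 0 x t"
      unfolding D_h_exact(1)[OF j] using x ab t G0[of ?a t] G0[of ?b t] by simp
    then show ?thesis using x by (intro bexI[of _ x]) auto
  qed
  obtain x where x: "x \<in> {grid_pt XL (mesh M) (real i - 1)..grid_pt XL (mesh M) (real i)}"
    "D_h (mesh M) (exact (mesh M) t) i = G 1 0 x t" using cell[OF i1(1)] by blast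
  obtain y where y: "y \<in> {grid_pt XL (mesh M) (real (i + 1) - 1)..grid_pt XL (mesh M) (real (i + 1))}"
    "D_h (mesh M) (exact (mesh M) t) (i + 1) = G 1 0 y t" using cell[OF i1(2)] by blast
  have mem: "x \<in> {XL..XR}" "y \<in> {XL..XR}"
    using x(1) y(1) D_h_exact(3,4)[OF i1(1)] D_h_exact(3,4)[OF i1(2)] by auto
  have dist: "\<bar>y - x\<bar> \<le> 2 * mesh M"
    using x(1) y(1) mesh_pos[OF M] by (auto simp: grid_pt_def algebra_simps abs_le_iff)
  have "norm (G 1 0 y t - G 1 0 x t) \<le> K * norm (y - x)"
    by (rule field_differentiable_bound[where S = "{XL..XR}" and f' = "\<lambda>Y. G 2 0 Y t"])
       (use G_X[of 1 0 _ t] G_le[of 2 0 _ t] mem t in \<open>auto simp: numeral_2_eq_2\<close>)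
  also have "\<dots> \<le> K * (2 * mesh M)" using dist K_ge_1 by (intro mult_left_mono) auto
  finally show ?thesis unfolding x(2) y(2) by simp
qed

text \<open>
  For \<open>\<tau> \<le> h\<close> a single term of the cell error is \<open>O((\<tau> + h\<^sup>2)\<^sup>2 / h) = O(h)\<close>, so the numerical slopes are
  within \<open>O(\<surd>h)\<close> of the exact ones, which vary by \<open>O(h)\<close> between neighbours.  For \<open>\<tau> > h\<close> the scheme gives the
  density gradient at the node next to the boundary: it equals friction times velocity, and the node moves
  by at most \<open>K * h\<close> in time \<open>\<tau>\<close>.  Hence the densities of the two cells differ by \<open>O(h\<^sup>2 / \<tau>) = O(h)\<close>, and so do
  the slopes, \<open>f\<^sub>0\<close> being Lipschitz continuous.
\<close>

lemma boundary_gradient: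
  obtains C where "0 < C"
    "\<And>N M xh n i. numerical N M xh \<Longrightarrow> n \<le> N \<Longrightarrow> 2 \<le> M \<Longrightarrow> mesh M \<le> 1 \<Longrightarrow> i = 1 \<or> i = M - 1 \<Longrightarrow>
      \<bar>D_h (mesh M) (xh n) (i + 1) - D_h (mesh M) (xh n) i\<bar> \<le> C * sqrt (mesh M)"
proof -
  obtain CR where CR: "0 < CR"
    "\<And>N M xh n. numerical N M xh \<Longrightarrow> n \<le> N \<Longrightarrow> cell_error N M xh n \<le> CR * (timestep N + (mesh M)\<^sup>2)\<^sup>2"
    using cell_error_bound by blast
  obtain L where L: "0 < L"
    "\<And>x y. x \<in> {XL<..<XR} \<Longrightarrow> y \<in> {XL<..<XR} \<Longrightarrow> \<bar>f0 x - f0 y\<bar> \<le> L * \<bar>x - y\<bar>"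
    using f0_Lipschitz by blast
  obtain a0 a1 La where A: "0 < a0" "0 < a1" "0 \<le> La"
    "\<And>f p. bf \<le> f \<Longrightarrow> f \<le> Bf \<Longrightarrow> lo \<le> p \<Longrightarrow> p \<le> K \<Longrightarrow> a0 \<le> friction m f p \<and> friction m f p \<le> a1"
    "\<And>f p q. bf \<le> f \<Longrightarrow> f \<le> Bf \<Longrightarrow> lo \<le> p \<Longrightarrow> p \<le> K \<Longrightarrow> lo \<le> q \<Longrightarrow> q \<le> K \<Longrightarrow>
       \<bar>friction m f p - friction m f q\<bar> \<le> La * \<bar>p - q\<bar>"
    using friction_bounds[OF m bf lo(1), of Bf K] by blast
  define Ca where "Ca = 2 * K + 4 * sqrt CR"
  define Cb where "Cb = (L + K * (a1 * K)) / bf"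
  have Ca: "0 < Ca" unfolding Ca_def using K_ge_1 CR by (intro add_pos_pos) auto
  have Cb: "0 < Cb" unfolding Cb_def using K_ge_1 A L bf by (intro divide_pos_pos add_pos_pos mult_pos_pos) auto
  show thesis
  proof
    show "0 < Ca + Cb" using Ca Cb by simp
    fix N M :: nat and xh n i
    assume num: "numerical N M xh" and n: "n \<le> N" and M: "2 \<le> M" and h1: "mesh M \<le> 1" and i: "i = 1 \<or> i = M - 1"
    note nd = numericalD[OF num]
    define h where "h = mesh M"
    define \<tau> where "\<tau> = timestep N"
    define p where "p = D_h h (xh n)"
    have h: "0 < h" "h \<le> 1" and tau: "0 < \<tau>" using nd h1 by (auto simp: h_def \<tau>_def)
    have i': "i \<in> {1..M - 1}" "i \<in> {1..M}" "i + 1 \<in> {1..M}" using i M by auto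
    have h_sqrt: "h \<le> sqrt h" using h by (simp add: real_le_rsqrt power2_eq_square)
    have "\<bar>p (i + 1) - p i\<bar> \<le> (Ca + Cb) * sqrt h"
    proof (cases "\<tau> \<le> h")
      case True
      define q where "q = D_h h (exact h (real n * \<tau>))"
      have "h\<^sup>2 \<le> h" using h by (simp add: power2_eq_square mult_left_le)
      then have \<epsilon>: "\<tau> + h\<^sup>2 \<le> 2 * h" using True by linarith
      have err: "\<bar>p j - q j\<bar> \<le> 2 * sqrt CR * sqrt h" if j: "j \<in> {1..M}" for j
      proof -
        have "(p j - q j)\<^sup>2 \<le> (\<Sum>j=1..M. (p j - q j)\<^sup>2)"
          by (rule member_le_sum) (use j in auto)
        then have "h * (p j - q j)\<^sup>2 \<le> cell_error N M xh n"
          unfolding cell_error_def p_def q_def h_def \<tau>_def using nd(4) by (intro mult_left_mono) auto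
        also have "\<dots> \<le> CR * (\<tau> + h\<^sup>2)\<^sup>2" using CR(2)[OF num n] by (simp add: h_def \<tau>_def)
        also have "\<dots> \<le> CR * (2 * h)\<^sup>2"
          using CR(1) \<epsilon> tau h by (intro mult_left_mono power_mono) auto
        also have "\<dots> = h * (2 * sqrt CR * sqrt h)\<^sup>2"
          using CR(1) h by (simp add: power_mult_distrib) (simp add: power2_eq_square)
        finally have "(p j - q j)\<^sup>2 \<le> (2 * sqrt CR * sqrt h)\<^sup>2" using h by simp
        then have "\<bar>p j - q j\<bar> \<le> \<bar>2 * sqrt CR * sqrt h\<bar>" by (rule abs_le_square_iff[THEN iffD2])
        then show ?thesis using CR(1) h by (simp add: abs_mult)
      qed
      have "\<bar>q (i + 1) - q i\<bar> \<le> 2 * K * h"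
        using D_h_exact_adjacent[OF i'(1) time_mem[OF nd(1) n]] by (simp add: q_def h_def \<tau>_def)
      also have "\<dots> \<le> 2 * K * sqrt h" using h_sqrt K_ge_1 by (intro mult_left_mono) auto
      finally have "\<bar>p (i + 1) - p i\<bar> \<le> 2 * K * sqrt h + 2 * sqrt CR * sqrt h + 2 * sqrt CR * sqrt h"
        using err[OF i'(2)] err[OF i'(3)] by linarith
      also have "\<dots> = Ca * sqrt h" by (simp add: Ca_def algebra_simps)
      also have "\<dots> \<le> (Ca + Cb) * sqrt h" using Cb h by (intro mult_right_mono) auto
      finally show ?thesis .
    next
      case False
      show ?thesis
      proof (cases n)
        \<comment> \<open>The initial data do not come from a step of the scheme, but their slopes are all \<open>1\<close>.\<close>
        case 0
        have "p j = 1" if "j \<in> {1..M}" for j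
          using that h(1) nd(5)[of j] nd(5)[of "j - 1"] unfolding p_def 0
          by (auto simp: D_h_def grid_pt_def of_nat_diff field_simps h_def)
        then show ?thesis using i'(2,3) Ca Cb h by simp
      next
        case (Suc k)
        then have k: "k < N" "k \<le> N" using n by auto
        define \<phi> where "\<phi> = (\<lambda>j. f0_cell h j / p j)"
        define a where "a = friction m (f0 (grid_pt XL h (real i))) (Dt_h h M (xh k) i)"
        have pb: "lo \<le> p j \<and> p j \<le> K" if "j \<in> {1..M}" for j
          using numerical_bounds(3,4)[OF num n that] by (simp add: p_def h_def)
        have \<phi>b: "bf \<le> \<phi> j \<and> \<phi> j \<le> Bf" if "j \<in> {1..M}" for j
          using numerical_bounds(1,2)[OF num n that] by (simp add: \<phi>_def p_def h_def)
        have Dt: "lo \<le> Dt_h h M (xh k) i" "Dt_h h M (xh k) i \<le> K"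
          using Dt_h_interior_bounds[OF h(1) i'(1), of lo "xh k" K] numerical_bounds(3,4)[OF num k(2)]
          unfolding h_def by auto
        have "grid_pt XL h (real i) \<in> {XL..XR}" unfolding h_def using i' by (intro grid_pt_mem) auto
        then have a: "\<bar>a\<bar> \<le> a1"
          using A(1) A(4)[OF _ _ Dt, of "f0 (grid_pt XL h (real i))"] f0 by (fastforce simp: a_def)
        have D1: "x i - x (i - 1) = h * D_h h x i" "x (i + 1) - x i = h * D_h h x (i + 1)" for x
          using h(1) by (auto simp: D_h_def)
        have disp: "\<bar>xh n i - xh k i\<bar> \<le> h * K"
        proof -
          have b: "lo \<le> D_h h (xh k) j \<and> D_h h (xh k) j \<le> K" if "j \<in> {1..M}" for j
            using numerical_bounds(3,4)[OF num k(2) that] by (simp add: h_def)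
          have *: "\<bar>D_h h (xh n) j - D_h h (xh k) j\<bar> \<le> K" if "j \<in> {1..M}" for j
            using pb[OF that] b[OF that] lo unfolding p_def by linarith
          from i show ?thesis
          proof
            assume "i = 1"
            then have "xh n i - xh k i = h * (D_h h (xh n) i - D_h h (xh k) i)"
              using D1(1)[of "xh n"] D1(1)[of "xh k"] nd(6)[OF n] nd(6)[OF k(2)] by (simp add: right_diff_distrib)
            then show ?thesis using *[OF i'(2)] h(1) by (simp add: abs_mult)
          next
            assume "i = M - 1"
            then have "i + 1 = M" using M by simp
            then have "xh n i - xh k i = - (h * (D_h h (xh n) (i + 1) - D_h h (xh k) (i + 1)))"
              using D1(2)[of "xh n"] D1(2)[of "xh k"] nd(7)[OF n] nd(7)[OF k(2)] by (simp add: right_diff_distrib)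
            then show ?thesis using *[OF i'(3)] h(1) by (simp add: abs_mult)
          qed
        qed
        have "a * ((xh n i - xh k i) / \<tau>) = - ((\<phi> (i + 1) - \<phi> i) / h)"
          using nd(9)[OF k(1) i'(1)] by (simp add: a_def \<phi>_def p_def d_h_def Suc h_def \<tau>_def)
        then have "\<phi> (i + 1) - \<phi> i = - (h / \<tau> * (a * (xh n i - xh k i)))"
          using h(1) by (simp add: field_simps)
        then have "\<bar>\<phi> (i + 1) - \<phi> i\<bar> = h / \<tau> * (\<bar>a\<bar> * \<bar>xh n i - xh k i\<bar>)"
          using h(1) tau by (simp add: abs_mult)
        also have "\<dots> \<le> 1 * (a1 * (h * K))"
          using False h(1) tau a disp by (intro mult_mono) auto
        finally have \<phi>d: "\<bar>\<phi> (i + 1) - \<phi> i\<bar> \<le> a1 * K * h" by (simp add: mult_ac)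
        have fd: "\<bar>f0_cell h (i + 1) - f0_cell h i\<bar> \<le> L * h"
        proof -
          have "grid_pt XL h (real (i + 1) - 1 / 2) \<in> {XL<..<XR}" "grid_pt XL h (real i - 1 / 2) \<in> {XL<..<XR}"
            unfolding h_def using i' M by (auto simp del: greaterThanLessThan_iff intro!: grid_pt_interior)
          from L(2)[OF this] show ?thesis using h(1) by (simp add: f0_cell_def grid_pt_def algebra_simps)
        qed
        have ppos: "0 < p i" "0 < p (i + 1)" using pb i' lo by force+
        have fp: "f0_cell h j = \<phi> j * p j" if "j \<in> {i, i + 1}" for j
          using that ppos by (auto simp: \<phi>_def)
        have "\<phi> (i + 1) * (p (i + 1) - p i) = (f0_cell h (i + 1) - f0_cell h i) - p i * (\<phi> (i + 1) - \<phi> i)"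
          using fp[of i] fp[of "i + 1"] by (simp add: algebra_simps)
        then have "\<bar>\<phi> (i + 1) * (p (i + 1) - p i)\<bar> \<le> \<bar>f0_cell h (i + 1) - f0_cell h i\<bar> + \<bar>p i * (\<phi> (i + 1) - \<phi> i)\<bar>"
          by linarith
        also have "\<dots> \<le> L * h + K * (a1 * K * h)"
          unfolding abs_mult using fd \<phi>d pb[OF i'(2)] ppos A(2) K_ge_1 h by (intro add_mono mult_mono) auto
        finally have "\<bar>\<phi> (i + 1) * (p (i + 1) - p i)\<bar> \<le> (L + K * (a1 * K)) * h" by (simp add: algebra_simps)
        moreover have "bf * \<bar>p (i + 1) - p i\<bar> \<le> \<bar>\<phi> (i + 1) * (p (i + 1) - p i)\<bar>"
          unfolding abs_mult using \<phi>b[OF i'(3)] by (intro mult_right_mono) auto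
        ultimately have "\<bar>p (i + 1) - p i\<bar> \<le> Cb * h"
          using bf by (simp add: Cb_def pos_le_divide_eq mult.commute)
        also have "\<dots> \<le> Cb * sqrt h" using Cb h_sqrt by simp
        also have "\<dots> \<le> (Ca + Cb) * sqrt h" using Ca h by (intro mult_right_mono) auto
        finally show ?thesis .
      qed
    qed
    then show "\<bar>D_h (mesh M) (xh n) (i + 1) - D_h (mesh M) (xh n) i\<bar> \<le> (Ca + Cb) * sqrt (mesh M)"
      by (simp add: p_def h_def)
  qed
qed

text \<open>
  At the left end \<open>Dt_h\<close> equals \<open>p\<^sub>1 - (p\<^sub>2 - p\<^sub>1) / 2\<close>, and the mesh is chosen so fine that
  \<open>|p\<^sub>2 - p\<^sub>1| \<le> lo \<le> p\<^sub>1\<close>.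
\<close>

lemma Dt_h_numerical_lower:
  obtains h0 where "0 < h0"
    "\<And>N M xh n i. numerical N M xh \<Longrightarrow> n \<le> N \<Longrightarrow> 2 \<le> M \<Longrightarrow> mesh M \<le> h0 \<Longrightarrow> i \<le> M \<Longrightarrow>
      lo / 2 \<le> Dt_h (mesh M) M (xh n) i"
proof -
  obtain C where C: "0 < C"
    "\<And>N M xh n i. numerical N M xh \<Longrightarrow> n \<le> N \<Longrightarrow> 2 \<le> M \<Longrightarrow> mesh M \<le> 1 \<Longrightarrow> i = 1 \<or> i = M - 1 \<Longrightarrow>
      \<bar>D_h (mesh M) (xh n) (i + 1) - D_h (mesh M) (xh n) i\<bar> \<le> C * sqrt (mesh M)"
    using boundary_gradient by blast
  show thesis
  proof
    show "0 < min 1 ((lo / C)\<^sup>2)" using C lo by simp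
    fix N M :: nat and xh n i
    assume num: "numerical N M xh" and n: "n \<le> N" and M: "2 \<le> M" and h: "mesh M \<le> min 1 ((lo / C)\<^sup>2)" and i: "i \<le> M"
    note nd = numericalD[OF num]
    have "sqrt (mesh M) \<le> lo / C" using h C lo by (intro real_le_lsqrt) auto
    then have "C * sqrt (mesh M) \<le> lo" using C by (simp add: field_simps)
    then have g: "\<bar>D_h (mesh M) (xh n) (i + 1) - D_h (mesh M) (xh n) i\<bar> \<le> lo" if "i = 1 \<or> i = M - 1" for i
      using C(2)[OF num n M _ that] h by simp
    have p: "lo \<le> D_h (mesh M) (xh n) j" if "j \<in> {1..M}" for j
      using numerical_bounds(3)[OF num n that] .
    consider "i = 0" | "i = M" | "i \<in> {1..M - 1}" using i by force
    then show "lo / 2 \<le> Dt_h (mesh M) M (xh n) i"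
    proof cases
      case 1
      then show ?thesis
        unfolding 1 Dt_h_left[OF nd(4)] using g[of 1] p[of 1] M by (simp add: numeral_2_eq_2)
    next
      case 2
      then show ?thesis
        unfolding 2 Dt_h_right[OF nd(4) M] using g[of "M - 1"] p[of M] M by simp
    next
      case 3
      have "i \<in> {1..M}" "i + 1 \<in> {1..M}" using 3 by auto
      then show ?thesis
        unfolding Dt_h_interior[OF nd(4) 3] using p[of i] p[of "i + 1"] lo by simp
    qed
  qed
qed


section \<open>Error estimates\<close>

lemma cell_error_eq:
  "mesh M * (\<Sum>j=1..M. (D_h (mesh M) (\<lambda>i. exact (mesh M) (real n * timestep N) i - xh n i) j)\<^sup>2)
     = cell_error N M xh n"
  unfolding cell_error_def D_h_diff by (simp add: power2_commute)

lemma trajectory_error: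
  obtains C where "0 < C"
    "\<And>N M xh n. numerical N M xh \<Longrightarrow> n \<le> N \<Longrightarrow>
      grid_inner (mesh M) M (\<lambda>i. exact (mesh M) (real n * timestep N) i - xh n i)
        (\<lambda>i. exact (mesh M) (real n * timestep N) i - xh n i) \<le> C * (timestep N + (mesh M)\<^sup>2)\<^sup>2"
proof -
  obtain CR where CR: "0 < CR"
    "\<And>N M xh n. numerical N M xh \<Longrightarrow> n \<le> N \<Longrightarrow> cell_error N M xh n \<le> CR * (timestep N + (mesh M)\<^sup>2)\<^sup>2"
    using cell_error_bound by blast
  show thesis
  proof
    show "0 < (XR - XL)\<^sup>2 * CR" using CR XLR by simp
    fix N M :: nat and xh n assume num: "numerical N M xh" and n: "n \<le> N"
    note nd = numericalD[OF num]
    let ?e = "\<lambda>i. exact (mesh M) (real n * timestep N) i - xh n i"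
    have "?e 0 = 0" using exact_boundary(1)[OF nd(2) time_mem[OF nd(1) n]] nd(6)[OF n] by simp
    from grid_inner_le_of_D_h[of "mesh M" M ?e, OF nd(4,2) this]
    have "grid_inner (mesh M) M ?e ?e \<le> (XR - XL)\<^sup>2 * cell_error N M xh n"
      unfolding cell_error_eq mesh_mult[OF nd(2)] .
    also have "\<dots> \<le> (XR - XL)\<^sup>2 * (CR * (timestep N + (mesh M)\<^sup>2)\<^sup>2)"
      by (intro mult_left_mono CR(2)[OF num n]) auto
    finally show "grid_inner (mesh M) M ?e ?e \<le> (XR - XL)\<^sup>2 * CR * (timestep N + (mesh M)\<^sup>2)\<^sup>2"
      by (simp only: mult.assoc)
  qed
qed

lemma slope_error:
  obtains C where "0 < C"
    "\<And>N M xh n. numerical N M xh \<Longrightarrow> n \<le> N \<Longrightarrow> 2 \<le> M \<Longrightarrow>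
      grid_inner (mesh M) M (Dt_h (mesh M) M (\<lambda>i. exact (mesh M) (real n * timestep N) i - xh n i))
        (Dt_h (mesh M) M (\<lambda>i. exact (mesh M) (real n * timestep N) i - xh n i)) \<le> C * (timestep N + (mesh M)\<^sup>2)\<^sup>2"
proof -
  obtain CR where CR: "0 < CR"
    "\<And>N M xh n. numerical N M xh \<Longrightarrow> n \<le> N \<Longrightarrow> cell_error N M xh n \<le> CR * (timestep N + (mesh M)\<^sup>2)\<^sup>2"
    using cell_error_bound by blast
  show thesis
  proof
    show "0 < 6 * CR" using CR by simp
    fix N M :: nat and xh n assume num: "numerical N M xh" and n: "n \<le> N" and M: "2 \<le> M"
    let ?e = "\<lambda>i. exact (mesh M) (real n * timestep N) i - xh n i"
    have "grid_inner (mesh M) M (Dt_h (mesh M) M ?e) (Dt_h (mesh M) M ?e) \<le> 6 * cell_error N M xh n"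
      using grid_inner_Dt_h_le[OF numericalD(4)[OF num] M, of ?e] unfolding cell_error_eq .
    then show "grid_inner (mesh M) M (Dt_h (mesh M) M ?e) (Dt_h (mesh M) M ?e) \<le> 6 * CR * (timestep N + (mesh M)\<^sup>2)\<^sup>2"
      using CR(2)[OF num n] by simp
  qed
qed

text \<open>
  Both densities are \<open>f\<^sub>0\<close> divided by a slope, so their difference is at most a constant times that of the
  slopes, once the numerical slope is bounded below at every node.
\<close>

lemma density_error:
  obtains C h0 where "0 < C" "0 < h0"
    "\<And>N M xh n. numerical N M xh \<Longrightarrow> n \<le> N \<Longrightarrow> 2 \<le> M \<Longrightarrow> mesh M \<le> h0 \<Longrightarrow>
      grid_inner (mesh M) M
        (\<lambda>i. numerical_density XL f0 (mesh M) M (xh n) i - exact_density XL XR f0 xe (mesh M) (real n * timestep N) i)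
        (\<lambda>i. numerical_density XL f0 (mesh M) M (xh n) i - exact_density XL XR f0 xe (mesh M) (real n * timestep N) i)
      \<le> C * (timestep N + (mesh M)\<^sup>2)\<^sup>2"
proof -
  obtain Ct where Ct: "0 < Ct"
    "\<And>N M xh n. numerical N M xh \<Longrightarrow> n \<le> N \<Longrightarrow> 2 \<le> M \<Longrightarrow>
      grid_inner (mesh M) M (Dt_h (mesh M) M (\<lambda>i. exact (mesh M) (real n * timestep N) i - xh n i))
        (Dt_h (mesh M) M (\<lambda>i. exact (mesh M) (real n * timestep N) i - xh n i)) \<le> Ct * (timestep N + (mesh M)\<^sup>2)\<^sup>2"
    using slope_error by blast
  obtain h0 where h0: "0 < h0"
    "\<And>N M xh n i. numerical N M xh \<Longrightarrow> n \<le> N \<Longrightarrow> 2 \<le> M \<Longrightarrow> mesh M \<le> h0 \<Longrightarrow> i \<le> M \<Longrightarrow>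
      lo / 2 \<le> Dt_h (mesh M) M (xh n) i"
    using Dt_h_numerical_lower by blast
  define c where "c = Bf / (lo / 2 * lo)"
  have c: "0 < c" using Bf_pos lo by (simp add: c_def)
  show thesis
  proof
    show "0 < 2 * c\<^sup>2 * Ct + (XR - XL) * (2 * c\<^sup>2 * (3 * K)\<^sup>2)"
      using c Ct XLR K_ge_1 by (intro add_pos_pos) auto
    show "0 < h0" by fact
    fix N M :: nat and xh n
    assume num: "numerical N M xh" and n: "n \<le> N" and M: "2 \<le> M" and h: "mesh M \<le> h0"
    note nd = numericalD[OF num]
    define t where "t = real n * timestep N"
    define \<epsilon> where "\<epsilon> = timestep N + (mesh M)\<^sup>2"
    have t: "t \<in> {0..T}" unfolding t_def by (rule time_mem[OF nd(1) n])
    let ?e = "\<lambda>i. exact (mesh M) t i - xh n i"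
    let ?d = "\<lambda>i. numerical_density XL f0 (mesh M) M (xh n) i - exact_density XL XR f0 xe (mesh M) t i"
    have pt: "(?d i)\<^sup>2 \<le> 2 * c\<^sup>2 * (Dt_h (mesh M) M ?e i)\<^sup>2 + 2 * c\<^sup>2 * (3 * K * (mesh M)\<^sup>2)\<^sup>2" if i: "i \<le> M" for i
    proof -
      define y where "y = grid_pt XL (mesh M) (real i)"
      define D where "D = Dt_h (mesh M) M (xh n) i"
      define w where "w = Dt_h (mesh M) M ?e i"
      have y: "y \<in> {XL..XR}" unfolding y_def using i nd(2) by (intro grid_pt_mem) auto
      have D: "lo / 2 \<le> D" unfolding D_def by (rule h0(2)[OF num n M h i])
      have g: "lo \<le> G 1 0 y t" by (rule lo_le[OF y t])
      have pos: "0 < D" "0 < G 1 0 y t" using D g lo by linarith+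
      have diff: "\<bar>G 1 0 y t - D\<bar> \<le> \<bar>w\<bar> + 3 * K * (mesh M)\<^sup>2"
        using Dt_h_exact[OF M i t] unfolding w_def Dt_h_diff D_def y_def by linarith
      have "?d i = f0 y * (G 1 0 y t - D) / (D * G 1 0 y t)"
        using pos by (simp add: numerical_density_def exact_density_def y_def[symmetric] D_def[symmetric] pd_X_eq[OF y t] field_simps)
      then have "\<bar>?d i\<bar> = f0 y * \<bar>G 1 0 y t - D\<bar> / (D * G 1 0 y t)"
        using pos f0[OF y] bf by (simp add: abs_mult)
      also have "\<dots> \<le> Bf * (\<bar>w\<bar> + 3 * K * (mesh M)\<^sup>2) / (lo / 2 * lo)"
        using diff f0[OF y] bf D g lo Bf_pos K_ge_1 by (intro frac_le mult_mono) auto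
      also have "\<dots> = c * (\<bar>w\<bar> + 3 * K * (mesh M)\<^sup>2)" by (simp add: c_def)
      finally have "(?d i)\<^sup>2 \<le> (c * (\<bar>w\<bar> + 3 * K * (mesh M)\<^sup>2))\<^sup>2"
        using power_mono[of "\<bar>?d i\<bar>" _ 2] by simp
      also have "\<dots> \<le> c\<^sup>2 * (2 * w\<^sup>2 + 2 * (3 * K * (mesh M)\<^sup>2)\<^sup>2)"
        unfolding power_mult_distrib[of c]
      proof (intro mult_left_mono)
        have "(a + b)\<^sup>2 \<le> 2 * a\<^sup>2 + 2 * b\<^sup>2" for a b :: real
          using zero_le_power2[of "a - b"] by (simp add: power2_eq_square algebra_simps)
        from this[of "\<bar>w\<bar>"] show "(\<bar>w\<bar> + 3 * K * (mesh M)\<^sup>2)\<^sup>2 \<le> 2 * w\<^sup>2 + 2 * (3 * K * (mesh M)\<^sup>2)\<^sup>2" by simp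
      qed auto
      finally show ?thesis by (simp add: w_def algebra_simps)
    qed
    have "grid_inner (mesh M) M ?d ?d
        \<le> 2 * c\<^sup>2 * grid_inner (mesh M) M (Dt_h (mesh M) M ?e) (Dt_h (mesh M) M ?e)
          + mesh M * real M * (2 * c\<^sup>2 * (3 * K * (mesh M)\<^sup>2)\<^sup>2)"
      by (rule grid_inner_mono[OF nd(4) pt]) (use nd(2) in auto)
    also have "\<dots> \<le> 2 * c\<^sup>2 * (Ct * \<epsilon>\<^sup>2) + (XR - XL) * (2 * c\<^sup>2 * (3 * K * \<epsilon>)\<^sup>2)"
      unfolding mesh_mult[OF nd(2)]
      using Ct(2)[OF num n M] XLR K_ge_1 nd(3)
      by (intro add_mono mult_left_mono power_mono) (auto simp: t_def \<epsilon>_def)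
    also have "\<dots> = (2 * c\<^sup>2 * Ct + (XR - XL) * (2 * c\<^sup>2 * (3 * K)\<^sup>2)) * \<epsilon>\<^sup>2"
      by (simp add: power_mult_distrib algebra_simps)
    finally show "grid_inner (mesh M) M
        (\<lambda>i. numerical_density XL f0 (mesh M) M (xh n) i - exact_density XL XR f0 xe (mesh M) (real n * timestep N) i)
        (\<lambda>i. numerical_density XL f0 (mesh M) M (xh n) i - exact_density XL XR f0 xe (mesh M) (real n * timestep N) i)
      \<le> (2 * c\<^sup>2 * Ct + (XR - XL) * (2 * c\<^sup>2 * (3 * K)\<^sup>2)) * (timestep N + (mesh M)\<^sup>2)\<^sup>2"
      by (simp only: t_def \<epsilon>_def)
  qed
qed

lemma error_estimate:
  "\<exists>C>0. \<exists>h0>0. \<forall>(N::nat) (M::nat) (xh::nat \<Rightarrow> nat \<Rightarrow> real).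
        1 \<le> N \<longrightarrow> 1 \<le> M \<longrightarrow> numerical_solution m T XL XR f0 N M xh \<longrightarrow>
        (\<forall>n\<le>N.
           let \<tau> = T / real N; h = (XR - XL) / real M; t = real n * \<tau>;
               e = (\<lambda>i. xe (grid_pt XL h (real i)) t - xh n i)
           in grid_norm h M e \<le> C * (\<tau> + h\<^sup>2) \<and>
              (2 \<le> M \<longrightarrow>
                 grid_norm h M (Dt_h h M e) \<le> C * (\<tau> + h\<^sup>2) \<and>
                 (h \<le> h0 \<longrightarrow>
                    grid_norm h M (\<lambda>i. numerical_density XL f0 h M (xh n) i
                                        - exact_density XL XR f0 xe h t i)
                      \<le> C * (\<tau> + h\<^sup>2))))"
proof -
  obtain Ce where Ce: "0 < Ce"
    "\<And>N M xh n. numerical N M xh \<Longrightarrow> n \<le> N \<Longrightarrow>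
      grid_inner (mesh M) M (\<lambda>i. exact (mesh M) (real n * timestep N) i - xh n i)
        (\<lambda>i. exact (mesh M) (real n * timestep N) i - xh n i) \<le> Ce * (timestep N + (mesh M)\<^sup>2)\<^sup>2"
    using trajectory_error by blast
  obtain Ct where Ct: "0 < Ct"
    "\<And>N M xh n. numerical N M xh \<Longrightarrow> n \<le> N \<Longrightarrow> 2 \<le> M \<Longrightarrow>
      grid_inner (mesh M) M (Dt_h (mesh M) M (\<lambda>i. exact (mesh M) (real n * timestep N) i - xh n i))
        (Dt_h (mesh M) M (\<lambda>i. exact (mesh M) (real n * timestep N) i - xh n i)) \<le> Ct * (timestep N + (mesh M)\<^sup>2)\<^sup>2"
    using slope_error by blast
  obtain Cd h0 where Cd: "0 < Cd" and h0: "0 < h0" and Cd':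
    "\<And>N M xh n. numerical N M xh \<Longrightarrow> n \<le> N \<Longrightarrow> 2 \<le> M \<Longrightarrow> mesh M \<le> h0 \<Longrightarrow>
      grid_inner (mesh M) M
        (\<lambda>i. numerical_density XL f0 (mesh M) M (xh n) i - exact_density XL XR f0 xe (mesh M) (real n * timestep N) i)
        (\<lambda>i. numerical_density XL f0 (mesh M) M (xh n) i - exact_density XL XR f0 xe (mesh M) (real n * timestep N) i)
      \<le> Cd * (timestep N + (mesh M)\<^sup>2)\<^sup>2"
    using density_error by blast
  define C where "C = Ce + Ct + Cd"
  have le: "0 \<le> Ce" "Ce \<le> C" "0 \<le> Ct" "Ct \<le> C" "0 \<le> Cd" "Cd \<le> C"
    using Ce(1) Ct(1) Cd by (auto simp: C_def)
  show ?thesis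
    unfolding Let_def mesh_def[symmetric] timestep_def[symmetric] exact_def[symmetric]
  proof (rule exI[of _ "1 + C"], rule conjI, goal_cases)
    case 1
    show ?case using le by linarith
  next
    case 2
    show ?case
    proof (rule exI[of _ h0], intro conjI allI impI)
      show "0 < h0" by (rule h0)
      fix N M :: nat and xh n
      assume NM: "1 \<le> N" "1 \<le> M" "numerical_solution m T XL XR f0 N M xh" and n: "n \<le> N"
      then have num: "numerical N M xh" by (simp add: numerical_def)
      have \<epsilon>: "0 \<le> timestep N + (mesh M)\<^sup>2" using timestep_pos[OF NM(1)] by simp
      show "grid_norm (mesh M) M (\<lambda>i. exact (mesh M) (real n * timestep N) i - xh n i)
          \<le> (1 + C) * (timestep N + (mesh M)\<^sup>2)"
        by (rule grid_norm_le_of_inner[OF le(1,2) \<epsilon> Ce(2)[OF num n]])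
      assume M: "2 \<le> M"
      show "grid_norm (mesh M) M (Dt_h (mesh M) M (\<lambda>i. exact (mesh M) (real n * timestep N) i - xh n i))
          \<le> (1 + C) * (timestep N + (mesh M)\<^sup>2)"
        by (rule grid_norm_le_of_inner[OF le(3,4) \<epsilon> Ct(2)[OF num n M]])
      assume h: "mesh M \<le> h0"
      show "grid_norm (mesh M) M
          (\<lambda>i. numerical_density XL f0 (mesh M) M (xh n) i - exact_density XL XR f0 xe (mesh M) (real n * timestep N) i)
          \<le> (1 + C) * (timestep N + (mesh M)\<^sup>2)"
        by (rule grid_norm_le_of_inner[OF le(5,6) \<epsilon> Cd'[OF num n M h]])
    qed
  qed
qed

end

text \<open>
  All constants come from compactness of the closed rectangle.
\<close>

lemma regular_trajectory_exists:
  assumes m: "1 < m" and T: "0 < T" and XLR: "XL < XR" and bf: "0 < bf"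
    and f0: "\<forall>X\<in>{XL..XR}. bf \<le> f0 X \<and> f0 X \<le> Bf"
    and Ck: "Ck_rect 4 XL XR T xe" and sol: "trajectory_solution m T XL XR f0 xe"
  obtains K lo G where "regular_trajectory m T XL XR bf Bf K lo f0 xe G"
proof -
  obtain G where G0: "\<forall>X\<in>{XL..XR}. \<forall>t\<in>{0..T}. G 0 0 X t = xe X t"
    and cont: "\<And>i j. i + j \<le> (4::nat) \<Longrightarrow> continuous_on ({XL..XR} \<times> {0..T}) (\<lambda>(X, t). G i j X t)"
    and der: "\<And>i j X t. i + j < (4::nat) \<Longrightarrow> X \<in> {XL..XR} \<Longrightarrow> t \<in> {0..T} \<Longrightarrow>
           ((\<lambda>Y. G i j Y t) has_real_derivative G (Suc i) j X t) (at X within {XL..XR}) \<and>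
           ((\<lambda>s. G i j X s) has_real_derivative G i (Suc j) X t) (at t within {0..T})"
    using Ck unfolding Ck_rect_def by blast
  have cpt: "compact ({XL..XR} \<times> {0..T})" by (intro compact_Times compact_Icc)
  have ne: "{XL..XR} \<times> {0..T} \<noteq> {}" using XLR T by auto
  have "\<exists>B. \<forall>X\<in>{XL..XR}. \<forall>t\<in>{0..T}. \<bar>G i j X t\<bar> \<le> B" if "i + j \<le> 4" for i j
  proof -
    have "bounded ((\<lambda>(X, t). G i j X t) ` ({XL..XR} \<times> {0..T}))"
      by (intro compact_imp_bounded compact_continuous_image cont[OF that] cpt)
    then show ?thesis unfolding bounded_iff by force
  qed
  then obtain b where b: "\<And>i j X t. i + j \<le> 4 \<Longrightarrow> X \<in> {XL..XR} \<Longrightarrow> t \<in> {0..T} \<Longrightarrow> \<bar>G i j X t\<bar> \<le> b i j"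
    by metis
  define K where "K = Bf / bf + (\<Sum>i\<le>4. \<Sum>j\<le>4. \<bar>b i j\<bar>)"
  have Bf: "0 < Bf" using f0 bf XLR by (metis atLeastAtMost_iff less_le_trans order_refl less_imp_le)
  have K: "\<bar>G i j X t\<bar> \<le> K" if ij: "i + j \<le> 4" and Xt: "X \<in> {XL..XR}" "t \<in> {0..T}" for i j X t
  proof -
    have "\<bar>b i j\<bar> \<le> (\<Sum>j\<le>4. \<bar>b i j\<bar>)" by (rule member_le_sum) (use ij in auto)
    also have "\<dots> \<le> (\<Sum>i\<le>4. \<Sum>j\<le>4. \<bar>b i j\<bar>)"
      by (rule member_le_sum[where f = "\<lambda>i. \<Sum>j\<le>4. \<bar>b i j\<bar>"]) (use ij in \<open>auto intro: sum_nonneg\<close>)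
    also have "\<dots> \<le> K" using Bf bf by (simp add: K_def)
    finally show ?thesis using b[OF ij Xt] by linarith
  qed
  have G1: "0 < G 1 0 X t" if Xt: "X \<in> {XL..XR}" "t \<in> {0..T}" for X t
  proof -
    have "((\<lambda>Y. xe Y t) has_real_derivative G 1 0 X t) (at X within {XL..XR})"
      using der[of 0 0 X t] Xt G0
      by (auto intro: has_field_derivative_transform_within[where d = 1])
    then have "pd_X XL XR xe X t = G 1 0 X t" by (rule pd_X_eqI[OF XLR Xt(1)])
    then show ?thesis using sol Xt unfolding trajectory_solution_def by metis
  qed
  obtain z where z: "z \<in> {XL..XR} \<times> {0..T}"
    "\<forall>y\<in>{XL..XR} \<times> {0..T}. (\<lambda>(X, t). G 1 0 X t) z \<le> (\<lambda>(X, t). G 1 0 X t) y"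
    using continuous_attains_inf[OF cpt ne cont[of 1 0]] by auto
  define lo where "lo = min (bf / Bf) (G 1 0 (fst z) (snd z))"
  have "regular_trajectory m T XL XR bf Bf K lo f0 xe G"
  proof
    show "0 < lo" using G1[of "fst z" "snd z"] z(1) bf Bf by (auto simp: lo_def)
    show "lo \<le> bf / Bf" by (simp add: lo_def)
    show "Bf / bf \<le> K" by (simp add: K_def sum_nonneg)
    show "lo \<le> G 1 0 X t" if "X \<in> {XL..XR}" "t \<in> {0..T}" for X t
      using bspec[OF z(2), of "(X, t)"] that by (auto simp: lo_def case_prod_unfold)
  qed (use m T XLR bf f0 G0 der K sol in auto)
  then show thesis by (rule that)
qed

theorem theorem3p2:
  "\<exists>k::nat. \<forall>(m::real) (T::real) (XL::real) (XR::real) (f0::real \<Rightarrow> real) (bf::real) (Bf::real)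
      (xe::real \<Rightarrow> real \<Rightarrow> real).
     1 < m \<longrightarrow> 0 < T \<longrightarrow> XL < XR \<longrightarrow>
     0 < bf \<longrightarrow> (\<forall>X\<in>{XL..XR}. bf \<le> f0 X \<and> f0 X \<le> Bf) \<longrightarrow>
     Ck_rect k XL XR T xe \<longrightarrow> trajectory_solution m T XL XR f0 xe \<longrightarrow>
     (\<exists>C>0. \<exists>h0>0. \<forall>(N::nat) (M::nat) (xh::nat \<Rightarrow> nat \<Rightarrow> real).
        1 \<le> N \<longrightarrow> 1 \<le> M \<longrightarrow> numerical_solution m T XL XR f0 N M xh \<longrightarrow>
        (\<forall>n\<le>N.
           let \<tau> = T / real N; h = (XR - XL) / real M; t = real n * \<tau>;
               e = (\<lambda>i. xe (grid_pt XL h (real i)) t - xh n i)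
           in grid_norm h M e \<le> C * (\<tau> + h\<^sup>2) \<and>
              (2 \<le> M \<longrightarrow>
                 grid_norm h M (Dt_h h M e) \<le> C * (\<tau> + h\<^sup>2) \<and>
                 (h \<le> h0 \<longrightarrow>
                    grid_norm h M (\<lambda>i. numerical_density XL f0 h M (xh n) i
                                        - exact_density XL XR f0 xe h t i)
                      \<le> C * (\<tau> + h\<^sup>2)))))"
  by (rule exI[of _ 4], intro allI impI, rule regular_trajectory_exists, assumption+,
      erule regular_trajectory.error_estimate)

end
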